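(* Let $\varphi:\mathbb{P}^n\dashrightarrow\mathbf{S}\subset\mathbb{P}^{n+1}$ be a quadratic birational transformation with base locus $\mathfrak{B}$ and whose image is a normal hypersurface $\mathbf{S}\subset\mathbb{P}^{n+1}$ which is not a hyperplane. The following conditions are equivalent: (1) $h^0(\mathbb{P}^n,\mathcal{I}_{\mathfrak{B}}(1))\neq 0$; (2) $\mathfrak{B}$ is a quadric of codimension $2$ in $\mathbb{P}^n$; (3) $\mathfrak{B}$ is a complete intersection in $\mathbb{P}^n$; (4) $\varphi$ is of type $(2,1)$. Moreover, if one of these conditions is satisfied, then $\mathbf{S}$ is a quadric and $\mathrm{rk}(\mathfrak{B})=\mathrm{rk}(\mathbf{S})-2$.
   Context: Everything is over $\mathbb{C}$. A birational transformation $\varphi:\mathbb{P}^n\dashrightarrow\overline{\varphi(\mathbb{P}^n)}=\mathbf{S}\subset\mathbb{P}^{n+1}$ (birational onto its image closure $\mathbf{S}$) is quadratic if it is defined by a linear system of quadrics without fixed component; its base locus $\mathfrak{B}\subset\mathbb{P}^n$ is the base scheme of this linear system, with ideal sheaf $\mathcal{I}_{\mathfrak{B}}$. It is of type $(2,d)$ if it is quadratic and $\varphi^{-1}$ can be defined by a linear system contained in $|\mathcal{O}_{\mathbf{S}}(d)|$, with $d$ minimal with this property. A quadric of codimension $2$ in $\mathbb{P}^n$ is a quadric hypersurface (a subscheme defined by one nonzero quadratic form) in some hyperplane of $\mathbb{P}^n$. The rank $\mathrm{rk}$ of a quadric hypersurface in a projective space is the rank of the quadratic form defining it in that space (for $\mathfrak{B}$: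 in the hyperplane containing it). *)

theory Defs
  imports
    Complex_Main
    "HOL-Library.Poly_Mapping"
    "HOL-Algebra.Ideal"
    "Jordan_Normal_Form.DL_Rank"
begin

section \<open>Polynomials and forms\<close>

text \<open>
  Homogeneous coordinates on the projective space of dimension \<open>N\<close> are \<open>x\<^sub>0, \<dots>, x\<^sub>N\<close>.
  Polynomials are finitely supported families of complex coefficients indexed by monomials
  (exponent vectors); \<open>poly_ring N\<close> is the ring of those involving only \<open>x\<^sub>0, \<dots>, x\<^sub>N\<close>.
\<close>

type_synonym cpoly = "(nat \<Rightarrow>\<^sub>0 nat) \<Rightarrow>\<^sub>0 complex"

definition Var :: "nat \<Rightarrow> cpoly" where
  "Var i = Poly_Mapping.single (Poly_Mapping.single i 1) 1"

definition Const :: "complex \<Rightarrow> cpoly" where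
  "Const c = Poly_Mapping.single 0 c"

definition monom_degree :: "(nat \<Rightarrow>\<^sub>0 nat) \<Rightarrow> nat" where
  "monom_degree m = (\<Sum>i\<in>Poly_Mapping.keys m. Poly_Mapping.lookup m i)"

definition poly_ring :: "nat \<Rightarrow> cpoly ring" where
  "poly_ring N = \<lparr>carrier = {p. \<forall>m\<in>Poly_Mapping.keys p. Poly_Mapping.keys m \<subseteq> {..N}},
                  monoid.mult = (*), one = 1, zero = 0, add = (+)\<rparr>"

text \<open>As usual, the zero polynomial is a form of every degree.\<close>

definition forms :: "nat \<Rightarrow> nat \<Rightarrow> cpoly set" where
  "forms N d = {p \<in> carrier (poly_ring N). \<forall>m\<in>Poly_Mapping.keys p. monom_degree m = d}"

text \<open>Evaluation of \<open>p\<close> at \<open>g\<close> in a commutative ring, along the homomorphism \<open>h\<close> on coefficients.\<close>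

definition insertion :: "(complex \<Rightarrow> 'a::comm_ring_1) \<Rightarrow> (nat \<Rightarrow> 'a) \<Rightarrow> cpoly \<Rightarrow> 'a" where
  "insertion h g p = (\<Sum>m\<in>Poly_Mapping.keys p. h (Poly_Mapping.lookup p m) * (\<Prod>i\<in>Poly_Mapping.keys m. g i ^ Poly_Mapping.lookup m i))"

definition eval_at :: "complex vec \<Rightarrow> cpoly \<Rightarrow> complex" where
  "eval_at v p = insertion id (\<lambda>i. v $ i) p"

definition subst :: "(nat \<Rightarrow> cpoly) \<Rightarrow> cpoly \<Rightarrow> cpoly" where
  "subst g p = insertion Const g p"


section \<open>Closed subschemes of projective space\<close>

text \<open>
  A closed subscheme \<open>Z\<close> of the projective space of dimension \<open>N\<close> is represented by its
  saturated homogeneous ideal, i.e. by the direct sum over \<open>m\<close> of the spaces of global sections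
  of \<open>I\<^sub>Z(m)\<close>; two homogeneous ideals define the same subscheme iff they have the same saturation.
  If \<open>Z\<close> is cut out by a set \<open>G\<close> of forms, then \<open>p\<close> lies in that ideal iff, on each of the
  standard charts \<open>x\<^sub>i \<noteq> 0\<close>, it lies in the localisation of the ideal generated by \<open>G\<close>.
\<close>

definition subscheme :: "nat \<Rightarrow> cpoly set \<Rightarrow> cpoly set" where
  "subscheme N G = {p \<in> carrier (poly_ring N).
     \<forall>i\<le>N. \<exists>k. Var i ^ k * p \<in> genideal (poly_ring N) G}"

definition h0_ideal_sheaf :: "nat \<Rightarrow> cpoly set \<Rightarrow> nat \<Rightarrow> nat" where
  "h0_ideal_sheaf N Z m = vector_space.dim (\<lambda>c p. Const c * p) (Z \<inter> forms N m)"

text \<open>Points are given by nonzero vectors of homogeneous coordinates.\<close>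

definition zero_points :: "nat \<Rightarrow> cpoly set \<Rightarrow> complex vec set" where
  "zero_points N Z = {v \<in> carrier_vec (N + 1). v \<noteq> 0\<^sub>v (N + 1) \<and> (\<forall>p\<in>Z. eval_at v p = 0)}"

definition vanishing_ideal :: "nat \<Rightarrow> complex vec set \<Rightarrow> cpoly set" where
  "vanishing_ideal N Y =
     genideal (poly_ring N) {p. (\<exists>d. p \<in> forms N d) \<and> (\<forall>v\<in>Y. eval_at v p = 0)}"

definition hypersurface :: "nat \<Rightarrow> nat \<Rightarrow> cpoly set \<Rightarrow> bool" where
  "hypersurface N e Z \<longleftrightarrow> e > 0 \<and> (\<exists>F. F \<in> forms N e \<and> F \<noteq> 0 \<and> Z = subscheme N {F})"

text \<open>
  \<open>Z\<close> is the scheme-theoretic intersection of hypersurfaces whose equations form a regular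
  sequence; its codimension is then the number of the equations (the empty scheme, of
  codimension \<open>N + 1\<close>, is thus a complete intersection).
\<close>

definition regular_sequence :: "nat \<Rightarrow> cpoly list \<Rightarrow> bool" where
  "regular_sequence N fs \<longleftrightarrow>
     (\<forall>i<length fs. \<forall>p\<in>carrier (poly_ring N).
        fs ! i * p \<in> genideal (poly_ring N) (set (take i fs)) \<longrightarrow>
        p \<in> genideal (poly_ring N) (set (take i fs)))"

definition complete_intersection :: "nat \<Rightarrow> cpoly set \<Rightarrow> bool" where
  "complete_intersection N Z \<longleftrightarrow>
     (\<exists>fs. (\<forall>F\<in>set fs. \<exists>d>0. F \<in> forms N d) \<and> regular_sequence N fs \<and> Z = subscheme N (set fs))"


section \<open>Quadrics and their ranks\<close>

text \<open>The symmetric matrix of a quadratic form in \<open>x\<^sub>0, \<dots>, x\<^sub>N\<close>.\<close>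

definition gram :: "nat \<Rightarrow> cpoly \<Rightarrow> complex mat" where
  "gram N Q = mat (N + 1) (N + 1) (\<lambda>(i, j).
     Poly_Mapping.lookup Q (Poly_Mapping.single i 1 + Poly_Mapping.single j 1) / (if i = j then 1 else 2))"

definition quadric_of_rank :: "nat \<Rightarrow> cpoly set \<Rightarrow> nat \<Rightarrow> bool" where
  "quadric_of_rank N Z r \<longleftrightarrow>
     (\<exists>Q. Q \<in> forms N 2 \<and> Q \<noteq> 0 \<and> Z = subscheme N {Q} \<and> r = vec_space.rank (N + 1) (gram N Q))"

text \<open>
  A quadric in the hyperplane \<open>l = 0\<close> is cut out there by the class modulo \<open>l\<close> of a quadratic
  form \<open>q\<close>, and this class has to be nonzero.
\<close>

definition quadric_in_hyperplane :: "nat \<Rightarrow> cpoly set \<Rightarrow> cpoly \<Rightarrow> cpoly \<Rightarrow> bool" where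
  "quadric_in_hyperplane N Z l q \<longleftrightarrow>
     l \<in> forms N 1 \<and> l \<noteq> 0 \<and> q \<in> forms N 2 \<and> q \<notin> genideal (poly_ring N) {l} \<and>
     Z = subscheme N {l, q}"

definition codim2_quadric :: "nat \<Rightarrow> cpoly set \<Rightarrow> bool" where
  "codim2_quadric N Z \<longleftrightarrow> (\<exists>l q. quadric_in_hyperplane N Z l q)"

text \<open>
  The rank is that of the form on the hyperplane, computed in linear coordinates \<open>A\<close> identifying
  the vectors of length \<open>N\<close> with the solutions of \<open>l = 0\<close>.
\<close>

definition codim2_quadric_of_rank :: "nat \<Rightarrow> cpoly set \<Rightarrow> nat \<Rightarrow> bool" where
  "codim2_quadric_of_rank N Z r \<longleftrightarrow>
     (\<exists>l q A. quadric_in_hyperplane N Z l q \<and> A \<in> carrier_mat (N + 1) N \<and>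
        bij_betw (\<lambda>u. A *\<^sub>v u) (carrier_vec N) {v \<in> carrier_vec (N + 1). eval_at v l = 0} \<and>
        r = vec_space.rank N (transpose_mat A * gram N q * A))"


section \<open>Normal projective varieties\<close>

text \<open>
  Let \<open>X\<close> be the projective variety with homogeneous prime ideal \<open>I\<close>. Its function field consists
  of the fractions \<open>a/b\<close> of forms of the same degree with \<open>b \<notin> I\<close>, where \<open>a/b = a'/b'\<close> iff
  \<open>a b' - a' b \<in> I\<close>; its local ring at a point \<open>P\<close> consists of those fractions which can be written
  with a denominator not vanishing at \<open>P\<close>.
\<close>

definition fraction :: "nat \<Rightarrow> cpoly set \<Rightarrow> cpoly \<Rightarrow> cpoly \<Rightarrow> bool" where
  "fraction N I a b \<longleftrightarrow> (\<exists>e. a \<in> forms N e \<and> b \<in> forms N e) \<and> b \<notin> I"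

definition in_local_ring :: "nat \<Rightarrow> cpoly set \<Rightarrow> complex vec \<Rightarrow> cpoly \<Rightarrow> cpoly \<Rightarrow> bool" where
  "in_local_ring N I P a b \<longleftrightarrow>
     (\<exists>a' b'. fraction N I a' b' \<and> eval_at P b' \<noteq> 0 \<and> a * b' - a' * b \<in> I)"

text \<open>
  Integrality of \<open>a/b\<close>: writing the coefficients of a monic equation with a common denominator
  \<open>s\<close> not vanishing at \<open>P\<close>, the equation
  \<open>(a/b)\<^sup>k + (c\<^bsub>k-1\<^esub>/s) (a/b)\<^bsup>k-1\<^esup> + \<dots> + c\<^sub>0/s = 0\<close> becomes the relation below.
\<close>

definition integral_over_local_ring ::
    "nat \<Rightarrow> cpoly set \<Rightarrow> complex vec \<Rightarrow> cpoly \<Rightarrow> cpoly \<Rightarrow> bool" where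
  "integral_over_local_ring N I P a b \<longleftrightarrow>
     (\<exists>k>0. \<exists>s c. (\<forall>j<k. fraction N I (c j) s) \<and> eval_at P s \<noteq> 0 \<and>
        s * a ^ k + (\<Sum>j<k. c j * a ^ j * b ^ (k - j)) \<in> I)"

definition normal_variety :: "nat \<Rightarrow> cpoly set \<Rightarrow> bool" where
  "normal_variety N I \<longleftrightarrow> primeideal I (poly_ring N) \<and>
     (\<forall>P\<in>zero_points N I. \<forall>a b. fraction N I a b \<and> integral_over_local_ring N I P a b \<longrightarrow>
        in_local_ring N I P a b)"


section \<open>Quadratic birational transformations into a hypersurface\<close>

text \<open>
  A tuple \<open>u\<^sub>0, \<dots>, u\<^sub>k\<close> of forms of the same degree, not all in the homogeneous prime ideal \<open>I\<close> of
  the variety \<open>X\<close>, defines a rational map from \<open>X\<close> to the projective space of dimension \<open>k\<close>.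
\<close>

definition same_rational_map ::
    "cpoly set \<Rightarrow> nat \<Rightarrow> (nat \<Rightarrow> cpoly) \<Rightarrow> (nat \<Rightarrow> cpoly) \<Rightarrow> bool" where
  "same_rational_map I k u v \<longleftrightarrow>
     (\<exists>i\<le>k. u i \<notin> I) \<and> (\<exists>i\<le>k. v i \<notin> I) \<and> (\<forall>i\<le>k. \<forall>j\<le>k. u i * v j - u j * v i \<in> I)"

text \<open>
  In what follows \<open>\<phi>\<close> is the rational map from the projective space of dimension \<open>n\<close> to that of
  dimension \<open>n + 1\<close> given by the forms \<open>f 0, \<dots>, f (n + 1)\<close> in \<open>x\<^sub>0, \<dots>, x\<^sub>n\<close>.
\<close>

definition quadratic_map :: "nat \<Rightarrow> (nat \<Rightarrow> cpoly) \<Rightarrow> bool" where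
  "quadratic_map n f \<longleftrightarrow> (\<forall>i\<le>n + 1. f i \<in> forms n 2) \<and>
     \<not> (\<exists>d>0. \<exists>h\<in>forms n d. \<forall>i\<le>n + 1. h dvd f i)"

definition base_locus :: "nat \<Rightarrow> (nat \<Rightarrow> cpoly) \<Rightarrow> cpoly set" where
  "base_locus n f = subscheme n (f ` {..n + 1})"

definition image_points :: "nat \<Rightarrow> (nat \<Rightarrow> cpoly) \<Rightarrow> complex vec set" where
  "image_points n f =
     {vec (n + 2) (\<lambda>i. eval_at v (f i)) | v. v \<in> carrier_vec (n + 1) \<and> (\<exists>i\<le>n + 1. eval_at v (f i) \<noteq> 0)}"

text \<open>The (reduced) Zariski closure of the image, given by its homogeneous ideal.\<close>

definition image_closure :: "nat \<Rightarrow> (nat \<Rightarrow> cpoly) \<Rightarrow> cpoly set" where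
  "image_closure n f = vanishing_ideal (n + 1) (image_points n f)"

text \<open>
  The forms \<open>g 0, \<dots>, g n\<close> of degree \<open>d\<close>, restricted to the closure \<open>S\<close> of the image, define a
  rational map inverse to \<open>\<phi>\<close>. When \<open>S\<close> is a hypersurface and \<open>n \<ge> 1\<close>, every section of \<open>O\<^sub>S(d)\<close> is
  the restriction of a form of degree \<open>d\<close>, so this says that the inverse of \<open>\<phi>\<close> is defined by a
  linear system contained in that of \<open>O\<^sub>S(d)\<close>.
\<close>

definition inverse_of_degree :: "nat \<Rightarrow> (nat \<Rightarrow> cpoly) \<Rightarrow> nat \<Rightarrow> (nat \<Rightarrow> cpoly) \<Rightarrow> bool" where
  "inverse_of_degree n f d g \<longleftrightarrow>
     (\<forall>i\<le>n. g i \<in> forms (n + 1) d) \<and> (\<exists>i\<le>n. g i \<notin> image_closure n f) \<and>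
     same_rational_map {0} n (\<lambda>i. subst f (g i)) Var \<and>
     same_rational_map (image_closure n f) (n + 1) (\<lambda>i. subst g (f i)) Var"

definition quadratic_birational :: "nat \<Rightarrow> (nat \<Rightarrow> cpoly) \<Rightarrow> bool" where
  "quadratic_birational n f \<longleftrightarrow> quadratic_map n f \<and> (\<exists>d g. inverse_of_degree n f d g)"

definition of_type_2 :: "nat \<Rightarrow> (nat \<Rightarrow> cpoly) \<Rightarrow> nat \<Rightarrow> bool" where
  "of_type_2 n f d \<longleftrightarrow> quadratic_map n f \<and> (\<exists>g. inverse_of_degree n f d g) \<and>
     (\<forall>d'<d. \<not> (\<exists>g. inverse_of_degree n f d' g))"

end

theory Submission
  imports
    Defs
    "HOL-Analysis.Continuum_Not_Denumerable"
    "HOL-Computational_Algebra.Fundamental_Theorem_Algebra"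
    "Jordan_Normal_Form.Char_Poly"
    "Jordan_Normal_Form.Matrix_Kernel"
begin

text \<open>
  The image \<open>S\<close> has the ideal \<open>(F)\<close> with \<open>deg F \<ge> 2\<close>, so the \<open>n + 2\<close> quadrics defining the map are
  independent. Since \<open>S\<close> is normal, they span all quadrics through the base locus \<open>B\<close>: any such quadric
  is integral over the coordinate ring of \<open>S\<close> by the Cayley--Hamilton argument, hence regular at
  each point of \<open>S\<close>, hence a linear form because the coordinate ring has depth at least 2.

  If \<open>B\<close> lies in the hyperplane \<open>l = 0\<close>, the linear system therefore contains all \<open>l x\<^sub>i\<close>, and it is spanned by
  these and one further quadric \<open>q\<close>. So \<open>B\<close> is \<open>l = q = 0\<close>, the \<open>l x\<^sub>i\<close> give a linear inverse, and in
  the coordinates \<open>z\<^sub>i = l x\<^sub>i\<close>, \<open>w = q\<close> the image is \<open>q(z) = w l(z)\<close>, of rank \<open>rk(q|\<^bsub>l = 0\<^esub>) + 2\<close>. A linear inverse gives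
  back a linear form \<open>l\<close> with all \<open>l x\<^sub>i\<close> in the linear system. A complete intersection which is
  in no hyperplane and not empty contains at most \<open>n\<close> independent quadrics; that its ideal is saturated, and that \<open>n + 1\<close>
  equations leave no points, is read off from Koszul complexes.
\<close>

section \<open>Koszul complexes\<close>

text \<open>The type \<open>cpoly\<close> has infinitely many variables, so
  \<open>poly_ring N\<close> is only a subset of it. Ideals are therefore spans in the whole type,
  and a retraction that kills the later variables brings coefficients back; the Koszul arguments are
  stated for any subset closed under the ring operations. Dimension theory is avoided. Two facts
  suffice: modulo a regular sequence shorter than the list of variables there is no socle, and a
  regular sequence inside a proper ideal with \<open>m\<close> generators has length at most
  \<open>m\<close>. Both express in which degrees the Koszul complex is exact. The main obstacle is
  that normality speaks of fractions of forms at single points, whereas a quadric \<open>h\<close>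
  through the base locus lives on the source. The birational inverse turns \<open>h\<close> into
  such a fraction, and the Nullstellensatz turns regularity at every point into powers of the
  coordinates that clear the denominators. Saturation of the ideal of a regular sequence of length 2
  then removes these powers; there is room for it, since for \<open>n = 0\<close> all quadrics would
  share a factor.\<close>

locale subring_set =
  fixes U :: "'a::comm_ring_1 set"
  assumes zero: "0 \<in> U" and one: "1 \<in> U"
    and add: "x \<in> U \<Longrightarrow> y \<in> U \<Longrightarrow> x + y \<in> U"
    and mult: "x \<in> U \<Longrightarrow> y \<in> U \<Longrightarrow> x * y \<in> U"
    and uminus: "x \<in> U \<Longrightarrow> - x \<in> U"
begin

lemma diff: "x \<in> U \<Longrightarrow> y \<in> U \<Longrightarrow> x - y \<in> U"
  using add[OF _ uminus, of x y] by simp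

definition ideal_set :: "'a set \<Rightarrow> bool" where
  "ideal_set J \<longleftrightarrow> J \<subseteq> U \<and> 0 \<in> J \<and> (\<forall>x\<in>J. \<forall>y\<in>J. x + y \<in> J) \<and> (\<forall>x\<in>J. \<forall>u\<in>U. u * x \<in> J)"

lemma ideal_setD:
  assumes "ideal_set J"
  shows "J \<subseteq> U" "0 \<in> J" "x \<in> J \<Longrightarrow> y \<in> J \<Longrightarrow> x + y \<in> J" "x \<in> J \<Longrightarrow> u \<in> U \<Longrightarrow> u * x \<in> J"
    "x \<in> J \<Longrightarrow> - x \<in> J" "x \<in> J \<Longrightarrow> y \<in> J \<Longrightarrow> x - y \<in> J"
proof -
  show A: "x \<in> J \<Longrightarrow> y \<in> J \<Longrightarrow> x + y \<in> J" for x y using assms unfolding ideal_set_def by blast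
  show M: "x \<in> J \<Longrightarrow> u \<in> U \<Longrightarrow> u * x \<in> J" for x u using assms unfolding ideal_set_def by blast
  show N: "x \<in> J \<Longrightarrow> - x \<in> J" for x using M[of x "-1"] uminus[OF one] by simp
  show "x \<in> J \<Longrightarrow> y \<in> J \<Longrightarrow> x - y \<in> J" using A[OF _ N, of x y] by simp
qed (use assms in \<open>unfold ideal_set_def, blast+\<close>)

end

text \<open>
  The Koszul complex of a list of ring elements; the exterior algebra on \<open>m\<close> generators has a
  basis indexed by the Boolean lists of length \<open>m\<close>, and a chain is its coefficient function. The
  differential is \<open>kd\<close>; exterior multiplication by the combination of the generators with
  coefficients \<open>rs\<close> is \<open>kh rs\<close>.
\<close>

fun kd :: "'a::comm_ring_1 list \<Rightarrow> (bool list \<Rightarrow> 'a) \<Rightarrow> bool list \<Rightarrow> 'a" where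
  "kd (a # as) z (True # bs) = - kd as (\<lambda>t. z (True # t)) bs"
| "kd (a # as) z (False # bs) = kd as (\<lambda>t. z (False # t)) bs + a * z (True # bs)"
| "kd _ _ _ = 0"

lemma kd_add: "kd as (\<lambda>t. z t + w t) bs = kd as z bs + kd as w bs"
proof (induction as z bs arbitrary: w rule: kd.induct)
  case (1 a as z bs)
  show ?case by (simp only: kd.simps 1; simp add: algebra_simps)
next
  case (2 a as z bs)
  show ?case by (simp only: kd.simps 2; simp add: algebra_simps)
qed simp_all

lemma kd_mult: "kd as (\<lambda>t. c * z t) bs = c * kd as z bs"
  by (induction as z bs rule: kd.induct) (auto simp: algebra_simps)

lemma kd_diff: "kd as (\<lambda>t. z t - w t) bs = kd as z bs - kd as w bs"
  using kd_add[of as z "\<lambda>t. (-1) * w t" bs] kd_mult[of as "-1" w bs] by simp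

lemma kd_uminus: "kd as (\<lambda>t. - w t) bs = - kd as w bs"
  using kd_mult[of as "-1" w bs] by simp

lemma kd_zero: "kd as (\<lambda>t. 0) bs = 0"
  using kd_mult[of as 0 "\<lambda>_. 0" bs] by simp

lemma kd_kd: "kd as (kd as z) bs = 0"
proof (induction as z bs rule: kd.induct)
  case (2 a as z bs)
  then show ?case by (simp add: kd_add kd_mult)
qed (simp_all add: kd_uminus)

fun kh :: "'a::comm_ring_1 list \<Rightarrow> (bool list \<Rightarrow> 'a) \<Rightarrow> bool list \<Rightarrow> 'a" where
  "kh (r # rs) z (True # bs) = r * z (False # bs) - kh rs (\<lambda>t. z (True # t)) bs"
| "kh (r # rs) z (False # bs) = kh rs (\<lambda>t. z (False # t)) bs"
| "kh _ _ _ = 0"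

lemma kh_add: "kh as (\<lambda>t. z t + w t) bs = kh as z bs + kh as w bs"
proof (induction as z bs arbitrary: w rule: kh.induct)
  case (1 a as z bs)
  show ?case by (simp only: kh.simps 1; simp add: algebra_simps)
next
  case (2 a as z bs)
  show ?case by (simp only: kh.simps 2; simp add: algebra_simps)
qed simp_all

lemma kh_mult: "kh as (\<lambda>t. c * z t) bs = c * kh as z bs"
  by (induction as z bs rule: kh.induct) (auto simp: algebra_simps)

lemma kh_uminus: "kh as (\<lambda>t. - w t) bs = - kh as w bs"
  using kh_mult[of as "-1" w bs] by simp

text \<open>The Koszul homotopy formula for contraction and exterior multiplication. It shows that
  the ideal generated by \<open>as\<close> annihilates the homology.\<close>

lemma kd_kh:
  "length rs = length as \<Longrightarrow> length bs = length as \<Longrightarrow>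
     kd as (kh rs z) bs + kh rs (kd as z) bs = sum_list (map2 (*) rs as) * z bs"
proof (induction as arbitrary: rs bs z)
  case Nil
  then show ?case by simp
next
  case (Cons a as)
  then obtain r rs' b bs' where [simp]: "rs = r # rs'" "bs = b # bs'" and l: "length rs' = length as" "length bs' = length as"
    by (metis Suc_length_conv)
  show ?case
  proof (cases b)
    case True
    have "kh rs' (kd as (\<lambda>t. z (True # t))) bs' =
        sum_list (map2 (*) rs' as) * z (True # bs') - kd as (kh rs' (\<lambda>t. z (True # t))) bs'"
      by (subst Cons.IH[OF l, of "\<lambda>t. z (True # t)", symmetric]) simp
    then show ?thesis using True by (simp add: kh_uminus kd_diff kd_mult; simp add: algebra_simps)
  next
    case False
    then show ?thesis using Cons.IH[OF l, of "\<lambda>t. z (False # t)"]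
      by (simp add: kh_add kh_mult algebra_simps)
  qed
qed

context subring_set
begin

text \<open>\<open>True\<close> marks the generators that occur in a basis monomial, so
  \<open>i\<close> is the exterior degree. Chains vanish at lists of any other length, where
  \<open>kd\<close> and \<open>kh\<close> may take default values; identities can then be asked for
  at every list.\<close>

definition chain :: "nat \<Rightarrow> nat \<Rightarrow> (bool list \<Rightarrow> 'a) set" where
  "chain m i = {z. \<forall>bs. z bs \<in> U \<and> (z bs \<noteq> 0 \<longrightarrow> length bs = m \<and> count_list bs True = i)}"

lemma chain_closed:
  "z \<in> chain m i \<Longrightarrow> w \<in> chain m i \<Longrightarrow> (\<lambda>t. z t + w t) \<in> chain m i"
  "z \<in> chain m i \<Longrightarrow> w \<in> chain m i \<Longrightarrow> (\<lambda>t. z t - w t) \<in> chain m i"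
  "z \<in> chain m i \<Longrightarrow> c \<in> U \<Longrightarrow> (\<lambda>t. c * z t) \<in> chain m i"
  "z \<in> chain m i \<Longrightarrow> (\<lambda>t. - z t) \<in> chain m i"
  "(\<lambda>t. 0) \<in> chain m i"
proof -
  assume z: "z \<in> chain m i"
  show "(\<lambda>t. c * z t) \<in> chain m i" if "c \<in> U"
  proof -
    have "length bs = m \<and> count_list bs True = i" if "c * z bs \<noteq> 0" for bs
      using z that by (cases "z bs = 0") (auto simp: chain_def)
    then show ?thesis using z \<open>c \<in> U\<close> by (simp add: chain_def mult)
  qed
  show "(\<lambda>t. - z t) \<in> chain m i"
    using z by (auto simp: chain_def intro: uminus)
  assume w: "w \<in> chain m i"
  have *: "length bs = m \<and> count_list bs True = i" if "z bs \<noteq> 0 \<or> w bs \<noteq> 0" for bs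
    using z w that by (auto simp: chain_def)
  have "length bs = m \<and> count_list bs True = i" if "z bs + w bs \<noteq> 0" for bs
    using that by (intro *) auto
  then show "(\<lambda>t. z t + w t) \<in> chain m i"
    using z w by (simp add: chain_def add)
  have "length bs = m \<and> count_list bs True = i" if "z bs - w bs \<noteq> 0" for bs
    using that by (intro *) auto
  then show "(\<lambda>t. z t - w t) \<in> chain m i"
    using z w by (simp add: chain_def diff)
qed (simp add: chain_def zero)

lemma chain_Cons:
  "z \<in> chain (Suc m) i \<Longrightarrow> (\<lambda>t. z (False # t)) \<in> chain m i"
  "z \<in> chain (Suc m) (Suc i) \<Longrightarrow> (\<lambda>t. z (True # t)) \<in> chain m i"
  "z \<in> chain (Suc m) 0 \<Longrightarrow> z (True # t) = 0"
  unfolding chain_def by fastforce+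

lemma chain_nonempty: "z \<in> chain m i \<Longrightarrow> i > m \<Longrightarrow> z bs = 0"
  unfolding chain_def using count_le_length[of bs True] by force

lemma kd_chain_0: "z \<in> chain (length as) 0 \<Longrightarrow> kd as z bs = 0"
proof (induction as z bs rule: kd.induct)
  case (1 a as z bs)
  then have "(\<lambda>t. z (True # t)) = (\<lambda>t. 0)" by (auto dest: chain_Cons(3))
  then show ?case by (simp add: kd_zero)
next
  case (2 a as z bs)
  then have "z (True # bs) = 0" by (auto dest: chain_Cons(3))
  with 2 show ?case by (auto dest: chain_Cons)
qed auto

lemma kd_in_U: "set as \<subseteq> U \<Longrightarrow> (\<And>t. z t \<in> U) \<Longrightarrow> kd as z bs \<in> U"
  by (induction as z bs rule: kd.induct) (auto intro: add mult uminus zero)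

lemma kh_in_U: "set rs \<subseteq> U \<Longrightarrow> (\<And>t. z t \<in> U) \<Longrightarrow> kh rs z bs \<in> U"
  by (induction rs z bs rule: kh.induct) (auto intro: diff mult zero)

lemma kd_chain:
  assumes "set as \<subseteq> U" "z \<in> chain (length as) (Suc i)"
  shows "kd as z \<in> chain (length as) i"
proof -
  have "length bs = length as \<and> count_list bs True = i" if "kd as z bs \<noteq> 0" for bs
    using assms(2) that
  proof (induction as z bs arbitrary: i rule: kd.induct)
    case (1 a as z bs)
    then have *: "(\<lambda>t. z (True # t)) \<in> chain (length as) i" by (auto dest: chain_Cons)
    show ?case
    proof (cases i)
      case 0
      then show ?thesis using * 1 kd_chain_0 by simp
    next
      case (Suc j)
      then show ?thesis using * 1 by auto
    qed
  next
    case (2 a as z bs)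
    then have *: "(\<lambda>t. z (True # t)) \<in> chain (length as) i" "(\<lambda>t. z (False # t)) \<in> chain (length as) (Suc i)"
      by (auto dest: chain_Cons)
    consider "kd as (\<lambda>t. z (False # t)) bs \<noteq> 0" | "z (True # bs) \<noteq> 0"
      using 2(3) by force
    then show ?case
    proof cases
      case 1
      then show ?thesis using 2(1)[OF *(2)] by simp
    next
      case 2
      then show ?thesis using *(1) by (auto simp: chain_def)
    qed
  qed auto
  moreover have "kd as z bs \<in> U" for bs
    using assms by (intro kd_in_U) (auto simp: chain_def)
  ultimately show ?thesis by (auto simp: chain_def)
qed

lemma kh_chain:
  assumes "set rs \<subseteq> U" "z \<in> chain (length rs) i"
  shows "kh rs z \<in> chain (length rs) (Suc i)"
proof -
  have "kh rs z bs \<in> U" for bs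
    using assms by (intro kh_in_U) (auto simp: chain_def)
  moreover have "length bs = length rs \<and> count_list bs True = Suc i" if "kh rs z bs \<noteq> 0" for bs
    using assms(2) that
  proof (induction rs z bs arbitrary: i rule: kh.induct)
    case (1 r rs z bs)
    then have F: "(\<lambda>t. z (False # t)) \<in> chain (length rs) i"
      by (auto dest: chain_Cons)
    consider "z (False # bs) \<noteq> 0" | "kh rs (\<lambda>t. z (True # t)) bs \<noteq> 0" using 1(3) by force
    then show ?case
    proof cases
      case 1
      then show ?thesis using F by (auto simp: chain_def)
    next
      case 2
      show ?thesis
      proof (cases i)
        case 0
        then have "(\<lambda>t. z (True # t)) = (\<lambda>t. 0)" using 1(2) by (auto dest: chain_Cons(3))
        then have "kh rs (\<lambda>t. z (True # t)) bs = 0"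
          using kh_mult[of rs 0 "\<lambda>t. 0" bs] by simp
        with 2 show ?thesis by simp
      next
        case (Suc j)
        then have "(\<lambda>t. z (True # t)) \<in> chain (length rs) j" using 1(2) by (auto dest: chain_Cons)
        then show ?thesis using 1(1) 2 Suc by simp
      qed
    qed
  next
    case (2 r rs z bs)
    then show ?case by (auto dest: chain_Cons)
  qed auto
  ultimately show ?thesis by (auto simp: chain_def)
qed

section \<open>Exactness of the Koszul complex modulo an ideal\<close>

lemma kd_in_ideal:
  assumes "ideal_set J" "set as \<subseteq> U" "\<And>t. z t \<in> J"
  shows "kd as z bs \<in> J"
  using assms(2,3)
  by (induction as z bs rule: kd.induct) (auto intro!: ideal_setD[OF assms(1)])

lemma kh_in_ideal:
  assumes "ideal_set J" "set rs \<subseteq> U" "\<And>t. z t \<in> J"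
  shows "kh rs z bs \<in> J"
  using assms(2,3)
  by (induction rs z bs rule: kh.induct) (auto intro!: ideal_setD[OF assms(1)])

text \<open>Exactness in exterior degree \<open>i\<close> over the quotient by \<open>J\<close>.
  Chains stay lifts with entries in \<open>U\<close> and only the equations are read modulo
  \<open>J\<close>, so no quotient ring is formed.\<close>

definition kexact :: "'a list \<Rightarrow> 'a set \<Rightarrow> nat \<Rightarrow> bool" where
  "kexact as J i \<longleftrightarrow> (\<forall>z\<in>chain (length as) i. (\<forall>bs. kd as z bs \<in> J) \<longrightarrow>
     (\<exists>w\<in>chain (length as) (Suc i). \<forall>bs. z bs - kd as w bs \<in> J))"

definition extend :: "'a set \<Rightarrow> 'a \<Rightarrow> 'a set" where
  "extend J f = {j + f * u | j u. j \<in> J \<and> u \<in> U}"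

abbreviation gen :: "'a list \<Rightarrow> 'a set" where
  "gen fs \<equiv> foldr (\<lambda>a J. extend J a) fs {0}"

lemma ideal_set_extend: "ideal_set J \<Longrightarrow> f \<in> U \<Longrightarrow> ideal_set (extend J f)"
proof -
  assume J: "ideal_set J" and f: "f \<in> U"
  show ?thesis unfolding ideal_set_def
  proof (intro conjI ballI)
    show "extend J f \<subseteq> U" using ideal_setD(1)[OF J] f by (auto simp: extend_def intro!: add mult)
    show "0 \<in> extend J f" unfolding extend_def using zero ideal_setD(2)[OF J] by force
  next
    fix x y assume "x \<in> extend J f" "y \<in> extend J f"
    then obtain j u k v where "x = j + f * u" "y = k + f * v" "j \<in> J" "k \<in> J" "u \<in> U" "v \<in> U"
      unfolding extend_def by blast
    then have "x + y = (j + k) + f * (u + v)" "j + k \<in> J" "u + v \<in> U"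
      using ideal_setD(3)[OF J] by (auto simp: algebra_simps intro: add)
    then show "x + y \<in> extend J f" unfolding extend_def by blast
  next
    fix x c assume "x \<in> extend J f" "c \<in> U"
    then obtain j u where "x = j + f * u" "j \<in> J" "u \<in> U"
      unfolding extend_def by blast
    moreover from this \<open>c \<in> U\<close> have "c * j \<in> J" "c * u \<in> U"
      using ideal_setD(4)[OF J] by (auto intro: mult)
    ultimately have "c * x = c * j + f * (c * u)" "c * j \<in> J" "c * u \<in> U"
      by (simp_all add: algebra_simps)
    then show "c * x \<in> extend J f" unfolding extend_def by blast
  qed
qed

lemma extend_choice:
  assumes "\<And>bs. z bs \<in> extend J f" "z \<in> chain m i" "ideal_set J"
  obtains w where "w \<in> chain m i" "\<And>bs. z bs - f * w bs \<in> J"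
proof -
  \<comment> \<open>The lift is chosen 0 wherever \<open>z\<close> is 0, which keeps
    \<open>w\<close> a chain of the same degree.\<close>
  have "\<exists>u. u \<in> U \<and> z bs - f * u \<in> J \<and> (z bs = 0 \<longrightarrow> u = 0)" for bs
  proof (cases "z bs = 0")
    case True
    then show ?thesis using zero ideal_setD(2)[OF assms(3)] by (intro exI[of _ 0]) auto
  next
    case False
    from assms(1)[of bs] obtain j u where "z bs = j + f * u" "j \<in> J" "u \<in> U"
      unfolding extend_def by blast
    with False show ?thesis by (intro exI[of _ u]) auto
  qed
  then obtain w where w: "\<And>bs. w bs \<in> U \<and> z bs - f * w bs \<in> J \<and> (z bs = 0 \<longrightarrow> w bs = 0)" by metis
  moreover from w assms(2) have "w \<in> chain m i" unfolding chain_def by auto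
  ultimately show ?thesis using that by blast
qed

text \<open>Multiplication by \<open>f\<close> is injective modulo \<open>J\<close>, so the long
  exact homology sequence places the homology over \<open>extend J f\<close> in degree
  \<open>Suc i\<close> between the homologies over \<open>J\<close> in degrees \<open>Suc i\<close>
  and \<open>i\<close>.\<close>

lemma kexact_extend:
  assumes J: "ideal_set J" and as: "set as \<subseteq> U" and f: "f \<in> U"
    and reg: "\<And>u. u \<in> U \<Longrightarrow> f * u \<in> J \<Longrightarrow> u \<in> J"
    and ex: "kexact as J i" "kexact as J (Suc i)"
  shows "kexact as (extend J f) (Suc i)"
  unfolding kexact_def
proof (intro ballI impI)
  fix z assume z: "z \<in> chain (length as) (Suc i)" and dz: "\<forall>bs. kd as z bs \<in> extend J f"
  let ?m = "length as"
  \<comment> \<open>\<open>w0\<close> represents the image of \<open>z\<close> under the connecting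
    homomorphism; regularity of \<open>f\<close> makes it a cycle modulo \<open>J\<close>.\<close>
  obtain w0 where w0: "w0 \<in> chain ?m i" "\<And>bs. kd as z bs - f * w0 bs \<in> J"
    using extend_choice[OF _ kd_chain[OF as z] J] dz by blast
  have "kd as w0 bs \<in> J" for bs
  proof -
    have "kd as (\<lambda>t. kd as z t - f * w0 t) bs \<in> J"
      by (rule kd_in_ideal[OF J as w0(2)])
    then have "- (f * kd as w0 bs) \<in> J" by (simp add: kd_diff kd_mult kd_kd)
    then have "f * kd as w0 bs \<in> J" using ideal_setD(5)[OF J] by fastforce
    moreover have "kd as w0 bs \<in> U" using w0(1) by (intro kd_in_U as) (auto simp: chain_def)
    ultimately show ?thesis using reg by blast
  qed
  then obtain v where v: "v \<in> chain ?m (Suc i)" "\<And>bs. w0 bs - kd as v bs \<in> J"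
    using ex(1) w0(1) unfolding kexact_def by blast
  have "kd as (\<lambda>t. z t - f * v t) bs \<in> J" for bs
  proof -
    have "kd as (\<lambda>t. z t - f * v t) bs = (kd as z bs - f * w0 bs) + f * (w0 bs - kd as v bs)"
      by (simp add: kd_diff kd_mult algebra_simps)
    then show ?thesis using w0(2) v(2) f by (auto intro: ideal_setD[OF J])
  qed
  moreover have "(\<lambda>t. z t - f * v t) \<in> chain ?m (Suc i)"
    using z v(1) f by (intro chain_closed)
  ultimately obtain u where u: "u \<in> chain ?m (Suc (Suc i))" "\<And>bs. z bs - f * v bs - kd as u bs \<in> J"
    using ex(2) unfolding kexact_def by blast
  have "z bs - kd as u bs \<in> extend J f" for bs
  proof -
    have "z bs - kd as u bs = (z bs - f * v bs - kd as u bs) + f * v bs" by simp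
    moreover have "v bs \<in> U" using v(1) by (auto simp: chain_def)
    ultimately show ?thesis using u(2) unfolding extend_def by blast
  qed
  with u(1) show "\<exists>w\<in>chain ?m (Suc (Suc i)). \<forall>bs. z bs - kd as w bs \<in> extend J f" by blast
qed

text \<open>In degree 0 the list of all \<open>False\<close> is the only basis element, and the
  boundaries there form the ideal generated by \<open>as\<close>. So homology in degree 0 is the
  quotient by this ideal.\<close>

lemma kd_degree_0:
  assumes "set as \<subseteq> U" 
  shows "z \<in> chain (length as) (Suc 0) \<Longrightarrow> kd as z (replicate (length as) False) \<in> gen as"
    and "r \<in> gen as \<Longrightarrow>
      \<exists>z\<in>chain (length as) (Suc 0). kd as z (replicate (length as) False) = r"
proof -
  show "kd as z (replicate (length as) False) \<in> gen as" if "z \<in> chain (length as) (Suc 0)"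
    using that
  proof (induction as arbitrary: z)
    case (Cons a as)
    have "(\<lambda>t. z (False # t)) \<in> chain (length as) (Suc 0)" "z (True # t) \<in> U" for t
      using Cons.prems by (auto dest: chain_Cons simp: chain_def)
    then show ?case using Cons.IH[of "\<lambda>t. z (False # t)"] by (auto simp: extend_def)
  qed simp
  show "\<exists>z\<in>chain (length as) (Suc 0). kd as z (replicate (length as) False) = r"
    if "r \<in> gen as"
    using that
  proof (induction as arbitrary: r)
    case Nil
    then show ?case using chain_closed(5) by force
  next
    case (Cons a as)
    then obtain j u where j: "r = j + a * u" "j \<in> gen as" "u \<in> U"
      by (auto simp: extend_def)
    from Cons.IH[OF j(2)] obtain z where z: "z \<in> chain (length as) (Suc 0)" "kd as z (replicate (length as) False) = j"
      by blast
    \<comment> \<open>\<open>u\<close> is put on the basis element consisting of the new generator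
      alone, and the chain of the tail on those without it.\<close>
    define w where "w = (\<lambda>bs. case bs of [] \<Rightarrow> 0 | b # t \<Rightarrow>
       (if b then (if t = replicate (length as) False then u else 0) else z t))"
    have "count_list (replicate k False) True = 0" for k by (induction k) auto
    then have "w \<in> chain (length (a # as)) (Suc 0)"
      using z(1) j(3) zero unfolding chain_def w_def by (auto split: list.splits if_splits)
    moreover have "kd (a # as) w (replicate (length (a # as)) False) = r"
      using z(2) j(1) by (simp add: w_def)
    ultimately show ?case by blast
  qed
qed

lemma ideal_set_foldr: "set as \<subseteq> U \<Longrightarrow> ideal_set (gen as)"
proof (induction as)
  case Nil
  show ?case by (simp add: ideal_set_def zero)
next
  case (Cons a as)
  then show ?case by (simp add: ideal_set_extend)
qed

text \<open>The list is read from right to left: \<open>a\<close> is a nonzerodivisor modulo the tail.\<close>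

fun regular :: "'a list \<Rightarrow> bool" where
  "regular [] \<longleftrightarrow> True"
| "regular (a # as) \<longleftrightarrow> regular as \<and> (\<forall>u\<in>U. a * u \<in> gen as \<longrightarrow> u \<in> gen as)"

lemma chain_0_eq:
  assumes "z \<in> chain m 0" "bs \<noteq> replicate m False"
  shows "z bs = 0"
proof (rule ccontr)
  assume "z bs \<noteq> 0"
  then have "length bs = m" "count_list bs True = 0" using assms(1) by (auto simp: chain_def)
  then have "bs = replicate m False"
    by (metis (full_types) count_list_0_iff replicate_eqI)
  with assms(2) show False by simp
qed

text \<open>The complex of \<open>a # as\<close> is the mapping cone of \<open>a\<close> on that of
  \<open>as\<close>: a cycle consists of a cycle \<open>?z1\<close> and a chain \<open>?z0\<close>
  with boundary \<open>- a * ?z1\<close>. A chain \<open>w1\<close> bounding \<open>?z1\<close>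
  corrects \<open>?z0\<close> to a cycle, which the induction hypothesis bounds.\<close>

lemma regular_kexact: "set as \<subseteq> U \<Longrightarrow> regular as \<Longrightarrow> kexact as {0} (Suc i)"
proof (induction as arbitrary: i)
  case Nil
  show ?case unfolding kexact_def
  proof (intro ballI impI)
    fix z assume "z \<in> chain (length []) (Suc i)"
    then have "z bs = 0" for bs using chain_nonempty[of z 0 "Suc i" bs] by simp
    then show "\<exists>w\<in>chain (length []) (Suc (Suc i)). \<forall>bs. z bs - kd [] w bs \<in> {0}"
      using chain_closed(5) by auto
  qed
next
  case (Cons a as)
  then have as: "set as \<subseteq> U" and a: "a \<in> U" and reg: "regular as" by auto
  show ?case unfolding kexact_def
  proof (intro ballI impI)
    fix z assume z: "z \<in> chain (length (a # as)) (Suc i)" and dz: "\<forall>bs. kd (a # as) z bs \<in> {0}"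
    let ?z0 = "\<lambda>t. z (False # t)" and ?z1 = "\<lambda>t. z (True # t)" and ?m = "length as"
    have z0: "?z0 \<in> chain ?m (Suc i)" and z1: "?z1 \<in> chain ?m i"
      using z by (auto dest: chain_Cons)
    have d1: "kd as ?z1 bs = 0" and d0: "kd as ?z0 bs + a * z (True # bs) = 0" for bs
      using dz[rule_format, of "True # bs"] dz[rule_format, of "False # bs"] by auto
    obtain w1 where w1: "w1 \<in> chain ?m (Suc i)" "\<And>bs. ?z1 bs = kd as w1 bs"
    proof (cases i)
      case (Suc j)
      then show ?thesis using Cons.IH[OF as reg, of j] z1 d1 that unfolding kexact_def by auto
    next
      \<comment> \<open>Degree 0 is where regularity of \<open>a\<close> enters: the cycle condition
        says that \<open>a\<close> times the single entry of \<open>?z1\<close> lies in the ideal of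
        the tail.\<close>
      case 0
      let ?F = "replicate ?m False"
      have "kd as ?z0 ?F \<in> gen as"
        using kd_degree_0(1)[OF as] z0 0 by simp
      moreover have "a * z (True # ?F) = - kd as ?z0 ?F" using d0[of ?F] by (simp add: add_eq_0_iff)
      ultimately have "a * z (True # ?F) \<in> gen as"
        using ideal_setD(5)[OF ideal_set_foldr[OF as]] by simp
      moreover have "z (True # ?F) \<in> U" using z by (auto simp: chain_def)
      ultimately have "z (True # ?F) \<in> gen as"
        using Cons.prems by simp
      then obtain w where w: "w \<in> chain ?m (Suc 0)" "kd as w ?F = z (True # ?F)"
        using kd_degree_0(2)[OF as] by blast
      have "?z1 bs = kd as w bs" for bs
        using w chain_0_eq[of ?z1 ?m bs] chain_0_eq[OF kd_chain[OF as w(1)], of bs] z1 0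
        by (cases "bs = ?F") auto
      then show ?thesis using that w 0 by blast
    qed
    have "(\<lambda>t. ?z0 t + a * w1 t) \<in> chain ?m (Suc i)"
      using z0 w1(1) a by (intro chain_closed)
    moreover have "kd as (\<lambda>t. ?z0 t + a * w1 t) bs = 0" for bs
      using d0[of bs] w1(2)[of bs] by (simp add: kd_add kd_mult)
    ultimately obtain w0 where w0: "w0 \<in> chain ?m (Suc (Suc i))" "\<And>bs. ?z0 bs + a * w1 bs = kd as w0 bs"
      using Cons.IH[OF as reg, of i] unfolding kexact_def by auto
    \<comment> \<open>The sign of \<open>w1\<close> cancels the one in the \<open>True\<close> case
      of \<open>kd\<close>.\<close>
    define w where "w = (\<lambda>bs. case bs of [] \<Rightarrow> 0 | b # t \<Rightarrow> if b then - w1 t else w0 t)"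
    have "w \<in> chain (length (a # as)) (Suc (Suc i))"
      using w0(1) w1(1) zero unfolding chain_def w_def by (auto split: list.splits if_splits intro: uminus)
    moreover have "z bs - kd (a # as) w bs = 0" for bs
    proof (cases bs)
      case Nil
      then show ?thesis using z by (auto simp: chain_def)
    next
      case (Cons b t)
      show ?thesis
      proof (cases b)
        case True
        then show ?thesis using Cons w1(2)[of t] by (simp add: w_def kd_uminus)
      next
        case False
        then show ?thesis using Cons w0(2)[of t] by (simp add: w_def algebra_simps)
      qed
    qed
    ultimately show "\<exists>w\<in>chain (length (a # as)) (Suc (Suc i)). \<forall>bs. z bs - kd (a # as) w bs \<in> {0}" by blast
  qed
qed

text \<open>Over the zero ideal all positive degrees are exact, and by \<open>kexact_extend\<close>
  each element of \<open>fs\<close> costs one degree.\<close>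

lemma kexact_regular:
  assumes "set as \<subseteq> U" "regular as" "set fs \<subseteq> U" "regular fs" "length fs \<le> i"
  shows "kexact as (gen fs) (Suc i)"
  using assms(3-5)
proof (induction fs arbitrary: i)
  case Nil
  then show ?case using regular_kexact[OF assms(1,2)] by simp
next
  case (Cons f fs)
  then obtain j where "i = Suc j" by (cases i) auto
  then show ?case using Cons
    by (auto intro!: kexact_extend ideal_set_foldr assms)
qed

text \<open>Every entry of the boundary of \<open>p\<close> times the top basis element is 0 or, up
  to sign, \<open>a * p\<close> with \<open>a\<close> in \<open>as\<close>.\<close>

lemma kd_top:
  assumes J: "ideal_set J" "\<And>a. a \<in> set as \<Longrightarrow> a * p \<in> J"
  shows "kd as (\<lambda>bs. if bs = replicate (length as) True then p else 0) bs \<in> J"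
  using J(2)
proof (induction as arbitrary: bs)
  case (Cons a as)
  show ?case
  proof (cases bs)
    case Nil
    then show ?thesis using ideal_setD(2)[OF J(1)] by simp
  next
    case c: (Cons b t)
    have "kd as (\<lambda>t. 0) t = 0" by (rule kd_zero)
    then show ?thesis
      using c Cons.IH[of t] Cons.prems ideal_setD(2,3,5)[OF J(1)] by (cases b) auto
  qed
qed (use ideal_setD(2)[OF J(1)] in simp)

text \<open>An element of the socle is a cycle of top degree.\<close>

lemma no_socle:
  assumes "set as \<subseteq> U" "regular as" "set fs \<subseteq> U" "regular fs" "length fs < length as"
    and "p \<in> U" "\<And>a. a \<in> set as \<Longrightarrow> a * p \<in> gen fs"
  shows "p \<in> gen fs"
proof -
  let ?J = "gen fs" and ?T = "replicate (length as) True"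
  let ?z = "\<lambda>bs. if bs = ?T then p else 0"
  obtain i where i: "length as = Suc i" "length fs \<le> i" using assms(5) by (cases "length as") auto
  have "count_list (replicate k True) True = k" for k by (induction k) auto
  then have z: "?z \<in> chain (length as) (Suc i)" using assms(6) i zero by (auto simp: chain_def)
  have "kd as ?z bs \<in> ?J" for bs
    using kd_top[OF ideal_set_foldr[OF assms(3)] assms(7)] by blast
  then obtain w where w: "w \<in> chain (length as) (Suc (Suc i))" "\<And>bs. ?z bs - kd as w bs \<in> ?J"
    using kexact_regular[OF assms(1-4) i(2)] z unfolding kexact_def by blast
  \<comment> \<open>No nonzero chain lives above the top degree, so the top coefficient
    \<open>p\<close> itself must lie in the ideal.\<close>
  have "w = (\<lambda>t. 0)" using chain_nonempty[OF w(1)] i by auto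
  then show ?thesis using w(2)[of ?T] by (simp add: kd_zero)
qed

section \<open>Nonvanishing homology and the length of regular sequences\<close>

text \<open>A nonzero class moves up one degree for each element of \<open>fs\<close>. The start is
  the class of 1 in degree 0, nonzero because \<open>as\<close> generates a proper ideal. If
  \<open>f\<close> is the combination of \<open>as\<close> with coefficients \<open>rs\<close>, the
  homotopy formula makes \<open>kh rs z\<close> a cycle modulo \<open>f\<close> whose connecting
  image is the old class \<open>z\<close>.\<close>

lemma not_kexact_regular:
  assumes "set as \<subseteq> U" "1 \<notin> gen as" "set fs \<subseteq> U" "regular fs"
    and "set fs \<subseteq> gen as"
  shows "\<exists>z\<in>chain (length as) (length fs). (\<forall>bs. kd as z bs \<in> gen fs) \<and>
    \<not> (\<exists>w\<in>chain (length as) (Suc (length fs)). \<forall>bs. z bs - kd as w bs \<in> gen fs)"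
  using assms(3-5)
proof (induction fs)
  case Nil
  let ?F = "replicate (length as) False"
  let ?z = "\<lambda>bs. if bs = ?F then 1 else 0"
  have "count_list (replicate k False) True = 0" for k by (induction k) auto
  then have z: "?z \<in> chain (length as) 0" using one zero by (auto simp: chain_def)
  moreover have "kd as ?z bs \<in> {0}" for bs using kd_chain_0[OF z] by simp
  moreover have "\<not> (\<exists>w\<in>chain (length as) (Suc 0). \<forall>bs. ?z bs - kd as w bs \<in> {0})"
  proof
    assume "\<exists>w\<in>chain (length as) (Suc 0). \<forall>bs. ?z bs - kd as w bs \<in> {0}"
    then obtain w where w: "w \<in> chain (length as) (Suc 0)" "?z ?F - kd as w ?F \<in> {0}" by blast
    then have "1 = kd as w ?F" by simp
    with kd_degree_0(1)[OF assms(1) w(1)] assms(2) show False by metis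
  qed
  ultimately show ?case by auto
next
  case (Cons f fs)
  let ?J = "gen fs" and ?m = "length as" and ?c = "length fs"
  have J: "ideal_set ?J" and f: "f \<in> U" using Cons by (auto intro: ideal_set_foldr)
  from Cons obtain z where z: "z \<in> chain ?m ?c" "\<And>bs. kd as z bs \<in> ?J"
    "\<not> (\<exists>w\<in>chain ?m (Suc ?c). \<forall>bs. z bs - kd as w bs \<in> ?J)" by auto
  have "\<exists>rs. length rs = length as \<and> set rs \<subseteq> U \<and> sum_list (map2 (*) rs as) = g"
    if "g \<in> gen as" for g
    using that
  proof (induction as arbitrary: g)
    case (Cons a as)
    then obtain j u where j: "g = j + a * u" "j \<in> gen as" "u \<in> U"
      by (auto simp: extend_def)
    from Cons.IH[OF j(2)] obtain rs where rs: "length rs = length as" "set rs \<subseteq> U" "sum_list (map2 (*) rs as) = j"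
      by blast
    then show ?case using j by (intro exI[of _ "u # rs"]) (auto simp: algebra_simps)
  qed simp
  then obtain rs where rs: "length rs = length as" "set rs \<subseteq> U" "sum_list (map2 (*) rs as) = f"
    using Cons.prems by auto
  define w where "w = kh rs z"
  have w: "w \<in> chain ?m (Suc ?c)" unfolding w_def using kh_chain[of rs z] rs z(1) by simp
  have key: "f * z bs - kd as w bs \<in> ?J" for bs
  proof (cases "length bs = ?m")
    case True
    have "f * z bs - kd as w bs = kh rs (kd as z) bs"
      using kd_kh[OF rs(1) True, of z] rs(3) unfolding w_def by (simp add: algebra_simps)
    then show ?thesis using kh_in_ideal[OF J rs(2) z(2)] by simp
  next
    case False
    then have "z bs = 0" "kd as w bs = 0"
      using z(1) kd_chain[OF assms(1) w] by (auto simp: chain_def)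
    then show ?thesis using ideal_setD(2)[OF J] by simp
  qed
  have "kd as w bs \<in> extend ?J f" for bs
  proof -
    have "kd as w bs = - (f * z bs - kd as w bs) + f * z bs" by simp
    moreover have "z bs \<in> U" using z(1) by (auto simp: chain_def)
    ultimately show ?thesis using ideal_setD(5)[OF J key[of bs]] unfolding extend_def by blast
  qed
  moreover have "\<not> (\<exists>u\<in>chain ?m (Suc (Suc ?c)). \<forall>bs. w bs - kd as u bs \<in> extend ?J f)"
  proof
    assume "\<exists>u\<in>chain ?m (Suc (Suc ?c)). \<forall>bs. w bs - kd as u bs \<in> extend ?J f"
    then obtain u where u: "u \<in> chain ?m (Suc (Suc ?c))" "\<And>bs. w bs - kd as u bs \<in> extend ?J f" by blast
    have "(\<lambda>bs. w bs - kd as u bs) \<in> chain ?m (Suc ?c)"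
      using w kd_chain[OF assms(1) u(1)] by (rule chain_closed)
    from extend_choice[OF u(2) this J]
    obtain v where v: "v \<in> chain ?m (Suc ?c)" "\<And>bs. w bs - kd as u bs - f * v bs \<in> ?J" by blast
    \<comment> \<open>Applying \<open>kd\<close> to the relation for \<open>w\<close> and cancelling
      the regular element \<open>f\<close> would make \<open>z\<close> a boundary.\<close>
    have "z bs - kd as v bs \<in> ?J" for bs
    proof -
      have "kd as (\<lambda>bs. w bs - kd as u bs - f * v bs) bs \<in> ?J"
        by (rule kd_in_ideal[OF J assms(1) v(2)])
      then have "kd as w bs - f * kd as v bs \<in> ?J" by (simp add: kd_diff kd_kd kd_mult)
      from ideal_setD(3)[OF J key[of bs] this] have "f * (z bs - kd as v bs) \<in> ?J"
        by (simp add: algebra_simps)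
      moreover have "z bs - kd as v bs \<in> U"
        using z(1) kd_chain[OF assms(1) v(1)] by (auto simp: chain_def intro: diff)
      ultimately show ?thesis using Cons.prems by simp
    qed
    with v(1) z(3) show False by blast
  qed
  ultimately show ?case using w by auto
qed

text \<open>The complex vanishes above degree \<open>length as\<close>, so no nonzero class can sit
  there. This takes the place of the height theorem.\<close>

lemma regular_length_le:
  assumes "set as \<subseteq> U" "1 \<notin> gen as" "set fs \<subseteq> U" "regular fs"
    and "set fs \<subseteq> gen as"
  shows "length fs \<le> length as"
proof (rule ccontr)
  assume "\<not> length fs \<le> length as"
  then have "z = (\<lambda>bs. 0)" if "z \<in> chain (length as) (length fs)" for z
    using chain_nonempty[OF that] by auto
  moreover from not_kexact_regular[OF assms] obtain z where "z \<in> chain (length as) (length fs)"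
    "\<not> (\<exists>w\<in>chain (length as) (Suc (length fs)). \<forall>bs. z bs - kd as w bs \<in> gen fs)" by blast
  ultimately show False
    using chain_closed(5) ideal_setD(2)[OF ideal_set_foldr[OF assms(3)]] kd_zero[of as]
    by (metis diff_zero)
qed

end

section \<open>Polynomials\<close>

abbreviation keys :: "('a \<Rightarrow>\<^sub>0 'b::zero) \<Rightarrow> 'a set" where "keys \<equiv> Poly_Mapping.keys"
abbreviation lookup :: "('a \<Rightarrow>\<^sub>0 'b::zero) \<Rightarrow> 'a \<Rightarrow> 'b" where "lookup \<equiv> Poly_Mapping.lookup"
abbreviation single :: "'a \<Rightarrow> 'b \<Rightarrow> ('a \<Rightarrow>\<^sub>0 'b::zero)" where "single \<equiv> Poly_Mapping.single"

abbreviation U :: "nat \<Rightarrow> cpoly set" where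
  "U N \<equiv> carrier (poly_ring N)"

lemma poly_ring_simps [simp]:
  "monoid.mult (poly_ring N) = (*)" "one (poly_ring N) = 1"
  "zero (poly_ring N) = 0" "add (poly_ring N) = (+)"
  by (simp_all add: poly_ring_def)

lemma in_U_iff: "p \<in> U N \<longleftrightarrow> (\<forall>m\<in>keys p. keys m \<subseteq> {..N})"
  by (simp add: poly_ring_def)

lemma poly_mapping_sum_singles:
  fixes p :: "'a \<Rightarrow>\<^sub>0 'b::comm_monoid_add"
  shows "p = (\<Sum>m\<in>keys p. single m (lookup p m))"
  by (rule poly_mapping_eqI)
     (auto simp: lookup_sum lookup_single when_def in_keys_iff sum.delta)

lemma cpoly_single_induct:
  fixes p :: cpoly
  assumes "P 0" "\<And>m c. P (single m c)" "\<And>p q. P p \<Longrightarrow> P q \<Longrightarrow> P (p + q)"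
  shows "P p"
proof -
  have "P (\<Sum>m\<in>A. single m (lookup p m))" if "finite A" "A \<subseteq> keys p" for A
    using that by (induction rule: finite_induct) (auto simp: assms)
  from this[OF finite_keys subset_refl] show ?thesis
    by (simp only: poly_mapping_sum_singles[symmetric])
qed

section \<open>Monomials, evaluation and substitution\<close>

definition mon :: "(nat \<Rightarrow> 'a::comm_ring_1) \<Rightarrow> (nat \<Rightarrow>\<^sub>0 nat) \<Rightarrow> 'a" where
  "mon g m = (\<Prod>i\<in>keys m. g i ^ lookup m i)"

lemma mon_superset:
  assumes "finite A" "keys m \<subseteq> A"
  shows "mon g m = (\<Prod>i\<in>A. g i ^ lookup m i)"
  unfolding mon_def using assms by (intro prod.mono_neutral_left) (auto simp: in_keys_iff)

lemma mon_add: "mon g (m + m') = mon g m * mon g m'"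
proof -
  let ?A = "keys m \<union> keys m'"
  have "mon g (m + m') = (\<Prod>i\<in>?A. g i ^ lookup (m + m') i)"
    by (rule mon_superset) (auto simp: keys_add)
  also have "\<dots> = (\<Prod>i\<in>?A. g i ^ lookup m i) * (\<Prod>i\<in>?A. g i ^ lookup m' i)"
    by (simp add: lookup_add power_add prod.distrib)
  also have "\<dots> = mon g m * mon g m'"
    by (simp add: mon_superset[of ?A])
  finally show ?thesis .
qed

lemma mon_0 [simp]: "mon g 0 = 1" by (simp add: mon_def)

lemma mon_single [simp]: "mon g (single i k) = g i ^ k"
  by (cases "k = 0") (simp_all add: mon_def)

lemma insertion_superset:
  assumes "finite A" "keys p \<subseteq> A" "h 0 = 0"
  shows "insertion h g p = (\<Sum>m\<in>A. h (lookup p m) * mon g m)"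
  unfolding insertion_def mon_def[symmetric] using assms
  by (intro sum.mono_neutral_left) (auto simp: in_keys_iff)

lemma insertion_single: "h 0 = 0 \<Longrightarrow> insertion h g (single m c) = h c * mon g m"
  by (subst insertion_superset[where A = "{m}"]) auto

lemma insertion_0 [simp]: "insertion h g 0 = 0"
  by (simp add: insertion_def)

context
  fixes h :: "complex \<Rightarrow> 'a::comm_ring_1"
  assumes h: "comm_ring_hom h"
begin

interpretation comm_ring_hom h by (rule h)

lemma insertion_add: "insertion h g (p + q) = insertion h g p + insertion h g q"
proof -
  let ?A = "keys p \<union> keys q"
  have "insertion h g (p + q) = (\<Sum>m\<in>?A. h (lookup (p + q) m) * mon g m)"
    by (rule insertion_superset) (auto simp: keys_add)
  also have "\<dots> = (\<Sum>m\<in>?A. h (lookup p m) * mon g m) + (\<Sum>m\<in>?A. h (lookup q m) * mon g m)"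
    by (simp add: lookup_add hom_add distrib_right sum.distrib)
  also have "\<dots> = insertion h g p + insertion h g q"
    by (simp add: insertion_superset[of ?A])
  finally show ?thesis .
qed

lemma insertion_mult: "insertion h g (p * q) = insertion h g p * insertion h g q"
proof (induction p rule: cpoly_single_induct)
  case (2 m c)
  show ?case
    by (induction q rule: cpoly_single_induct)
       (auto simp: insertion_add insertion_single mult_single mon_add hom_mult algebra_simps)
qed (auto simp: insertion_add algebra_simps)

lemma comm_ring_hom_insertion: "comm_ring_hom (insertion h g)"
proof
  show "insertion h g 1 = 1"
    using insertion_single[of h g 0 1] by (simp add: hom_one)
qed (auto simp: insertion_add insertion_mult)

end

lemma comm_ring_hom_Const: "comm_ring_hom Const"
  by standard (auto simp: Const_def single_add mult_single)

interpretation Const: comm_ring_hom Const by (rule comm_ring_hom_Const)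

lemma comm_ring_hom_subst: "comm_ring_hom (subst g)"
  unfolding subst_def[abs_def] by (rule comm_ring_hom_insertion[OF comm_ring_hom_Const])

interpretation subst: comm_ring_hom "subst g" for g by (rule comm_ring_hom_subst)

text \<open>A point is a function on all indices here, which avoids the dimension conditions of
  \<open>eval_at\<close>; for \<open>p \<in> U N\<close> only the values up to \<open>N\<close>
  count.\<close>

definition ev :: "(nat \<Rightarrow> complex) \<Rightarrow> cpoly \<Rightarrow> complex" where
  "ev v p = insertion id v p"

lemma eval_at_eq: "eval_at v = ev (\<lambda>i. v $ i)"
  by (simp add: eval_at_def ev_def fun_eq_iff)

lemma comm_ring_hom_ev: "comm_ring_hom (ev v)"
  unfolding ev_def[abs_def] by (rule comm_ring_hom_insertion) (unfold_locales, auto)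

interpretation ev: comm_ring_hom "ev v" for v by (rule comm_ring_hom_ev)

lemma subst_Const [simp]: "subst g (Const c) = Const c"
  by (simp add: subst_def Const_def insertion_single) 

lemma subst_Var [simp]: "subst g (Var i) = g i"
  by (simp add: subst_def Var_def insertion_single) 

lemma ev_Const [simp]: "ev v (Const c) = c"
  by (simp add: ev_def Const_def insertion_single) 

lemma ev_Var [simp]: "ev v (Var i) = v i"
  by (simp add: ev_def Var_def insertion_single)

lemma Const_eq_iff [simp]: "Const a = Const b \<longleftrightarrow> a = b"
  by (metis ev_Const)

lemma Const_eq_0_iff [simp]: "Const a = 0 \<longleftrightarrow> a = 0"
  by (metis ev_Const Const.hom_zero)

lemma Var_neq_0 [simp]: "Var i \<noteq> 0"
proof
  assume "Var i = 0"
  then have "ev (\<lambda>_. 1) (Var i) = 0" by (simp only: ev.hom_zero)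
  then show False by simp
qed

lemma mon_eq_single: "mon Var m = single m 1"
proof -
  have "mon Var m = (\<Prod>i\<in>keys m. single (single i (lookup m i)) 1)"
  proof -
    have "Var i ^ k = single (single i k) 1" for i k
      by (induction k) (auto simp: Var_def mult_single single_add[symmetric])
    then show ?thesis by (simp add: mon_def)
  qed
  also have "\<dots> = single (\<Sum>i\<in>keys m. single i (lookup m i)) 1"
  proof -
    have "(\<Prod>i\<in>A. single (single i (lookup m i)) (1::complex)) =
       single (\<Sum>i\<in>A. single i (lookup m i)) 1" if "finite A" for A
      using that by (induction rule: finite_induct) (auto simp: mult_single)
    then show ?thesis by simp
  qed
  also have "(\<Sum>i\<in>keys m. single i (lookup m i)) = m"
    by (rule poly_mapping_sum_singles[symmetric])
  finally show ?thesis .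
qed

lemma single_eq: "single m c = Const c * mon Var m"
  by (simp add: mon_eq_single Const_def mult_single)

section \<open>The subring in finitely many variables\<close>

lemma U_closed [simp, intro]:
  "0 \<in> U N" "1 \<in> U N" "Const c \<in> U N" "i \<le> N \<Longrightarrow> Var i \<in> U N"
  "p \<in> U N \<Longrightarrow> q \<in> U N \<Longrightarrow> p + q \<in> U N"
  "p \<in> U N \<Longrightarrow> q \<in> U N \<Longrightarrow> p * q \<in> U N"
  "p \<in> U N \<Longrightarrow> - p \<in> U N"
  "p \<in> U N \<Longrightarrow> q \<in> U N \<Longrightarrow> p - q \<in> U N"
proof -
  show add: "p \<in> U N \<Longrightarrow> q \<in> U N \<Longrightarrow> p + q \<in> U N" for p q
    unfolding in_U_iff using keys_add[of p q] by blast
  show mult: "p \<in> U N \<Longrightarrow> q \<in> U N \<Longrightarrow> p * q \<in> U N" for p q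
  proof (unfold in_U_iff, intro ballI)
    fix m assume "\<forall>m\<in>keys p. keys m \<subseteq> {..N}"
      "\<forall>m\<in>keys q. keys m \<subseteq> {..N}" "m \<in> keys (p * q)"
    moreover from this obtain a b where "m = a + b" "a \<in> keys p" "b \<in> keys q"
      using keys_mult[of p q] by blast
    ultimately show "keys m \<subseteq> {..N}"
      using keys_add[of a b] by (meson Un_least subset_trans)
  qed
  show Const: "Const c \<in> U N" for c
    by (simp add: in_U_iff Const_def)
  show uminus: "p \<in> U N \<Longrightarrow> - p \<in> U N" for p
    using mult[OF Const[of "-1"], of p] by (simp add: Const.hom_uminus)
  show "p \<in> U N \<Longrightarrow> q \<in> U N \<Longrightarrow> p - q \<in> U N" for p q
    using add[OF _ uminus, of p q] by simp
qed (auto simp: in_U_iff Var_def)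

lemma U_power [simp, intro]: "p \<in> U N \<Longrightarrow> p ^ k \<in> U N"
  by (induction k) auto

lemma U_sum [intro]: "(\<And>x. x \<in> A \<Longrightarrow> f x \<in> U N) \<Longrightarrow> sum f A \<in> U N"
  by (induction A rule: infinite_finite_induct) auto

lemma U_mono: "N \<le> M \<Longrightarrow> U N \<subseteq> U M"
  by (fastforce simp: in_U_iff)

lemma subst_single: "subst g (single m c) = Const c * mon g m"
  by (simp add: subst_def insertion_single)

lemma ev_single: "ev v (single m c) = c * mon v m"
  by (simp add: ev_def insertion_single)

lemma U_keys_single: "p \<in> U N \<Longrightarrow> m \<in> keys p \<Longrightarrow> keys m \<subseteq> {..N}"
  by (auto simp: in_U_iff)

lemma U_induct [consumes 1, case_names Const Var add mult]:
  assumes "p \<in> U N"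
    and "\<And>c. P (Const c)" and "\<And>i. i \<le> N \<Longrightarrow> P (Var i)"
    and add: "\<And>p q. p \<in> U N \<Longrightarrow> q \<in> U N \<Longrightarrow> P p \<Longrightarrow> P q \<Longrightarrow> P (p + q)"
    and mult: "\<And>p q. p \<in> U N \<Longrightarrow> q \<in> U N \<Longrightarrow> P p \<Longrightarrow> P q \<Longrightarrow> P (p * q)"
  shows "P p"
proof -
  have pow: "p ^ k \<in> U N \<and> P (p ^ k)" if "P p" "p \<in> U N" for p k
    using that assms(2)[of 1] by (induction k) (auto intro!: mult)
  have "mon Var m \<in> U N \<and> P (mon Var m)" if "keys m \<subseteq> {..N}" for m
  proof -
    have "(\<Prod>i\<in>A. Var i ^ lookup m i) \<in> U N \<and> P (\<Prod>i\<in>A. Var i ^ lookup m i)"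
      if "finite A" "A \<subseteq> {..N}" for A
      using that by (induction rule: finite_induct)
        (use assms(2)[of 1] pow assms(3) in \<open>auto intro!: mult\<close>)
    from this[of "keys m"] show ?thesis using that by (simp add: mon_def)
  qed
  then have "m \<in> keys p \<Longrightarrow> single m c \<in> U N \<and> P (single m c)" for m c
    using assms(2) U_keys_single[OF assms(1)] by (auto simp: single_eq intro!: mult)
  then have S: "\<And>m c. m \<in> keys p \<Longrightarrow> single m c \<in> U N \<and> P (single m c)" .
  have "(\<Sum>m\<in>A. single m (lookup p m)) \<in> U N \<and> P (\<Sum>m\<in>A. single m (lookup p m))"
    if "finite A" "A \<subseteq> keys p" for A
    using that by (induction rule: finite_induct) (use assms(2)[of 0] S in \<open>auto intro!: add\<close>)
  from this[OF finite_keys subset_refl] show ?thesis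
    by (simp only: poly_mapping_sum_singles[symmetric])
qed

lemma U_hom_eq:
  assumes "p \<in> U N" "comm_ring_hom h" "comm_ring_hom h'"
    and "\<And>c. h (Const c) = h' (Const c)" "\<And>i. i \<le> N \<Longrightarrow> h (Var i) = h' (Var i)"
  shows "h p = (h' p :: 'a :: comm_ring_1)"
proof -
  interpret h: comm_ring_hom h by fact
  interpret h': comm_ring_hom h' by fact
  show ?thesis using assms(1)
    by (induction rule: U_induct) (auto simp: assms h.hom_add h'.hom_add h.hom_mult h'.hom_mult)
qed

lemma comm_ring_hom_comp:
  "comm_ring_hom h \<Longrightarrow> comm_ring_hom h' \<Longrightarrow> comm_ring_hom (\<lambda>x. h (h' x))"
proof -
  assume "comm_ring_hom h" "comm_ring_hom h'"
  then interpret h: comm_ring_hom h + h': comm_ring_hom h' by simp_all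
  show ?thesis by standard (auto simp: h.hom_add h'.hom_add h.hom_mult h'.hom_mult)
qed

lemma comm_ring_hom_id: "comm_ring_hom (\<lambda>x. x)"
  by standard auto

lemma subst_cong: "p \<in> U N \<Longrightarrow> (\<And>i. i \<le> N \<Longrightarrow> g i = g' i) \<Longrightarrow> subst g p = subst g' p"
  by (erule U_hom_eq) (auto intro: comm_ring_hom_subst)

lemma ev_cong: "p \<in> U N \<Longrightarrow> (\<And>i. i \<le> N \<Longrightarrow> g i = g' i) \<Longrightarrow> ev g p = ev g' p"
  by (erule U_hom_eq) (auto intro: comm_ring_hom_ev)

lemma subst_ident: "p \<in> U N \<Longrightarrow> (\<And>i. i \<le> N \<Longrightarrow> g i = Var i) \<Longrightarrow> subst g p = p"
  by (erule U_hom_eq) (auto intro: comm_ring_hom_subst comm_ring_hom_id)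

lemma ex_U: "\<exists>N. p \<in> U N"
proof (induction p rule: cpoly_single_induct)
  case 1
  show ?case by (rule exI[of _ 0]) simp
next
  case (2 m c)
  show ?case
    by (rule exI[of _ "Max (insert 0 (keys m))"]) (auto simp: in_U_iff split: if_splits)
next
  case (3 p q)
  then obtain N M where "p \<in> U N" "q \<in> U M" by auto
  then have "p \<in> U (max N M)" "q \<in> U (max N M)"
    using U_mono[of N "max N M"] U_mono[of M "max N M"] by auto
  then have "p + q \<in> U (max N M)" by simp
  then show ?case ..
qed

lemma subst_subst: "subst g (subst g' p) = subst (\<lambda>i. subst g (g' i)) p"
proof -
  obtain N where "p \<in> U N" using ex_U by blast
  then show ?thesis
    by (rule U_hom_eq[OF _ comm_ring_hom_comp[OF comm_ring_hom_subst comm_ring_hom_subst] comm_ring_hom_subst]) auto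
qed

lemma ev_subst: "ev v (subst g p) = ev (\<lambda>i. ev v (g i)) p"
proof -
  obtain N where "p \<in> U N" using ex_U by blast
  then show ?thesis
    by (rule U_hom_eq[OF _ comm_ring_hom_comp[OF comm_ring_hom_ev comm_ring_hom_subst] comm_ring_hom_ev]) auto
qed

lemma subst_in_U: "p \<in> U N \<Longrightarrow> (\<And>i. i \<le> N \<Longrightarrow> g i \<in> U M) \<Longrightarrow> subst g p \<in> U M"
  by (induction rule: U_induct) (auto simp: subst.hom_add subst.hom_mult)

text \<open>A retraction of all polynomials onto \<open>U N\<close>. Since it fixes generators in
  \<open>U N\<close>, applying it to a linear combination of them moves the coefficients into
  \<open>U N\<close>.\<close>

definition restr :: "nat \<Rightarrow> cpoly \<Rightarrow> cpoly" where
  "restr N = subst (\<lambda>i. if i \<le> N then Var i else 0)"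

lemma restr_id: "p \<in> U N \<Longrightarrow> restr N p = p"
  unfolding restr_def by (rule subst_ident) auto

lemma restr_in_U: "restr N p \<in> U N"
proof -
  obtain M where "p \<in> U M" using ex_U by blast
  then show ?thesis unfolding restr_def by (rule subst_in_U) auto
qed

section \<open>Degrees\<close>

definition homog :: "nat \<Rightarrow> cpoly set" where
  "homog d = {p. \<forall>m\<in>keys p. monom_degree m = d}"

lemma forms_iff: "p \<in> forms N d \<longleftrightarrow> p \<in> U N \<and> p \<in> homog d"
  by (simp add: forms_def homog_def)

lemma monom_degree_superset:
  "finite A \<Longrightarrow> keys m \<subseteq> A \<Longrightarrow> monom_degree m = (\<Sum>i\<in>A. lookup m i)"
  unfolding monom_degree_def by (intro sum.mono_neutral_left) (auto simp: in_keys_iff)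

lemma monom_degree_add: "monom_degree (m + m') = monom_degree m + monom_degree m'"
proof -
  let ?A = "keys m \<union> keys m'"
  have "monom_degree (m + m') = (\<Sum>i\<in>?A. lookup (m + m') i)"
    by (rule monom_degree_superset) (auto simp: keys_add)
  then show ?thesis
    by (simp add: lookup_add sum.distrib monom_degree_superset[of ?A])
qed

lemma monom_degree_0 [simp]: "monom_degree 0 = 0" by (simp add: monom_degree_def)

lemma monom_degree_single [simp]: "monom_degree (single i k) = k"
  by (cases "k = 0") (simp_all add: monom_degree_def)

lemma homog_closed [simp, intro]:
  "0 \<in> homog d" "1 \<in> homog 0" "Const c \<in> homog 0" "Var i \<in> homog 1" "Var i \<in> homog (Suc 0)"
  "p \<in> homog d \<Longrightarrow> q \<in> homog d \<Longrightarrow> p + q \<in> homog d"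
  "p \<in> homog d \<Longrightarrow> - p \<in> homog d"
  "p \<in> homog d \<Longrightarrow> q \<in> homog d \<Longrightarrow> p - q \<in> homog d"
proof -
  show add: "p \<in> homog d \<Longrightarrow> q \<in> homog d \<Longrightarrow> p + q \<in> homog d" for p q
    using keys_add[of p q] by (auto simp: homog_def)
  show um: "p \<in> homog d \<Longrightarrow> - p \<in> homog d" for p
    by (auto simp: homog_def in_keys_iff)
  show "p \<in> homog d \<Longrightarrow> q \<in> homog d \<Longrightarrow> p - q \<in> homog d" for p q
    using add[OF _ um, of p q] by simp
qed (auto simp: homog_def Const_def Var_def)

lemma homog_mult: "p \<in> homog d \<Longrightarrow> q \<in> homog e \<Longrightarrow> p * q \<in> homog (d + e)"
  unfolding homog_def using keys_mult[of p q] by (auto simp: monom_degree_add)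

lemma homog_Const_mult: "p \<in> homog d \<Longrightarrow> Const c * p \<in> homog d"
  using homog_mult[of "Const c" 0 p d] by simp

lemma homog_power: "p \<in> homog d \<Longrightarrow> p ^ k \<in> homog (k * d)"
  by (induction k) (auto intro: homog_mult)

lemma homog_sum: "(\<And>x. x \<in> A \<Longrightarrow> f x \<in> homog d) \<Longrightarrow> sum f A \<in> homog d"
  by (induction A rule: infinite_finite_induct) auto

lemma homog_prod: "(\<And>x. x \<in> A \<Longrightarrow> f x \<in> homog (d x)) \<Longrightarrow> prod f A \<in> homog (sum d A)"
  by (induction A rule: infinite_finite_induct) (auto intro: homog_mult)

lemma homog_mon: "(\<And>i. i \<in> keys m \<Longrightarrow> g i \<in> homog d) \<Longrightarrow> mon g m \<in> homog (d * monom_degree m)"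
proof -
  assume "\<And>i. i \<in> keys m \<Longrightarrow> g i \<in> homog d"
  then have "mon g m \<in> homog (\<Sum>i\<in>keys m. lookup m i * d)"
    unfolding mon_def by (intro homog_prod homog_power)
  then show ?thesis by (simp add: monom_degree_def sum_distrib_left mult.commute)
qed

lemma homog_subst:
  assumes "p \<in> forms N e" "\<And>i. i \<le> N \<Longrightarrow> g i \<in> homog d"
  shows "subst g p \<in> homog (d * e)"
proof -
  have "subst g p = (\<Sum>m\<in>keys p. subst g (single m (lookup p m)))"
    by (subst poly_mapping_sum_singles[of p]) (simp add: subst.hom_sum)
  moreover have "subst g (single m (lookup p m)) \<in> homog (d * e)"
    if "m \<in> keys p" for m
  proof -
    have "monom_degree m = e" "keys m \<subseteq> {..N}"
      using assms(1) that by (auto simp: forms_iff in_U_iff homog_def)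
    moreover have "mon g m \<in> homog (d * monom_degree m)"
      by (rule homog_mon) (use \<open>_ \<subseteq> {..N}\<close> assms(2) in auto)
    ultimately show ?thesis by (auto simp: subst_single intro: homog_Const_mult)
  qed
  ultimately show ?thesis by (auto intro: homog_sum)
qed

lemma forms_subst:
  assumes "p \<in> forms N e" "\<And>i. i \<le> N \<Longrightarrow> g i \<in> forms M d"
  shows "subst g p \<in> forms M (d * e)"
  using assms homog_subst[of p N e g d] subst_in_U[of p N g M] by (auto simp: forms_iff)

lemma forms_mult: "p \<in> forms N d \<Longrightarrow> q \<in> forms N e \<Longrightarrow> p * q \<in> forms N (d + e)"
  by (auto simp: forms_iff homog_mult)

lemma forms_sum: "(\<And>x. x \<in> A \<Longrightarrow> f x \<in> forms N d) \<Longrightarrow> sum f A \<in> forms N d"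
  by (auto simp: forms_iff homog_sum)

lemma forms_Const_mult: "p \<in> forms N d \<Longrightarrow> Const c * p \<in> forms N d"
  by (auto simp: forms_iff homog_Const_mult)

lemma forms_power: "p \<in> forms N d \<Longrightarrow> p ^ k \<in> forms N (k * d)"
  by (auto simp: forms_iff homog_power)

lemma forms_closed [simp, intro]:
  "0 \<in> forms N d" "1 \<in> forms N 0" "Const c \<in> forms N 0" "i \<le> N \<Longrightarrow> Var i \<in> forms N 1" "i \<le> N \<Longrightarrow> Var i \<in> forms N (Suc 0)"
  "p \<in> forms N d \<Longrightarrow> q \<in> forms N d \<Longrightarrow> p + q \<in> forms N d"
  "p \<in> forms N d \<Longrightarrow> - p \<in> forms N d"
  "p \<in> forms N d \<Longrightarrow> q \<in> forms N d \<Longrightarrow> p - q \<in> forms N d"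
  by (auto simp: forms_iff)

definition hom_part :: "nat \<Rightarrow> cpoly \<Rightarrow> cpoly" where
  "hom_part d p = Poly_Mapping.mapp (\<lambda>m c. if monom_degree m = d then c else 0) p"

lemma lookup_hom_part: "lookup (hom_part d p) m = (if monom_degree m = d then lookup p m else 0)"
  by (auto simp: hom_part_def lookup_mapp when_def in_keys_iff)

lemma hom_part_add: "hom_part d (p + q) = hom_part d p + hom_part d q"
  by (rule poly_mapping_eqI) (auto simp: lookup_hom_part lookup_add)

lemma hom_part_0 [simp]: "hom_part d 0 = 0"
  by (rule poly_mapping_eqI) (auto simp: lookup_hom_part)

lemma hom_part_sum: "hom_part d (sum f A) = (\<Sum>x\<in>A. hom_part d (f x))"
  by (induction A rule: infinite_finite_induct) (auto simp: hom_part_add)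

lemma hom_part_homog: "hom_part d p \<in> homog d"
  by (auto simp: homog_def in_keys_iff lookup_hom_part split: if_splits)

lemma hom_part_in_U: "p \<in> U N \<Longrightarrow> hom_part d p \<in> U N"
  by (auto simp: in_U_iff in_keys_iff lookup_hom_part split: if_splits)

lemma hom_part_forms: "p \<in> U N \<Longrightarrow> hom_part d p \<in> forms N d"
  by (auto simp: forms_iff hom_part_homog hom_part_in_U)

lemma hom_part_of_homog: "p \<in> homog e \<Longrightarrow> hom_part d p = (if d = e then p else 0)"
  by (rule poly_mapping_eqI) (auto simp: lookup_hom_part homog_def in_keys_iff)

lemma hom_part_sum_eq: "(\<And>m. m \<in> keys p \<Longrightarrow> monom_degree m \<le> D) \<Longrightarrow> p = (\<Sum>d\<le>D. hom_part d p)"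
  by (rule poly_mapping_eqI) (auto simp: lookup_sum lookup_hom_part in_keys_iff sum.delta)

lemma ex_hom_part_sum: "\<exists>D. p = (\<Sum>d\<le>D. hom_part d p)"
proof -
  have "p = (\<Sum>d\<le>Max (insert 0 (monom_degree ` keys p)). hom_part d p)"
    by (rule hom_part_sum_eq) auto
  then show ?thesis ..
qed

lemma hom_part_mult:
  assumes "q \<in> homog e"
  shows "hom_part d (p * q) = (if e \<le> d then hom_part (d - e) p * q else 0)"
proof -
  obtain D where D: "p = (\<Sum>k\<le>D. hom_part k p)" using ex_hom_part_sum by blast
  have "hom_part d (p * q) = (\<Sum>k\<le>D. hom_part d (hom_part k p * q))"
    by (subst D) (simp add: sum_distrib_right hom_part_sum)
  also have "\<dots> = (\<Sum>k\<le>D. if d = k + e then hom_part k p * q else 0)"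
    by (intro sum.cong refl) (subst hom_part_of_homog[OF homog_mult[OF hom_part_homog assms]], rule refl)
  also have "\<dots> = (\<Sum>k\<le>D. (if e \<le> d then hom_part (d - e) (hom_part k p) * q else 0))"
    by (intro sum.cong refl) (auto simp: hom_part_of_homog[OF hom_part_homog])
  also have "\<dots> = (if e \<le> d then hom_part (d - e) (\<Sum>k\<le>D. hom_part k p) * q else 0)"
    by (simp add: hom_part_sum sum_distrib_right)
  finally show ?thesis using D by simp
qed

lemma hom_part_subst:
  assumes "p \<in> U N" "\<And>i. i \<le> N \<Longrightarrow> g i \<in> homog d" "d > 0"
  shows "hom_part (d * k) (subst g p) = subst g (hom_part k p)"
proof -
  obtain D where D: "p = (\<Sum>k\<le>D. hom_part k p)" using ex_hom_part_sum by blast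
  have "hom_part (d * k) (subst g p) = (\<Sum>j\<le>D. hom_part (d * k) (subst g (hom_part j p)))"
    by (subst D) (simp add: subst.hom_sum hom_part_sum)
  also have "\<dots> = (\<Sum>j\<le>D. if k = j then subst g (hom_part j p) else 0)"
  proof (intro sum.cong refl)
    fix j
    \<comment> \<open>Different components land in different degrees because
      \<open>d > 0\<close>.\<close>
    have "subst g (hom_part j p) \<in> homog (d * j)"
      by (rule homog_subst[of _ N]) (use assms in \<open>auto intro: hom_part_forms\<close>)
    then show "hom_part (d * k) (subst g (hom_part j p)) = (if k = j then subst g (hom_part j p) else 0)"
      using hom_part_of_homog[of "subst g (hom_part j p)" "d * j" "d * k"] assms(3) by auto
  qed
  also have "\<dots> = (\<Sum>j\<le>D. subst g (hom_part k (hom_part j p)))"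
    by (intro sum.cong refl) (auto simp: hom_part_of_homog[OF hom_part_homog])
  also have "\<dots> = subst g (hom_part k (\<Sum>j\<le>D. hom_part j p))"
    by (simp add: hom_part_sum subst.hom_sum)
  finally show ?thesis using D by simp
qed

lemma homog_0_Const: "p \<in> homog 0 \<Longrightarrow> p = Const (lookup p 0)"
proof -
  assume p: "p \<in> homog 0"
  have "lookup p m = 0" if "m \<noteq> 0" for m
  proof (rule ccontr)
    assume "lookup p m \<noteq> 0"
    then have "monom_degree m = 0" using p by (auto simp: homog_def in_keys_iff)
    then have "m = 0"
      by (intro poly_mapping_eqI) (auto simp: monom_degree_def in_keys_iff)
    then show False using that by simp
  qed
  then show ?thesis
    by (intro poly_mapping_eqI) (auto simp: Const_def lookup_single when_def)
qed

lemma monom_degree_1: "monom_degree m = 1 \<Longrightarrow> \<exists>i. m = single i 1"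
proof -
  assume d: "monom_degree m = 1"
  then have "keys m \<noteq> {}" by (auto simp: monom_degree_def)
  then obtain i where i: "i \<in> keys m" by blast
  have "1 = lookup m i + (\<Sum>j\<in>keys m - {i}. lookup m j)"
    using d i unfolding monom_degree_def by (simp add: sum.remove)
  moreover have "lookup m i \<noteq> 0" using i by (simp add: in_keys_iff)
  ultimately have "lookup m i = 1 \<and> (\<Sum>j\<in>keys m - {i}. lookup m j) = 0"
    by arith
  then have "lookup m i = 1" "\<forall>j\<in>keys m - {i}. lookup m j = 0"
    by simp_all
  then have "lookup m j = (if j = i then 1 else 0)" for j
    by (metis DiffI in_keys_iff singletonD)
  then have "m = single i 1"
    by (intro poly_mapping_eqI) (auto simp: lookup_single when_def)
  then show ?thesis ..
qed

definition lcoeff :: "cpoly \<Rightarrow> nat \<Rightarrow> complex" where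
  "lcoeff p i = lookup p (single i 1)"

lemma linear_form_eq:
  assumes "p \<in> forms N 1"
  shows "p = (\<Sum>i\<le>N. Const (lcoeff p i) * Var i)"
proof (rule poly_mapping_eqI)
  fix m
  have inj: "single i (1::nat) = single j 1 \<longleftrightarrow> i = j" for i j
    by (metis lookup_single_eq lookup_single_not_eq zero_neq_one)
  have C: "Const c * Var i = single (single i 1) c" for c i
    by (simp add: single_eq)
  show "lookup p m = lookup (\<Sum>i\<le>N. Const (lcoeff p i) * Var i) m"
  proof (cases "\<exists>i\<le>N. m = single i 1")
    case True
    then obtain i where i: "i \<le> N" "m = single i 1" by blast
    then show ?thesis
      by (simp add: C lookup_sum lookup_single when_def inj lcoeff_def del: One_nat_def)
  next
    case False
    have "m \<notin> keys p"
    proof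
      assume m: "m \<in> keys p"
      then have "monom_degree m = 1" "keys m \<subseteq> {..N}" using assms
        by (auto simp: forms_iff homog_def in_U_iff)
      with monom_degree_1 obtain i where "m = single i 1" by blast
      with \<open>_ \<subseteq> {..N}\<close> have "i \<le> N" by auto
      with False \<open>m = _\<close> show False by blast
    qed
    then have "lookup p m = 0" by (simp add: in_keys_iff)
    moreover have "lookup (\<Sum>i\<le>N. Const (lcoeff p i) * Var i) m = 0"
      using False by (auto simp: C lookup_sum lookup_single when_def intro!: sum.neutral)
    ultimately show ?thesis by simp
  qed
qed

section \<open>Ideals\<close>

text \<open>Ideals of the whole polynomial ring are its submodules over itself:
  \<open>idl.span\<close> generates them and \<open>idl.subspace\<close> recognises them. The second
  interpretation \<open>cvs\<close> is the complex vector space structure.\<close>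

interpretation idl: Modules.module "(*) :: cpoly \<Rightarrow> cpoly \<Rightarrow> cpoly"
  by standard (rule distrib_left distrib_right mult.assoc[symmetric] mult_1_left)+

interpretation cvs: Vector_Spaces.vector_space "\<lambda>c p. Const c * p"
  by standard (simp_all only: Const.hom_add Const.hom_mult Const.hom_one distrib_left distrib_right mult.assoc mult_1_left)

declare idl.scale_scale [simp del] cvs.scale_scale [simp del]

lemma cring_poly_ring: "cring (poly_ring N)"
proof (rule cringI)
  show "abelian_group (poly_ring N)"
  proof (rule abelian_groupI, unfold poly_ring_simps)
    fix x assume "x \<in> U N"
    then show "\<exists>y\<in>U N. y + x = 0"
      by (intro bexI[of _ "- x"]) simp_all
  qed (erule (1) U_closed | rule U_closed add.assoc add_0_left add.commute)+
  show "comm_monoid (poly_ring N)"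
    by (rule comm_monoidI, unfold poly_ring_simps)
       (erule (1) U_closed | rule U_closed mult.assoc mult_1_left mult.commute)+
qed (unfold poly_ring_simps, rule distrib_right)

text \<open>That the contracted ideal is not larger than the one generated in
  \<open>poly_ring N\<close> comes from the retraction \<open>restr N\<close>, which fixes
  \<open>G\<close>.\<close>

lemma genideal_eq:
  assumes "G \<subseteq> U N"
  shows "genideal (poly_ring N) G = idl.span G \<inter> U N"
proof
  interpret R: cring "poly_ring N" by (rule cring_poly_ring)
  have ideal: "ideal (idl.span G \<inter> U N) (poly_ring N)"
  proof (rule idealI)
    show "subgroup (idl.span G \<inter> U N) (add_monoid (poly_ring N))"
    proof (rule R.add.subgroupI)
      show "idl.span G \<inter> U N \<noteq> {}" using idl.span_zero[of G] U_closed(1)[of N] by blast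
    next
      fix a assume "a \<in> idl.span G \<inter> U N"
      moreover from this have "\<ominus>\<^bsub>poly_ring N\<^esub> a = - a"
        by (intro R.minus_equality) auto
      ultimately show "\<ominus>\<^bsub>poly_ring N\<^esub> a \<in> idl.span G \<inter> U N"
        by (auto intro: idl.span_neg)
    qed (auto intro: idl.span_add)
  next
    fix a x assume "a \<in> idl.span G \<inter> U N" "x \<in> U N"
    then have "x * a \<in> idl.span G \<inter> U N" by (auto intro: idl.span_scale)
    then show "x \<otimes>\<^bsub>poly_ring N\<^esub> a \<in> idl.span G \<inter> U N" "a \<otimes>\<^bsub>poly_ring N\<^esub> x \<in> idl.span G \<inter> U N"
      by (simp_all add: mult.commute)
  qed (rule R.ring_axioms)
  then show "genideal (poly_ring N) G \<subseteq> idl.span G \<inter> U N"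
    by (rule R.genideal_minimal) (use assms in \<open>auto intro: idl.span_base\<close>)
  interpret I: ideal "genideal (poly_ring N) G" "poly_ring N"
    by (rule R.genideal_ideal[OF assms])
  have "restr N p \<in> genideal (poly_ring N) G" if "p \<in> idl.span G" for p
    using that
  proof (induction rule: idl.span_induct_alt)
    case base
    then show ?case using I.zero_closed by (simp add: restr_def)
  next
    case (step c x y)
    have "x \<in> genideal (poly_ring N) G" "x \<in> U N"
      using R.genideal_self[OF assms] step assms by auto
    then have "restr N c * x \<in> genideal (poly_ring N) G"
      using I.I_l_closed[of x "restr N c"] restr_in_U[of N c] by simp
    moreover have "restr N (c * x + y) = restr N c * x + restr N y"
      using restr_id[OF \<open>x \<in> U N\<close>] by (simp add: restr_def subst.hom_add subst.hom_mult)
    ultimately show ?case using I.a_closed step by auto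
  qed
  then show "idl.span G \<inter> U N \<subseteq> genideal (poly_ring N) G"
    using restr_id by force
qed

lemma span_U_insert:
  assumes "p \<in> idl.span (insert g G)" "p \<in> U N" "g \<in> U N" "G \<subseteq> U N"
  obtains c where "c \<in> U N" "p - c * g \<in> idl.span G"
proof -
  obtain k where k: "p - k * g \<in> idl.span G" using assms idl.span_breakdown_eq by blast
  have "restr N q \<in> idl.span G" if "q \<in> idl.span G" for q
    using that
  proof (induction rule: idl.span_induct_alt)
    case (step c x y)
    then have "restr N (c * x + y) = restr N c * x + restr N y"
      using assms(4) restr_id[of x N] by (auto simp: restr_def subst.hom_add subst.hom_mult)
    then show ?case using step idl.span_add[OF idl.span_scale[OF idl.span_base]] by simp
  qed (simp add: restr_def idl.span_zero)
  from this[OF k] have "p - restr N k * g \<in> idl.span G"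
    using restr_id[OF assms(2)] restr_id[OF assms(3)]
    by (simp add: restr_def subst.hom_minus subst.hom_mult)
  then show ?thesis using that restr_in_U by blast
qed

lemma span_U_finite:
  assumes "finite G" "p \<in> idl.span G" "p \<in> U N" "G \<subseteq> U N"
  obtains c where "\<And>g. c g \<in> U N" "p = (\<Sum>g\<in>G. c g * g)"
proof -
  obtain c where c: "(\<Sum>g\<in>G. c g * g) = p" using assms(1,2) by (auto simp: idl.span_finite)
  have "p = restr N (\<Sum>g\<in>G. c g * g)" using restr_id[OF assms(3)] c by simp
  also have "\<dots> = (\<Sum>g\<in>G. restr N (c g) * restr N g)"
    by (simp add: restr_def subst.hom_sum subst.hom_mult)
  also have "\<dots> = (\<Sum>g\<in>G. restr N (c g) * g)"
  proof (rule sum.cong[OF refl])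
    fix g assume "g \<in> G"
    then show "restr N (c g) * restr N g = restr N (c g) * g" using restr_id[of g N] assms(4) by auto
  qed
  finally have "p = (\<Sum>g\<in>G. restr N (c g) * g)" .
  then show ?thesis by (rule that[of "\<lambda>g. restr N (c g)", OF restr_in_U])
qed

lemma span_subst_cong:
  assumes "p \<in> U N" "\<And>i. i \<le> N \<Longrightarrow> g i - g' i \<in> idl.span G"
  shows "subst g p - subst g' p \<in> idl.span G"
  using assms(1)
proof (induction rule: U_induct)
  case (add p q)
  have "subst g (p + q) - subst g' (p + q) = (subst g p - subst g' p) + (subst g q - subst g' q)"
    by (simp add: subst.hom_add)
  then show ?case using idl.span_add[OF add(3,4)] by simp
next
  case (mult p q)
  have "subst g (p * q) - subst g' (p * q) = subst g q * (subst g p - subst g' p) + subst g' p * (subst g q - subst g' q)"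
    by (simp add: subst.hom_mult algebra_simps)
  then show ?case using idl.span_add[OF idl.span_scale[OF mult(3)] idl.span_scale[OF mult(4)]] by simp
qed (use assms(2) in \<open>auto simp: idl.span_zero\<close>)

section \<open>Nullstellensatz\<close>

lemma finite_monomials: "finite {m :: nat \<Rightarrow>\<^sub>0 nat. keys m \<subseteq> {..N} \<and> (\<forall>i. lookup m i \<le> K)}" (is "finite ?M")
proof (rule finite_imageD)
  show "finite ((\<lambda>m. restrict (lookup m) {..N}) ` ?M)"
    by (rule finite_subset[OF _ finite_PiE[of "{..N}" "\<lambda>_. {..K}"]], intro image_subsetI PiE_I) auto
  show "inj_on (\<lambda>m. restrict (lookup m) {..N}) ?M"
  proof (rule inj_onI)
    fix a b assume ab: "a \<in> ?M" "b \<in> ?M" "restrict (lookup a) {..N} = restrict (lookup b) {..N}"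
    show "a = b"
    proof (rule poly_mapping_eqI)
      fix i show "lookup a i = lookup b i"
      proof (cases "i \<le> N")
        case True
        then show ?thesis using fun_cong[OF ab(3), of i] by simp
      next
        case False
        then have "i \<notin> keys a" "i \<notin> keys b" using ab by auto
        then show ?thesis by (simp add: in_keys_iff)
      qed
    qed
  qed
qed

text \<open>One bound serves for indices and exponents. The boxes are finite and exhaust the
  monomials, which is how countable dimension is used.\<close>

definition monomial_box :: "nat \<Rightarrow> (nat \<Rightarrow>\<^sub>0 nat) set" where
  "monomial_box N = {m. keys m \<subseteq> {..N} \<and> (\<forall>i. lookup m i \<le> N)}"

lemma ex_monomial_bound:
  "\<exists>N. keys p \<subseteq> {m :: nat \<Rightarrow>\<^sub>0 nat. keys m \<subseteq> {..N} \<and> (\<forall>i. lookup m i \<le> N)}"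
proof -
  let ?S = "insert 0 (\<Union>m\<in>keys p. keys m \<union> Poly_Mapping.range m)"
  have "finite ?S" by simp
  then obtain N where N: "\<And>x. x \<in> ?S \<Longrightarrow> x \<le> N" using Max_ge by blast
  have "keys m \<subseteq> {..N} \<and> (\<forall>i. lookup m i \<le> N)" if m: "m \<in> keys p" for m
  proof
    show "keys m \<subseteq> {..N}"
    proof
      fix x assume "x \<in> keys m"
      then have "x \<in> ?S" using m by blast
      then show "x \<in> {..N}" using N by blast
    qed
    show "\<forall>i. lookup m i \<le> N"
    proof
      fix i
      show "lookup m i \<le> N"
      proof (cases "lookup m i = 0")
        case False
        then have "i \<in> keys m" by (simp only: in_keys_iff not_False_eq_True)
        then have "lookup m i \<in> Poly_Mapping.range m" by (rule in_keys_lookup_in_range)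
        then have "lookup m i \<in> ?S" using m by blast
        then show ?thesis by (rule N)
      qed simp
    qed
  qed
  then show ?thesis by blast
qed

lemma span_monomials:
  assumes "keys p \<subseteq> A"
  shows "p \<in> cvs.span (mon Var ` A)"
proof -
  have "p = (\<Sum>m\<in>keys p. Const (lookup p m) * mon Var m)"
    using poly_mapping_sum_singles[of p] by (simp only: single_eq)
  also have "\<dots> \<in> cvs.span (mon Var ` A)"
    using assms by (intro cvs.span_sum cvs.span_scale cvs.span_base) auto
  finally show ?thesis .
qed

text \<open>Stated for a family and not for a set: two equal members already give the relation with
  coefficients 1 and -1.\<close>

lemma finite_dim_dependent:
  assumes "finite S" "card S < card T" "\<And>c. c \<in> T \<Longrightarrow> a c \<in> cvs.span S"
  obtains l where "\<exists>c\<in>T. l c \<noteq> 0" "(\<Sum>c\<in>T. Const (l c) * a c) = 0"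
proof -
  have T: "finite T" using assms(2) card.infinite by force
  show ?thesis
  proof (cases "inj_on a T")
    case True
    have "cvs.dependent (a ` T)"
    proof (rule ccontr)
      assume "\<not> cvs.dependent (a ` T)"
      then have "card (a ` T) \<le> card S"
        using cvs.independent_span_bound[OF assms(1), of "a ` T"] assms(3) by auto
      with assms(2) True show False by (simp add: card_image)
    qed
    then obtain u where "\<exists>v\<in>a ` T. u v \<noteq> 0" "(\<Sum>v\<in>a ` T. Const (u v) * v) = 0"
      using cvs.dependent_finite[of "a ` T"] T by auto
    then show ?thesis using that[of "u \<circ> a"] True by (auto simp: sum.reindex)
  next
    case False
    then obtain c d where cd: "c \<in> T" "d \<in> T" "c \<noteq> d" "a c = a d" by (auto simp: inj_on_def)
    define l :: "_ \<Rightarrow> complex" where "l = (\<lambda>x. if x = c then 1 else if x = d then -1 else 0)"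
    have "(\<Sum>x\<in>T. Const (l x) * a x) = (\<Sum>x\<in>{c,d}. Const (l x) * a x)"
      using T cd by (intro sum.mono_neutral_right) (auto simp: l_def)
    also have "\<dots> = 0" using cd by (simp add: l_def Const.hom_uminus)
    finally show ?thesis by (intro that[of l] bexI[of _ c]) (use cd(1) in \<open>simp_all add: l_def\<close>)
  qed
qed

definition poly_at :: "nat \<Rightarrow> complex poly \<Rightarrow> cpoly" where
  "poly_at i q = poly (map_poly Const q) (Var i)"

lemma poly_at_simps:
  "poly_at i 0 = 0" "poly_at i (pCons a q) = Const a + Var i * poly_at i q"
  by (simp_all add: poly_at_def Polynomial.map_poly_pCons)

lemma poly_at_add: "poly_at i (p + q) = poly_at i p + poly_at i q"
  by (induction p q rule: poly_induct2) (auto simp: poly_at_simps Const.hom_add algebra_simps)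

lemma poly_at_smult: "poly_at i (Polynomial.smult c q) = Const c * poly_at i q"
proof (induction q)
  case (pCons a q)
  have "Const (c * a) + Var i * (Const c * poly_at i q) = Const c * (Const a + Var i * poly_at i q)"
    by (subst Const.hom_mult) (simp only: distrib_left mult.left_commute)
  then show ?case by (simp only: smult_pCons poly_at_simps pCons.IH)
qed (simp add: poly_at_simps)

lemma poly_at_mult: "poly_at i (p * q) = poly_at i p * poly_at i q"
proof (induction p)
  case (pCons a p)
  have "poly_at i (pCons a p * q) = Const a * poly_at i q + Var i * (poly_at i p * poly_at i q)"
    by (simp only: mult_pCons_left poly_at_add poly_at_smult poly_at_simps pCons.IH Const.hom_zero add_0_left)
  then show ?case by (simp only: poly_at_simps distrib_right mult.assoc)
qed (simp add: poly_at_simps)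

lemma poly_at_sum: "poly_at i (sum f A) = (\<Sum>x\<in>A. poly_at i (f x))"
  by (induction A rule: infinite_finite_induct) (auto simp: poly_at_simps poly_at_add)

lemma poly_at_prod: "poly_at i (\<Prod>c\<in>A. [:- c, 1:]) = (\<Prod>c\<in>A. Var i - Const c)"
proof (induction A rule: infinite_finite_induct)
  case (insert x F)
  have "poly_at i [:- x, 1:] = Var i - Const x" by (simp add: poly_at_simps Const.hom_uminus)
  then show ?case
    unfolding prod.insert[OF insert(1,2)] poly_at_mult insert(3) by simp
qed (simp_all add: poly_at_simps poly_at_def)

lemma subst_Const_ev: "subst (\<lambda>i. Const (v i)) p = Const (ev v p)"
proof -
  obtain N where "p \<in> U N" using ex_U by blast
  then show ?thesis
    by (rule U_hom_eq[OF _ comm_ring_hom_subst comm_ring_hom_comp[OF comm_ring_hom_Const comm_ring_hom_ev]]) auto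
qed

text \<open>Countably many finite fibres cannot cover the uncountable complex numbers. The pair will
  be a power of \<open>p\<close> and a monomial box.\<close>

lemma ex_infinite_fibre:
  fixes h :: "complex \<Rightarrow> nat \<times> nat"
  shows "\<exists>y. infinite {c. h c = y}"
proof (rule ccontr)
  assume "\<nexists>y. infinite {c. h c = y}"
  then have "countable (\<Union>y. {c. h c = y})"
    by (intro countable_UN) (auto intro: countable_finite)
  then have "countable (UNIV :: complex set)"
    by (rule countable_subset[rotated]) auto
  then have "countable (range complex_of_real)" by (rule countable_subset[rotated]) auto
  then have "countable (UNIV :: real set)"
    by (rule countable_image_inj_on) (auto simp: inj_on_def)
  then show False using uncountable_UNIV_real by blast
qed

text \<open>
  An ideal maximal among those containing \<open>D\<close> and no power of \<open>p\<close> is the ideal of a point: otherwise,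
  for some coordinate \<open>x\<close>, the \<open>(x - c)\<^sup>-\<^sup>1\<close> would be uncountably many linearly independent elements of
  a space of countable dimension.
\<close>

theorem nullstellensatz:
  assumes D: "idl.subspace D" and p: "\<And>k. p ^ k \<notin> D"
  shows "\<exists>v. (\<forall>w\<in>D. ev v w = 0) \<and> ev v p \<noteq> 0"
proof -
  define \<A> where "\<A> = {M. idl.subspace M \<and> D \<subseteq> M \<and> (\<forall>k. p ^ k \<notin> M)}"
  have "\<exists>M\<in>\<A>. \<forall>X\<in>\<A>. M \<subseteq> X \<longrightarrow> X = M"
  proof (rule subset_Zorn_nonempty)
    show "\<A> \<noteq> {}" using D p by (auto simp: \<A>_def)
    fix \<C> assume C: "\<C> \<noteq> {}" "subset.chain \<A> \<C>"
    then have sub: "\<And>M. M \<in> \<C> \<Longrightarrow> idl.subspace M \<and> D \<subseteq> M \<and> (\<forall>k. p ^ k \<notin> M)"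
      and ch: "\<And>M M'. M \<in> \<C> \<Longrightarrow> M' \<in> \<C> \<Longrightarrow> M \<subseteq> M' \<or> M' \<subseteq> M"
      unfolding subset_chain_def \<A>_def by blast+
    have "idl.subspace (\<Union>\<C>)"
    proof (rule idl.subspaceI)
      show "0 \<in> \<Union>\<C>" using C(1) sub idl.subspace_0 by blast
      show "x + y \<in> \<Union>\<C>" if xy: "x \<in> \<Union>\<C>" "y \<in> \<Union>\<C>" for x y
      proof -
        obtain M M' where M: "x \<in> M" "M \<in> \<C>" "y \<in> M'" "M' \<in> \<C>" using xy by blast
        then consider "M \<subseteq> M'" | "M' \<subseteq> M" using ch by blast
        then show ?thesis
        proof cases
          case 1
          then have "x + y \<in> M'" using M sub by (intro idl.subspace_add) auto
          then show ?thesis using M(4) by blast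
        next
          case 2
          then have "x + y \<in> M" using M sub by (intro idl.subspace_add) auto
          then show ?thesis using M(2) by blast
        qed
      qed
      show "c * x \<in> \<Union>\<C>" if x: "x \<in> \<Union>\<C>" for c x
      proof -
        obtain M where M: "x \<in> M" "M \<in> \<C>" using x by blast
        then have "c * x \<in> M" using sub by (intro idl.subspace_scale) auto
        then show ?thesis using M(2) by blast
      qed
    qed
    moreover have "D \<subseteq> \<Union>\<C>" using C(1) sub by blast
    moreover have "p ^ k \<notin> \<Union>\<C>" for k using sub by blast
    ultimately show "\<Union>\<C> \<in> \<A>" by (simp add: \<A>_def)
  qed
  then obtain M where M: "idl.subspace M" "D \<subseteq> M" "\<And>k. p ^ k \<notin> M"
    and max0: "\<forall>X\<in>\<A>. M \<subseteq> X \<longrightarrow> X = M"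
    by (auto simp: \<A>_def)
  have max: "X = M" if "idl.subspace X" "M \<subseteq> X" "\<And>k. p ^ k \<notin> X" for X
  proof -
    have "X \<in> \<A>" using that M(2) by (auto simp: \<A>_def)
    then show ?thesis using max0 that(2) by blast
  qed
  note Mc = idl.subspace_add[OF M(1)] idl.subspace_scale[OF M(1)] idl.subspace_diff[OF M(1)] idl.subspace_sum[OF M(1)]
  have one: "1 \<notin> M" using M(3)[of 0] by simp
  \<comment> \<open>By maximality the ideal generated by \<open>M\<close> and \<open>w\<close>
    contains a power of \<open>p\<close>; so \<open>w\<close> becomes invertible modulo
    \<open>M\<close> once \<open>p\<close> is inverted.\<close>
  have max': "\<exists>k a. p ^ k - a * w \<in> M" if "w \<notin> M" for w
  proof (rule ccontr)
    assume no: "\<nexists>k a. p ^ k - a * w \<in> M"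
    have spM: "idl.span M = M" using M(1) by simp
    have "idl.span (insert w M) = M"
    proof (rule max)
      show "M \<subseteq> idl.span (insert w M)" using idl.span_superset by blast
      show "p ^ k \<notin> idl.span (insert w M)" for k
        using no idl.span_breakdown_eq[of "p ^ k" w M] spM by auto
    qed simp
    moreover have "w \<in> idl.span (insert w M)" by (rule idl.span_base) simp
    ultimately show False using that by simp
  qed
  have prime: "a \<in> M \<or> b \<in> M" if ab: "a * b \<in> M" for a b
  proof (rule ccontr)
    assume "\<not> (a \<in> M \<or> b \<in> M)"
    then obtain k x j y where xy: "p ^ k - x * a \<in> M" "p ^ j - y * b \<in> M" using max' by blast
    have "p ^ (k + j) = p ^ j * (p ^ k - x * a) + (x * a) * (p ^ j - y * b) + (x * y) * (a * b)"
      by (simp add: power_add algebra_simps)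
    then have "p ^ (k + j) \<in> M" using xy ab Mc by simp
    with M(3) show False by blast
  qed
  \<comment> \<open>A nonzero polynomial in one coordinate splits into linear factors, and the prime
    ideal \<open>M\<close> contains one of them.\<close>
  have split: "\<exists>r. Var i - Const r \<in> M" if "poly_at i q \<in> M" "q \<noteq> 0" for i q
    using that
  proof (induction "degree q" arbitrary: q)
    case 0
    then obtain c where "q = [:c:]" "c \<noteq> 0" by (metis degree_eq_zeroE pCons_0_0)
    then have "Const c \<in> M" using 0 by (simp add: poly_at_simps)
    then have "Const (1 / c) * Const c \<in> M" by (rule Mc)
    then have "1 \<in> M" using \<open>c \<noteq> 0\<close> by (simp flip: Const.hom_mult)
    with one show ?case by simp
  next
    case (Suc d)
    then obtain r where "poly q r = 0"
      using fundamental_theorem_of_algebra[of q] by (auto simp: constant_degree)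
    then obtain q' where q': "q = [:- r, 1:] * q'" by (auto simp: poly_eq_0_iff_dvd)
    then have "poly_at i [:- r, 1:] * poly_at i q' \<in> M" using Suc.prems by (simp add: poly_at_mult del: mult_pCons_left)
    moreover have "poly_at i [:- r, 1:] = Var i - Const r" by (simp add: poly_at_simps Const.hom_uminus)
    ultimately have "Var i - Const r \<in> M \<or> poly_at i q' \<in> M" using prime by simp
    moreover have "q' \<noteq> 0" using q' Suc.prems by auto
    moreover from this have "degree q' = d" using q' Suc(2) by (simp add: degree_mult_eq del: mult_pCons_left)
    ultimately show ?case using Suc(1) by auto
  qed
  have "\<exists>r. Var i - Const r \<in> M" for i
  proof (rule ccontr)
    assume no: "\<nexists>r. Var i - Const r \<in> M"
    then have "\<forall>c. \<exists>k a. p ^ k - a * (Var i - Const c) \<in> M" using max' by blast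
    \<comment> \<open>Modulo \<open>M\<close>, \<open>a c\<close> plays the part of
      \<open>p ^ k c\<close> divided by \<open>Var i - Const c\<close>.\<close>
    then obtain k a where ka: "\<And>c. p ^ k c - a c * (Var i - Const c) \<in> M" by metis
    have "\<forall>c. \<exists>N. keys (a c) \<subseteq> monomial_box N"
      using ex_monomial_bound by (auto simp: monomial_box_def)
    from choice[OF this] obtain N where N: "\<And>c. keys (a c) \<subseteq> monomial_box (N c)" by blast
    \<comment> \<open>Infinitely many \<open>c\<close> share the exponent \<open>k0\<close> and the
      box \<open>N0\<close>, so their \<open>a c\<close> lie in one finite-dimensional
      space.\<close>
    obtain k0 N0 where inf: "infinite {c. (k c, N c) = (k0, N0)}"
      using ex_infinite_fibre[of "\<lambda>c. (k c, N c)"] by auto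
    define S where "S = mon Var ` monomial_box N0"
    have finS: "finite S" unfolding S_def monomial_box_def by (intro finite_imageI finite_monomials)
    obtain T where T: "T \<subseteq> {c. (k c, N c) = (k0, N0)}" "card T = Suc (card S)" "finite T"
      using infinite_arbitrarily_large[OF inf] by blast
    have "a c \<in> cvs.span S" if "c \<in> T" for c
    proof -
      have "N c = N0" using that T(1) by auto
      then show ?thesis unfolding S_def using N[of c] by (intro span_monomials) simp
    qed
    then obtain l where l: "\<exists>c\<in>T. l c \<noteq> 0" "(\<Sum>c\<in>T. Const (l c) * a c) = 0"
      using finite_dim_dependent[OF finS, of T a] T(2) by auto
    \<comment> \<open>The numerator of the sum of the fractions \<open>l c / (x - c)\<close> over
      \<open>T\<close>. At a point \<open>c\<close> of \<open>T\<close> only the summand of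
      \<open>c\<close> survives, so \<open>q\<close> is nonzero where \<open>l c\<close> is.\<close>
    define q where "q = (\<Sum>c\<in>T. Polynomial.smult (l c) (\<Prod>d\<in>T - {c}. [:- d, 1:]))"
    let ?P = "\<lambda>c. (\<Prod>d\<in>T - {c}. Var i - Const d)"
    have "q \<noteq> 0"
    proof -
      from l(1) obtain c where c: "c \<in> T" "l c \<noteq> 0" by blast
      have "poly q c = (\<Sum>e\<in>T. l e * (\<Prod>d\<in>T - {e}. c - d))"
        by (simp add: q_def poly_sum poly_prod)
      also have "\<dots> = (\<Sum>e\<in>T. if e = c then l c * (\<Prod>d\<in>T - {c}. c - d) else 0)"
        using T(3) c(1) by (intro sum.cong refl) (auto intro!: prod_zero)
      also have "\<dots> = l c * (\<Prod>d\<in>T - {c}. c - d)" using T(3) c(1) by simp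
      also have "\<dots> \<noteq> 0" using c(2) T(3) by auto
      finally show ?thesis by auto
    qed
    have "p ^ k0 * poly_at i q = (\<Sum>c\<in>T. Const (l c) * (p ^ k0 * ?P c))"
      by (simp add: q_def poly_at_sum poly_at_smult poly_at_prod sum_distrib_left mult.left_commute)
    also have "\<dots> = (\<Sum>c\<in>T. Const (l c) * ?P c * (p ^ k0 - a c * (Var i - Const c)) + Const (l c) * a c * (\<Prod>d\<in>T. Var i - Const d))"
    proof (rule sum.cong[OF refl])
      fix c assume "c \<in> T"
      then have "(\<Prod>d\<in>T. Var i - Const d) = (Var i - Const c) * ?P c"
        using T(3) by (rule prod.remove[rotated])
      then show "Const (l c) * (p ^ k0 * ?P c) = Const (l c) * ?P c * (p ^ k0 - a c * (Var i - Const c)) + Const (l c) * a c * (\<Prod>d\<in>T. Var i - Const d)"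
        by (simp only:) (simp add: algebra_simps)
    qed
    also have "\<dots> = (\<Sum>c\<in>T. Const (l c) * ?P c * (p ^ k0 - a c * (Var i - Const c)))"
      using l(2) by (simp add: sum.distrib flip: sum_distrib_right)
    also have "\<dots> \<in> M"
    proof (rule idl.subspace_sum[OF M(1)], rule idl.subspace_scale[OF M(1)])
      fix c assume "c \<in> T"
      then have "k c = k0" using T(1) by auto
      then show "p ^ k0 - a c * (Var i - Const c) \<in> M" using ka[of c] by simp
    qed
    finally have "p ^ k0 * poly_at i q \<in> M" .
    then have "poly_at i q \<in> M" using prime M(3) by blast
    then show False using split \<open>q \<noteq> 0\<close> no by blast
  qed
  then obtain v where v: "\<And>i. Var i - Const (v i) \<in> M" by metis
  have cong: "w - Const (ev v w) \<in> M" for w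
  proof -
    obtain N where w: "w \<in> U N" using ex_U by blast
    have "subst Var w - subst (\<lambda>i. Const (v i)) w \<in> idl.span M"
      using w v by (intro span_subst_cong idl.span_base) auto
    moreover have "subst Var w = w" using w by (rule subst_ident) simp
    moreover have "idl.span M = M" using M(1) by simp
    ultimately show ?thesis by (simp only: subst_Const_ev)
  qed
  have "ev v w = 0" if "w \<in> D" for w
  proof (rule ccontr)
    assume nz: "ev v w \<noteq> 0"
    have "w \<in> M" using that M(2) by blast
    from idl.subspace_diff[OF M(1) this cong[of w]] have "Const (ev v w) \<in> M" by simp
    then have "Const (1 / ev v w) * Const (ev v w) \<in> M" by (rule idl.subspace_scale[OF M(1)])
    then show False using one nz by (simp flip: Const.hom_mult)
  qed
  moreover have "ev v p \<noteq> 0"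
    using cong[of p] M(3)[of 1] by auto
  ultimately show ?thesis by blast
qed

section \<open>Regular sequences\<close>

interpretation SR: subring_set "U N" for N
  by standard auto

lemma ev_span_0:
  assumes "p \<in> idl.span G" "\<And>g. g \<in> G \<Longrightarrow> ev v g = 0"
  shows "ev v p = 0"
  using assms(1) by (induction rule: idl.span_induct_alt) (auto simp: assms(2) ev.hom_add ev.hom_mult)

lemma subst_span_0:
  assumes "p \<in> idl.span G" "\<And>g. g \<in> G \<Longrightarrow> subst v g = 0"
  shows "subst v p = 0"
  using assms(1) by (induction rule: idl.span_induct_alt) (auto simp: assms(2) subst.hom_add subst.hom_mult)

lemma foldr_extend_eq:
  "set fs \<subseteq> U N \<Longrightarrow> SR.gen N fs = idl.span (set fs) \<inter> U N"
proof (induction fs)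
  case (Cons f fs)
  then have f: "f \<in> U N" and IH: "SR.gen N fs = idl.span (set fs) \<inter> U N" and fs: "set fs \<subseteq> U N" by auto
  have "SR.extend N (idl.span (set fs) \<inter> U N) f = idl.span (insert f (set fs)) \<inter> U N" (is "?A = ?B")
  proof (intro subset_antisym subsetI)
    fix p assume "p \<in> ?A"
    then obtain j u where "p = j + f * u" "j \<in> idl.span (set fs)" "j \<in> U N" "u \<in> U N"
      unfolding SR.extend_def by blast
    then show "p \<in> ?B" using f
      by (auto simp: mult.commute[of f] intro!: idl.span_add idl.span_scale intro: idl.span_base idl.span_mono[THEN subsetD, of "set fs"])
  next
    fix p assume p: "p \<in> ?B"
    then obtain c where c: "c \<in> U N" "p - c * f \<in> idl.span (set fs)"
      using span_U_insert[of p f "set fs" N] f fs by auto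
    then have "p = (p - c * f) + f * c" "p - c * f \<in> idl.span (set fs) \<inter> U N" using p f by (auto simp: algebra_simps)
    with c show "p \<in> ?A" unfolding SR.extend_def by blast
  qed
  then show ?case using IH by simp
qed simp

lemma genideal_set: "set fs \<subseteq> U N \<Longrightarrow> genideal (poly_ring N) (set fs) = SR.gen N fs"
  by (simp add: genideal_eq foldr_extend_eq)

lemma regular_sequence_snoc:
  "regular_sequence N (fs @ [f]) \<longleftrightarrow> regular_sequence N fs \<and>
     (\<forall>p\<in>U N. f * p \<in> genideal (poly_ring N) (set fs) \<longrightarrow> p \<in> genideal (poly_ring N) (set fs))"
  unfolding regular_sequence_def
  by (simp add: less_Suc_eq all_conj_distrib nth_append conj_commute imp_conjR cong: conj_cong imp_cong)

text \<open>\<open>regular_sequence\<close> reads lists from left to right,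
  \<open>SR.regular\<close> from right to left.\<close>

lemma regular_rev:
  "set fs \<subseteq> U N \<Longrightarrow> regular_sequence N fs \<Longrightarrow> SR.regular N (rev fs)"
proof (induction fs rule: rev_induct)
  case (snoc f fs)
  then have fs: "set fs \<subseteq> U N" "regular_sequence N fs"
    and reg: "\<forall>p\<in>U N. f * p \<in> genideal (poly_ring N) (set fs) \<longrightarrow> p \<in> genideal (poly_ring N) (set fs)"
    by (auto simp: regular_sequence_snoc)
  have "genideal (poly_ring N) (set fs) = SR.gen N (rev fs)"
    using genideal_set[of "rev fs" N] fs by simp
  then show ?case using snoc.IH[OF fs] reg by simp
qed simp

text \<open>Setting the variables of \<open>A\<close> to 0 changes a polynomial only modulo these
  variables. As kernel of a homomorphism into a domain the ideal is prime, which makes the variables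
  a regular sequence.\<close>

lemma span_Var_iff: "p \<in> idl.span (Var ` A) \<longleftrightarrow> subst (\<lambda>i. if i \<in> A then 0 else Var i) p = 0"
proof
  assume "subst (\<lambda>i. if i \<in> A then 0 else Var i) p = 0"
  moreover obtain N where p: "p \<in> U N" using ex_U by blast
  have "subst Var p - subst (\<lambda>i. if i \<in> A then 0 else Var i) p \<in> idl.span (Var ` A)"
    by (rule span_subst_cong[OF p]) (auto intro: idl.span_base simp: idl.span_zero)
  moreover have "subst Var p = p" using p by (rule subst_ident) simp
  ultimately show "p \<in> idl.span (Var ` A)" by simp
qed (erule subst_span_0, auto)

lemma regular_vars: "m \<le> Suc N \<Longrightarrow> SR.regular N (map Var (rev [0..<m]))"
proof (induction m)
  case (Suc m)
  have sub: "set (map Var (rev [0..<m])) \<subseteq> U N" using Suc by auto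
  have "u \<in> idl.span (Var ` {0..<m})" if "Var m * u \<in> idl.span (Var ` {0..<m})" for u
    using that unfolding span_Var_iff by (simp add: subst.hom_mult)
  then show ?case using Suc foldr_extend_eq[OF sub] by simp
qed simp

text \<open>A maximal monomial multiple outside the ideal of an element violating saturation lies in the socle.\<close>

lemma regular_sequence_saturated:
  assumes fs: "set fs \<subseteq> U N" "regular_sequence N fs" "length fs \<le> N"
    and p: "p \<in> U N" "\<And>i. i \<le> N \<Longrightarrow> \<exists>k. Var i ^ k * p \<in> idl.span (set fs)"
  shows "p \<in> idl.span (set fs)"
proof (rule ccontr)
  assume np: "p \<notin> idl.span (set fs)"
  \<comment> \<open>Induction over the variables: \<open>m\<close> counts those already multiplying
    \<open>q\<close> into the ideal. For the next one, \<open>q\<close> is multiplied by its highest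
    power that stays outside.\<close>
  have "\<exists>q. q \<in> U N \<and> q \<notin> idl.span (set fs) \<and> (\<forall>i<m. Var i * q \<in> idl.span (set fs)) \<and>
      (\<forall>i\<le>N. \<exists>k. Var i ^ k * q \<in> idl.span (set fs))" if "m \<le> Suc N" for m
    using that
  proof (induction m)
    case 0
    then show ?case using np p by auto
  next
    case (Suc m)
    have "m \<le> Suc N" using Suc.prems by simp
    from Suc.IH[OF this] obtain q where q: "q \<in> U N" "q \<notin> idl.span (set fs)"
      "\<And>i. i < m \<Longrightarrow> Var i * q \<in> idl.span (set fs)"
      "\<And>i. i \<le> N \<Longrightarrow> \<exists>k. Var i ^ k * q \<in> idl.span (set fs)" by blast
    define k where "k = (LEAST k. Var m ^ k * q \<in> idl.span (set fs))"
    have k: "Var m ^ k * q \<in> idl.span (set fs)"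
      unfolding k_def by (rule LeastI_ex[OF q(4)]) (use Suc.prems in simp)
    have "k \<noteq> 0"
    proof
      assume "k = 0"
      with k q(2) show False by simp
    qed
    then obtain j where j: "k = Suc j" by (cases k) auto
    have nj: "Var m ^ j * q \<notin> idl.span (set fs)"
      using not_less_Least[of j "\<lambda>k. Var m ^ k * q \<in> idl.span (set fs)"] j unfolding k_def by simp
    have "Var i * (Var m ^ j * q) \<in> idl.span (set fs)" if "i < Suc m" for i
    proof (cases "i = m")
      case True
      then show ?thesis using k j by (simp add: mult.assoc)
    next
      case False
      then have "i < m" using that by simp
      from idl.span_scale[OF q(3)[OF this]] have "Var m ^ j * (Var i * q) \<in> idl.span (set fs)" .
      moreover have "Var m ^ j * (Var i * q) = Var i * (Var m ^ j * q)" by (rule mult.left_commute)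
      ultimately show ?thesis by simp
    qed
    moreover have "\<exists>k. Var i ^ k * (Var m ^ j * q) \<in> idl.span (set fs)" if i: "i \<le> N" for i
    proof -
      from q(4)[OF i] obtain k where "Var i ^ k * q \<in> idl.span (set fs)" ..
      then have "Var m ^ j * (Var i ^ k * q) \<in> idl.span (set fs)" by (rule idl.span_scale)
      moreover have "Var m ^ j * (Var i ^ k * q) = Var i ^ k * (Var m ^ j * q)" by (rule mult.left_commute)
      ultimately show ?thesis by (intro exI[of _ k]) simp
    qed
    moreover have "Var m ^ j * q \<in> U N" using q(1) Suc.prems by (intro U_closed U_power) simp_all
    ultimately show ?case using nj by (intro exI[of _ "Var m ^ j * q"]) simp
  qed
  from this[OF order_refl] obtain q where q: "q \<in> U N" "q \<notin> idl.span (set fs)"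
    "\<forall>i<Suc N. Var i * q \<in> idl.span (set fs)" by blast
  let ?as = "map Var (rev [0..<Suc N])"
  have J: "SR.gen N (rev fs) = idl.span (set fs) \<inter> U N"
    using foldr_extend_eq[of "rev fs" N] fs by simp
  have "q \<in> SR.gen N (rev fs)"
  proof (rule SR.no_socle)
    show "set ?as \<subseteq> U N" "SR.regular N ?as" "set (rev fs) \<subseteq> U N" "SR.regular N (rev fs)"
      "length (rev fs) < length ?as" "q \<in> U N"
      using fs q regular_vars[of "Suc N" N] regular_rev by auto
    show "a * q \<in> SR.gen N (rev fs)" if "a \<in> set ?as" for a
    proof -
      have "a \<in> Var ` {0..<Suc N}" using that by (simp only: set_map set_rev set_upt)
      then obtain i where i: "i < Suc N" "a = Var i" by (auto simp del: atLeastLessThanSuc)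
      then have "a * q \<in> U N" using q(1) by (intro U_closed) auto
      then show ?thesis using q(3) i unfolding J by blast
    qed
  qed
  with q(2) J show False by simp
qed

lemma mon_scale: "mon (\<lambda>i. c * g i) m = c ^ monom_degree m * mon g m"
  by (simp add: mon_def monom_degree_def power_mult_distrib prod.distrib power_sum)

lemma subst_homog_scale: "p \<in> homog d \<Longrightarrow> subst (\<lambda>i. c * g i) p = c ^ d * subst g p"
  by (subst (1 2) poly_mapping_sum_singles[of p])
     (auto simp: subst.hom_sum subst_single mon_scale homog_def sum_distrib_left intro!: sum.cong)

text \<open>An inverse of \<open>f\<close> composes with it to the identity only up to a common
  factor \<open>h\<close>. The lemma serves for the given inverse, with factor \<open>H\<close>, and
  for the linear one, with a linear form as factor.\<close>

lemma subst_subst_proportional: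
  assumes p: "p \<in> forms N d" and k: "\<And>i. i \<le> N \<Longrightarrow> subst f (k i) = h * Var i"
  shows "subst f (subst k p) = h ^ d * p"
proof -
  have pU: "p \<in> U N" using p by (simp add: forms_iff)
  have "subst f (subst k p) = subst (\<lambda>i. subst f (k i)) p" by (rule subst_subst)
  also have "\<dots> = subst (\<lambda>i. h * Var i) p" by (rule subst_cong[OF pU k])
  also have "\<dots> = h ^ d * subst Var p" using p by (intro subst_homog_scale) (simp add: forms_iff)
  also have "subst Var p = p" by (rule subst_ident[OF pU]) simp
  finally show ?thesis .
qed

text \<open>The forms vanishing at \<open>v\<close> lie in the ideal of the \<open>N\<close> linear forms vanishing at \<open>v\<close>.\<close>

lemma regular_sequence_common_zero:
  assumes fs: "regular_sequence N fs" "\<And>F. F \<in> set fs \<Longrightarrow> \<exists>d>0. F \<in> forms N d"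
    and v: "\<And>F. F \<in> set fs \<Longrightarrow> ev v F = 0" "k \<le> N" "v k \<noteq> 0"
  shows "length fs \<le> N"
proof -
  define as where "as = map (\<lambda>i. Var i - Const (v i / v k) * Var k) (filter (\<lambda>i. i \<noteq> k) [0..<Suc N])"
  have set_as: "set as = (\<lambda>i. Var i - Const (v i / v k) * Var k) ` ({..N} - {k})"
  proof -
    have "set (filter (\<lambda>i. i \<noteq> k) [0..<Suc N]) = {..N} - {k}" by (auto simp: less_Suc_eq_le)
    then show ?thesis by (simp only: as_def set_map)
  qed
  have as: "set as \<subseteq> U N" using v(2) by (auto simp: set_as)
  have "distinct (filter (\<lambda>i. i \<noteq> k) [0..<Suc N])" by simp
  then have "length (filter (\<lambda>i. i \<noteq> k) [0..<Suc N]) = card (set (filter (\<lambda>i. i \<noteq> k) [0..<Suc N]))"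
    by (rule distinct_card[symmetric])
  also have "set (filter (\<lambda>i. i \<noteq> k) [0..<Suc N]) = {..N} - {k}" by (auto simp: less_Suc_eq_le)
  finally have len: "length as = N" using v(2) by (simp add: as_def)
  have J: "SR.gen N as = idl.span (set as) \<inter> U N"
    by (rule foldr_extend_eq[OF as])
  have fsU: "set fs \<subseteq> U N" using fs(2) by (auto simp: forms_iff)
  have "1 \<notin> idl.span (set as)"
  proof
    assume "1 \<in> idl.span (set as)"
    then have "ev (\<lambda>_. 0) 1 = 0" by (rule ev_span_0) (auto simp: set_as ev.hom_minus ev.hom_mult)
    then show False by simp
  qed
  moreover have "F \<in> idl.span (set as)" if F: "F \<in> set fs" for F
  proof -
    obtain d where d: "d > 0" "F \<in> forms N d" using fs(2)[OF F] by blast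
    have "subst Var F - subst (\<lambda>i. Const (v i / v k) * Var k) F \<in> idl.span (set as)"
    proof (rule span_subst_cong)
      show "F \<in> U N" using d by (simp add: forms_iff)
      fix i assume "i \<le> N"
      show "Var i - Const (v i / v k) * Var k \<in> idl.span (set as)"
      proof (cases "i = k")
        case True
        then show ?thesis using v(3) by (simp add: idl.span_zero)
      next
        case False
        with \<open>i \<le> N\<close> show ?thesis by (intro idl.span_base) (auto simp: set_as)
      qed
    qed
    moreover have "subst Var F = F" using d by (intro subst_ident[of _ N]) (auto simp: forms_iff)
    \<comment> \<open>The substituted point is \<open>v\<close> times the scalar
      \<open>Var k / v k\<close>, so homogeneity reduces this to \<open>F\<close> vanishing at
      \<open>v\<close>.\<close>
    moreover have "subst (\<lambda>i. Const (v i / v k) * Var k) F = 0"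
    proof -
      have "subst (\<lambda>i. (Const (1 / v k) * Var k) * Const (v i)) F = (Const (1 / v k) * Var k) ^ d * subst (\<lambda>i. Const (v i)) F"
        using d by (intro subst_homog_scale) (simp add: forms_iff)
      also have "subst (\<lambda>i. Const (v i)) F = Const (ev v F)"
        by (rule U_hom_eq[of F N, OF _ comm_ring_hom_subst comm_ring_hom_comp[OF comm_ring_hom_Const comm_ring_hom_ev]])
           (use d in \<open>auto simp: forms_iff\<close>)
      also have "\<dots> = 0" using v(1)[OF F] by simp
      also have "(\<lambda>i. (Const (1 / v k) * Var k) * Const (v i)) = (\<lambda>i. Const (v i / v k) * Var k)"
        by (simp add: fun_eq_iff mult_ac flip: Const.hom_mult)
      finally show ?thesis by simp
    qed
    ultimately show ?thesis by simp
  qed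
  ultimately have "length (rev fs) \<le> length as"
    using fsU by (intro SR.regular_length_le[of as N "rev fs", OF as] regular_rev fs) (auto simp: J)
  then show ?thesis using len by simp
qed

section \<open>Integral equations\<close>

lemma span_image_U:
  assumes "finite A" "p \<in> idl.span (f ` A)" "p \<in> U N" "\<And>i. i \<in> A \<Longrightarrow> f i \<in> U N"
  obtains c where "\<And>i. c i \<in> U N" "p = (\<Sum>i\<in>A. c i * f i)"
proof -
  obtain B where B: "B \<subseteq> A" "inj_on f B" "f ` A = f ` B" by (metis subset_image_inj order_refl)
  then have "finite B" using assms(1) finite_subset by blast
  have sp: "p \<in> idl.span (f ` B)" and fB: "f ` B \<subseteq> U N"
    using assms(2,4) B by auto
  have "\<exists>c. (\<forall>g. c g \<in> U N) \<and> p = (\<Sum>g\<in>f ` B. c g * g)"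
    by (rule span_U_finite[OF finite_imageI[OF \<open>finite B\<close>] sp assms(3) fB]) blast
  then obtain c where c: "\<And>g. c g \<in> U N" "p = (\<Sum>g\<in>f ` B. c g * g)" by blast
  have "p = (\<Sum>i\<in>B. c (f i) * f i)" using c(2) B(2) by (simp add: sum.reindex)
  also have "\<dots> = (\<Sum>i\<in>A. (if i \<in> B then c (f i) else 0) * f i)"
    using assms(1) B(1) by (intro sum.mono_neutral_cong_left) auto
  finally show ?thesis using c(1) by (intro that[of "\<lambda>i. if i \<in> B then c (f i) else 0"]) auto
qed

text \<open>Homogeneity of degree \<open>k\<close> when the polynomial variable is given degree 1.\<close>

definition whomog :: "nat \<Rightarrow> nat \<Rightarrow> cpoly poly \<Rightarrow> bool" where
  "whomog N k p \<longleftrightarrow> (\<forall>j. coeff p j \<in> forms N (k - j) \<and> (k < j \<longrightarrow> coeff p j = 0))"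

lemma whomog_mult:
  assumes "whomog N k p" "whomog N l q"
  shows "whomog N (k + l) (p * q)"
  unfolding whomog_def
proof (intro allI conjI impI)
  fix j
  have *: "coeff p i * coeff q (j - i) \<in> forms N (k + l - j) \<and> (k + l < j \<longrightarrow> coeff p i * coeff q (j - i) = 0)" if "i \<le> j" for i
  proof (cases "i \<le> k \<and> j - i \<le> l")
    case True
    then have "k + l - j = (k - i) + (l - (j - i))" using that by auto
    moreover have "coeff p i * coeff q (j - i) \<in> forms N ((k - i) + (l - (j - i)))"
      using assms unfolding whomog_def by (intro forms_mult) auto
    ultimately show ?thesis using True that by auto
  next
    case False
    then have "coeff p i * coeff q (j - i) = 0" using assms unfolding whomog_def
      by (auto simp: not_le)
    then show ?thesis by (simp only: forms_closed simp_thms)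
  qed
  show "coeff (p * q) j \<in> forms N (k + l - j)"
    unfolding coeff_mult using * by (intro forms_sum) auto
  show "coeff (p * q) j = 0" if "k + l < j"
    unfolding coeff_mult using * that by (intro sum.neutral) auto
qed

lemma whomog_closed:
  "whomog N k p \<Longrightarrow> whomog N k q \<Longrightarrow> whomog N k (p + q)"
  "whomog N k p \<Longrightarrow> whomog N k (- p)"
  "whomog N k 0" "whomog N 0 1"
  by (auto simp: whomog_def)

lemma whomog_sum: "(\<And>x. x \<in> A \<Longrightarrow> whomog N k (f x)) \<Longrightarrow> whomog N k (sum f A)"
  by (induction A rule: infinite_finite_induct) (auto simp: whomog_closed)

lemma whomog_prod: "(\<And>x. x \<in> A \<Longrightarrow> whomog N 1 (f x)) \<Longrightarrow> whomog N (card A) (prod f A)"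
proof (induction A rule: infinite_finite_induct)
  case (insert x F)
  then show ?case using whomog_mult[of N 1 "f x" "card F" "prod f F"] by simp
qed (auto simp: whomog_closed)

text \<open>The entries of the characteristic matrix have weight 1, and the determinant is a sum of
  signed products of \<open>k\<close> of them.\<close>

lemma whomog_char_poly:
  assumes M: "M \<in> carrier_mat k k" "\<And>i j. i < k \<Longrightarrow> j < k \<Longrightarrow> M $$ (i, j) \<in> forms N 1"
  shows "whomog N k (char_poly M)"
proof -
  have C: "char_poly_matrix M \<in> carrier_mat k k" using M(1) by (rule char_poly_matrix_closed)
  have E: "whomog N 1 (char_poly_matrix M $$ (i, j))" if ij: "i < k" "j < k" for i j
  proof -
    have "char_poly_matrix M $$ (i, j) = (if i = j then [:- M $$ (i, j), 1:] else [:- M $$ (i, j):])"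
      using ij M(1) by (auto simp: char_poly_matrix_def)
    then show ?thesis using M(2)[OF ij]
      by (auto simp: whomog_def coeff_pCons split: nat.splits)
  qed
  have "whomog N k (signof \<pi> * (\<Prod>i = 0..<k. char_poly_matrix M $$ (i, \<pi> i)))" if "\<pi> permutes {0..<k}" for \<pi>
  proof -
    have "whomog N (card {0..<k}) (\<Prod>i = 0..<k. char_poly_matrix M $$ (i, \<pi> i))"
      using that permutes_in_image[OF that] by (intro whomog_prod E) auto
    then show ?thesis by (simp add: sign_def whomog_closed)
  qed
  then show ?thesis unfolding char_poly_def det_def'[OF C] by (intro whomog_sum) auto
qed

lemma forms_mon: "keys m \<subseteq> {..N} \<Longrightarrow> mon Var m \<in> forms N (monom_degree m)"
  by (auto simp: mon_eq_single forms_iff homog_def in_U_iff)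

lemma forms_sum_mon:
  assumes "finite A" "\<And>m. keys m \<subseteq> {..N} \<Longrightarrow> monom_degree m = d \<Longrightarrow> m \<in> A" "p \<in> forms N d"
  shows "p = (\<Sum>m\<in>A. Const (lookup p m) * mon Var m)"
proof -
  have "p = (\<Sum>m\<in>keys p. Const (lookup p m) * mon Var m)"
    using poly_mapping_sum_singles[of p] by (simp only: single_eq)
  also have "\<dots> = (\<Sum>m\<in>A. Const (lookup p m) * mon Var m)"
    using assms by (intro sum.mono_neutral_left) (auto simp: forms_iff in_U_iff homog_def in_keys_iff)
  finally show ?thesis .
qed

text \<open>
  If \<open>h\<close> lies in the saturation of the ideal of the \<open>f i\<close>, then multiplication by \<open>h\<close> maps the
  forms of a high degree into the combinations of the \<open>f i\<close> with coefficients of that degree, and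
  the Cayley--Hamilton argument applies.
\<close>

lemma integral_equation:
  assumes f: "\<And>i. i \<le> r \<Longrightarrow> f i \<in> forms n e" and h: "h \<in> forms n e"
    and sat: "\<And>i. i \<le> n \<Longrightarrow> \<exists>k. Var i ^ k * h \<in> idl.span (f ` {..r})"
  shows "\<exists>k>0. \<exists>c. (\<forall>j<k. c j \<in> forms r (k - j)) \<and> h ^ k + (\<Sum>j<k. subst f (c j) * h ^ j) = 0"
proof -
  have up: "Var i ^ k' * h \<in> idl.span (f ` {..r})" if "Var i ^ k * h \<in> idl.span (f ` {..r})" "k \<le> k'" for i k k'
  proof -
    have "Var i ^ (k' - k) * (Var i ^ k * h) \<in> idl.span (f ` {..r})" using that(1) by (rule idl.span_scale)
    moreover have "Var i ^ (k' - k) * (Var i ^ k * h) = Var i ^ k' * h"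
      using that(2) by (simp only: mult.assoc[symmetric] power_add[symmetric]) simp
    ultimately show ?thesis by simp
  qed
  from sat obtain K0 where K0: "\<And>i. i \<le> n \<Longrightarrow> Var i ^ K0 i * h \<in> idl.span (f ` {..r})" by metis
  define K where "K = Max (K0 ` {..n})"
  have K: "Var i ^ K * h \<in> idl.span (f ` {..r})" if "i \<le> n" for i
    using K0[OF that] that by (rule_tac up) (auto simp: K_def)
  \<comment> \<open>Pigeonhole: a monomial of degree \<open>D\<close> in the \<open>n + 1\<close>
    variables has an exponent at least \<open>K\<close>, so \<open>h\<close> times it lies in the
    ideal of the \<open>f i\<close>.\<close>
  define D where "D = Suc n * K + 1"
  define A where "A = {m. keys m \<subseteq> {..n} \<and> monom_degree m = D}"
  have "A \<subseteq> {m. keys m \<subseteq> {..n} \<and> (\<forall>i. lookup m i \<le> D)}"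
  proof (clarsimp simp: A_def)
    fix m :: "nat \<Rightarrow>\<^sub>0 nat" and i
    show "lookup m i \<le> monom_degree m"
      unfolding monom_degree_def by (cases "i \<in> keys m") (auto intro: member_le_sum simp: in_keys_iff)
  qed
  then have finA: "finite A" using finite_monomials finite_subset by blast
  have "single 0 D \<in> A" by (auto simp: A_def)
  then have neA: "A \<noteq> {}" by blast
  have "\<exists>b. (\<forall>m'. b m' \<in> forms r 1) \<and> h * mon Var m = (\<Sum>m'\<in>A. subst f (b m') * mon Var m')" if m: "m \<in> A" for m
  proof -
    have "\<exists>i\<le>n. K \<le> lookup m i"
    proof (rule ccontr)
      assume "\<not> ?thesis"
      then have "(\<Sum>i\<le>n. lookup m i) \<le> (\<Sum>i\<le>n. K)" by (intro sum_mono) auto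
      moreover have "D = (\<Sum>i\<le>n. lookup m i)"
        using m monom_degree_superset[of "{..n}" m] by (auto simp: A_def)
      ultimately show False by (simp add: D_def)
    qed
    then obtain i where i: "i \<le> n" "K \<le> lookup m i" by blast
    define m' where "m' = m - single i K"
    have mm: "m = single i K + m'"
      unfolding m'_def using i(2) by (intro poly_mapping_eqI) (auto simp: lookup_add lookup_minus lookup_single when_def)
    have "h * mon Var m = mon Var m' * (Var i ^ K * h)"
      by (subst mm) (simp add: mon_add mult_ac)
    also have "\<dots> \<in> idl.span (f ` {..r})" by (intro idl.span_scale K i)
    finally have sp: "h * mon Var m \<in> idl.span (f ` {..r})" .
    have mon: "mon Var m \<in> forms n D" using forms_mon[of m n] m by (auto simp: A_def)
    then have "h * mon Var m \<in> U n" using h by (auto simp: forms_iff)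
    then obtain a where a: "\<And>j. a j \<in> U n" "h * mon Var m = (\<Sum>j\<le>r. a j * f j)"
      using span_image_U[OF _ sp, of n] f by (auto simp: forms_iff)
    \<comment> \<open>Homogeneous parts replace the coefficients by forms of degree
      \<open>D\<close>, which are combinations of the monomials in \<open>A\<close>; their constants
      are then collected into linear forms in the \<open>f j\<close>.\<close>
    have "h * mon Var m = hom_part (e + D) (h * mon Var m)"
      using forms_mult[OF h mon] by (subst hom_part_of_homog[of _ "e + D"]) (auto simp: forms_iff)
    also have "\<dots> = (\<Sum>j\<le>r. hom_part (e + D) (a j * f j))" by (simp add: a(2) hom_part_sum)
    also have "\<dots> = (\<Sum>j\<le>r. hom_part D (a j) * f j)"
      using f by (intro sum.cong refl) (subst hom_part_mult[of _ e], auto simp: forms_iff)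
    also have "\<dots> = (\<Sum>j\<le>r. (\<Sum>m'\<in>A. Const (lookup (hom_part D (a j)) m') * mon Var m') * f j)"
      by (intro sum.cong refl, subst forms_sum_mon[of A n D])
         (use finA a(1) in \<open>auto simp: A_def intro: hom_part_forms\<close>)
    also have "\<dots> = (\<Sum>m'\<in>A. (\<Sum>j\<le>r. Const (lookup (hom_part D (a j)) m') * f j) * mon Var m')"
      unfolding sum_distrib_right by (subst sum.swap, intro sum.cong refl, simp only: mult_ac)
    also have "\<dots> = (\<Sum>m'\<in>A. subst f (\<Sum>j\<le>r. Const (lookup (hom_part D (a j)) m') * Var j) * mon Var m')"
      by (simp add: subst.hom_sum subst.hom_mult)
    finally show ?thesis
      by (intro exI[of _ "\<lambda>m'. \<Sum>j\<le>r. Const (lookup (hom_part D (a j)) m') * Var j"])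
         (auto intro!: forms_sum forms_Const_mult)
  qed
  then have "\<forall>m\<in>A. \<exists>b. (\<forall>m'. b m' \<in> forms r 1) \<and> h * mon Var m = (\<Sum>m'\<in>A. subst f (b m') * mon Var m')" ..
  from bchoice[OF this] obtain b where b0: "\<forall>m\<in>A. (\<forall>m'. b m m' \<in> forms r 1) \<and>
    h * mon Var m = (\<Sum>m'\<in>A. subst f (b m m') * mon Var m')" ..
  have b: "b m m' \<in> forms r 1" "h * mon Var m = (\<Sum>m'\<in>A. subst f (b m m') * mon Var m')" if "m \<in> A" for m m'
    using bspec[OF b0 that] by blast+
  define k where "k = card A"
  have "k > 0" using finA neA by (simp add: k_def card_gt_0_iff)
  \<comment> \<open>From here on \<open>e\<close> enumerates \<open>A\<close> and no longer denotes
    the degree of the \<open>f i\<close>.\<close>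
  obtain e where e: "bij_betw e {0..<k} A" using ex_bij_betw_nat_finite[OF finA] k_def by blast
  have eA: "e i \<in> A" if "i < k" for i using e that by (auto simp: bij_betw_def)
  define M where "M = mat k k (\<lambda>(i, j). b (e i) (e j))"
  have M: "M \<in> carrier_mat k k" by (simp add: M_def)
  let ?M' = "map_mat (subst f) M" and ?v = "vec k (\<lambda>i. mon Var (e i)) :: cpoly vec"
  have ev: "(h \<cdot>\<^sub>m 1\<^sub>m k - ?M') *\<^sub>v ?v = 0\<^sub>v k"
  proof (rule eq_vecI)
    fix i assume i: "i < dim_vec (0\<^sub>v k :: cpoly vec)"
    then have ik: "i < k" by simp
    have "((h \<cdot>\<^sub>m 1\<^sub>m k - ?M') *\<^sub>v ?v) $ i = (\<Sum>j = 0..<k. ((if i = j then h else 0) - subst f (b (e i) (e j))) * mon Var (e j))"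
      using ik by (auto simp: M_def scalar_prod_def intro!: sum.cong)
    also have "\<dots> = (\<Sum>j = 0..<k. if i = j then h * mon Var (e j) else 0) - (\<Sum>j = 0..<k. subst f (b (e i) (e j)) * mon Var (e j))"
      by (simp add: left_diff_distrib sum_subtractf if_distrib[of "\<lambda>x. x * _"] cong: if_cong)
    also have "(\<Sum>j = 0..<k. subst f (b (e i) (e j)) * mon Var (e j)) = (\<Sum>m'\<in>A. subst f (b (e i) m') * mon Var m')"
      by (rule sum.reindex_bij_betw[OF e])
    also have "\<dots> = h * mon Var (e i)" using b(2)[OF eA[OF ik]] by simp
    finally show "((h \<cdot>\<^sub>m 1\<^sub>m k - ?M') *\<^sub>v ?v) $ i = 0\<^sub>v k $ i" using ik by simp
  qed (simp add: M_def)
  have "?v \<noteq> 0\<^sub>v k"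
  proof
    assume "?v = 0\<^sub>v k"
    then have "?v $ 0 = 0\<^sub>v k $ 0" by simp
    then have "mon Var (e 0) = 0" using \<open>k > 0\<close> by simp
    then have "lookup (single (e 0) (1::complex)) (e 0) = 0" by (simp only: mon_eq_single lookup_zero)
    then show False by simp
  qed
  moreover have C: "h \<cdot>\<^sub>m 1\<^sub>m k - ?M' \<in> carrier_mat k k" 
    by (rule minus_carrier_mat) (simp only: map_carrier_mat M)
  \<comment> \<open>The vector of monomials is a nonzero kernel vector over an integral
    domain.\<close>
  ultimately have det0: "det (h \<cdot>\<^sub>m 1\<^sub>m k - ?M') = 0"
    using ev vec_carrier[of k "\<lambda>i. mon Var (e i)"] unfolding det_0_iff_vec_prod_zero[OF C] by blast
  have ph: "comm_ring_hom (\<lambda>p. poly p h)" by unfold_locales auto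
  have "map_mat (\<lambda>p. poly p h) (char_poly_matrix ?M') = h \<cdot>\<^sub>m 1\<^sub>m k - ?M'"
    using M by (intro eq_matI) (auto simp: char_poly_matrix_def)
  then have "poly (char_poly ?M') h = 0"
    unfolding char_poly_def comm_ring_hom.hom_det[OF ph, symmetric] using det0 by (simp only:)
  moreover have "char_poly ?M' = map_poly (subst f) (char_poly M)" by (rule comm_ring_hom.char_poly_hom[OF comm_ring_hom_subst M])
  ultimately have "poly (map_poly (subst f) (char_poly M)) h = 0" by simp
  moreover have deg: "degree (char_poly M) = k" "coeff (char_poly M) k = 1"
    using degree_monic_char_poly[OF M] by auto
  moreover have "poly (map_poly (subst f) (char_poly M)) h = (\<Sum>j\<le>k. subst f (coeff (char_poly M) j) * h ^ j)"
  proof -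
    let ?p = "map_poly (subst f) (char_poly M)"
    have "degree ?p \<le> k" using degree_map_poly_le[of "subst f" "char_poly M"] deg(1) by simp
    then have "(\<Sum>j\<le>degree ?p. coeff ?p j * h ^ j) = (\<Sum>j\<le>k. coeff ?p j * h ^ j)"
    proof (intro sum.mono_neutral_left ballI)
      fix j assume "j \<in> {..k} - {..degree ?p}"
      then have "coeff ?p j = 0" by (intro coeff_eq_0) simp
      then show "coeff ?p j * h ^ j = 0" by (simp only: mult_zero_left)
    qed auto
    then show ?thesis by (simp add: poly_altdef coeff_map_poly)
  qed
  ultimately have "h ^ k + (\<Sum>j<k. subst f (coeff (char_poly M) j) * h ^ j) = 0"
    using deg(2) by (simp add: lessThan_Suc_atMost[symmetric] add.commute)
  moreover have "whomog r k (char_poly M)" using M b(1) eA by (intro whomog_char_poly) (auto simp: M_def)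
  ultimately show ?thesis using \<open>k > 0\<close> unfolding whomog_def
    by (intro exI[of _ k] conjI exI[of _ "coeff (char_poly M)"]) auto
qed

section \<open>Subschemes\<close>

lemma subscheme_iff:
  assumes "G \<subseteq> U N"
  shows "p \<in> subscheme N G \<longleftrightarrow> p \<in> U N \<and> (\<forall>i\<le>N. \<exists>k. Var i ^ k * p \<in> idl.span G)"
  unfolding subscheme_def genideal_eq[OF assms] by (auto 4 3 intro: exI)

lemma span_in_subscheme: "G \<subseteq> U N \<Longrightarrow> p \<in> idl.span G \<Longrightarrow> p \<in> U N \<Longrightarrow> p \<in> subscheme N G"
  by (auto simp: subscheme_iff intro!: exI[of _ 0])

lemma subscheme_mono:
  assumes G: "finite G" "G \<subseteq> subscheme N G'" "G' \<subseteq> U N"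
  shows "subscheme N G \<subseteq> subscheme N G'"
proof
  fix p assume p: "p \<in> subscheme N G"
  have GU: "G \<subseteq> U N" using G(2) by (auto simp: subscheme_def)
  show "p \<in> subscheme N G'"
    unfolding subscheme_iff[OF G(3)]
  proof (intro conjI allI impI)
    show "p \<in> U N" using p by (simp add: subscheme_def)
    fix i assume i: "i \<le> N"
    have "\<forall>g\<in>G. \<exists>k. Var i ^ k * g \<in> idl.span G'"
      using G(2) i unfolding subset_iff subscheme_iff[OF G(3)] by blast
    from bchoice[OF this] obtain k where k: "\<And>g. g \<in> G \<Longrightarrow> Var i ^ k g * g \<in> idl.span G'" by blast
    \<comment> \<open>Finiteness of \<open>G\<close> gives one exponent for all generators on the
      chart.\<close>
    define K where "K = (\<Sum>g\<in>G. k g)"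
    have K: "Var i ^ K * g \<in> idl.span G'" if g: "g \<in> G" for g
    proof -
      have "k g \<le> K" unfolding K_def using g G(1) by (intro member_le_sum) auto
      then have "Var i ^ K * g = Var i ^ (K - k g) * (Var i ^ k g * g)"
        by (simp only: mult.assoc[symmetric] power_add[symmetric]) simp
      then show ?thesis using idl.span_scale[OF k[OF g], of "Var i ^ (K - k g)"] by (simp only:)
    qed
    obtain j where j: "Var i ^ j * p \<in> idl.span G"
      using p i unfolding subscheme_iff[OF GU] by blast
    have "Var i ^ K * q \<in> idl.span G'" if "q \<in> idl.span G" for q
      using that
    proof (induction rule: idl.span_induct_alt)
      case (step c x y)
      have "Var i ^ K * (c * x + y) = c * (Var i ^ K * x) + Var i ^ K * y"
        by (simp only: distrib_left mult.left_commute)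
      then show ?case using idl.span_add[OF idl.span_scale[OF K[OF step(1)], of c] step(2)] by simp
    qed (simp add: idl.span_zero)
    from this[OF j] have "Var i ^ (K + j) * p \<in> idl.span G'" by (simp add: power_add mult.assoc)
    then show "\<exists>k. Var i ^ k * p \<in> idl.span G'" ..
  qed
qed

text \<open>The zero ideal contains no power of a nonzero polynomial, so the Nullstellensatz yields
  a point where it does not vanish.\<close>

lemma ev_zero_imp: "(\<And>v. ev v p = 0) \<Longrightarrow> p = 0"
proof (rule ccontr)
  assume "\<And>v. ev v p = 0" "p \<noteq> 0"
  then show False using nullstellensatz[of "{0}" p] by simp
qed

section \<open>Linear forms\<close>

lemma lcoeff_Var: "lcoeff (Var i) j = (if i = j then 1 else 0)"
proof -
  have "single i (1::nat) = single j 1 \<longleftrightarrow> i = j"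
    by (metis lookup_single_eq lookup_single_not_eq zero_neq_one)
  then show ?thesis by (simp add: lcoeff_def Var_def lookup_single when_def del: One_nat_def)
qed

lemma lookup_Const_mult: "lookup (Const c * p) m = c * lookup p m"
proof (induction p rule: cpoly_single_induct)
  case (2 m' c')
  then show ?case by (simp add: Const_def mult_single lookup_single when_def)
qed (auto simp: lookup_add distrib_left)

lemma lcoeff_Const_mult: "lcoeff (Const c * p) i = c * lcoeff p i"
  by (simp add: lcoeff_def lookup_Const_mult)

lemma lcoeff_sum: "lcoeff (sum f A) i = (\<Sum>x\<in>A. lcoeff (f x) i)"
  by (simp add: lcoeff_def lookup_sum)

lemma linear_form_nonzero: "l \<in> forms N 1 \<Longrightarrow> l \<noteq> 0 \<Longrightarrow> \<exists>i\<le>N. lcoeff l i \<noteq> 0"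
proof (rule ccontr)
  assume l: "l \<in> forms N 1" "l \<noteq> 0" "\<not> (\<exists>i\<le>N. lcoeff l i \<noteq> 0)"
  then have "(\<Sum>i\<le>N. Const (lcoeff l i) * Var i) = 0" by (intro sum.neutral) auto
  with linear_form_eq[OF l(1)] l(2) show False by simp
qed

lemma linear_combination_zero:
  assumes "(\<Sum>i\<le>N. Const (c i) * Var i) = 0" "i \<le> N"
  shows "c i = 0"
proof -
  have "lcoeff (\<Sum>i\<le>N. Const (c i) * Var i) i = c i"
    using assms(2) by (simp add: lcoeff_sum lcoeff_Const_mult lcoeff_Var if_distrib[of "\<lambda>x. _ * x"] cong: if_cong)
  with assms(1) show ?thesis by (simp add: lcoeff_def)
qed

lemma subst_linear_form: "l \<in> forms N 1 \<Longrightarrow> subst g l = (\<Sum>i\<le>N. Const (lcoeff l i) * g i)"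
  by (subst linear_form_eq, assumption) (simp add: subst.hom_sum subst.hom_mult)

text \<open>Eliminating a variable that occurs in \<open>l\<close> is a substitution with kernel the
  ideal of \<open>l\<close>, and its values lie in an integral domain.\<close>

lemma linear_form_prime:
  assumes l: "l \<in> forms N 1" "l \<noteq> 0" and ab: "a * b \<in> idl.span {l}"
  shows "a \<in> idl.span {l} \<or> b \<in> idl.span {l}"
proof -
  obtain k where k: "k \<le> N" "lcoeff l k \<noteq> 0" using linear_form_nonzero[OF l] by blast
  define \<theta> where "\<theta> = (\<lambda>i. if i = k then Var k - Const (1 / lcoeff l k) * l else Var i)"
  have "subst \<theta> l = (\<Sum>i\<le>N. Const (lcoeff l i) * Var i - (if i = k then l else 0))"
    unfolding subst_linear_form[OF l(1)]
  proof (intro sum.cong refl)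
    fix i
    show "Const (lcoeff l i) * \<theta> i = Const (lcoeff l i) * Var i - (if i = k then l else 0)"
    proof (cases "i = k")
      case True
      have "Const (lcoeff l k) * (Const (1 / lcoeff l k) * l) = Const (lcoeff l k * (1 / lcoeff l k)) * l"
        by (subst Const.hom_mult) (simp only: mult.assoc)
      also have "\<dots> = l" using k(2) by simp
      finally show ?thesis using True by (simp add: \<theta>_def right_diff_distrib)
    qed (simp add: \<theta>_def)
  qed
  also have "\<dots> = 0" using linear_form_eq[OF l(1)] k(1) by (simp add: sum_subtractf)
  finally have \<theta>l: "subst \<theta> l = 0" .
  have iff: "p \<in> idl.span {l} \<longleftrightarrow> subst \<theta> p = 0" for p
  proof
    assume "subst \<theta> p = 0"
    moreover obtain M where p: "p \<in> U M" using ex_U by blast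
    have "subst Var p - subst \<theta> p \<in> idl.span {l}"
    proof (rule span_subst_cong[OF p])
      fix i
      have "Const (1 / lcoeff l k) * l \<in> idl.span {l}" by (intro idl.span_scale idl.span_base) simp
      then show "Var i - \<theta> i \<in> idl.span {l}" by (simp add: \<theta>_def idl.span_zero)
    qed
    moreover have "subst Var p = p" using p by (rule subst_ident) simp
    ultimately show "p \<in> idl.span {l}" by simp
  qed (erule subst_span_0, use \<theta>l in auto)
  show ?thesis using ab unfolding iff by (simp add: subst.hom_mult)
qed

text \<open>Independent linear forms, as many as there are variables, are new coordinates. Counting
  dimensions gives \<open>\<rho>\<close> as a one-sided inverse, and independence of
  \<open>w\<close> gives the other composition.\<close>

lemma linear_forms_basis:
  assumes w: "\<And>i. i \<le> m \<Longrightarrow> w i \<in> forms m 1"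
    and ind: "\<And>c i. (\<Sum>i\<le>m. Const (c i) * w i) = 0 \<Longrightarrow> i \<le> m \<Longrightarrow> c i = 0"
  obtains \<rho> where "\<And>i. i \<le> m \<Longrightarrow> \<rho> i \<in> forms m 1" "\<And>i. i \<le> m \<Longrightarrow> subst w (\<rho> i) = Var i"
    "\<And>j. j \<le> m \<Longrightarrow> subst \<rho> (w j) = Var j"
proof -
  have delta: "(\<Sum>i\<le>m. Const (if i = a then 1 else 0) * h i) = h a" if "a \<le> m" for a and h :: "nat \<Rightarrow> cpoly"
  proof -
    have "(\<Sum>i\<le>m. Const (if i = a then 1 else 0) * h i) = (\<Sum>i\<le>m. if i = a then h i else 0)"
      by (intro sum.cong refl) simp
    then show ?thesis using that by simp
  qed
  have inj: "inj_on w {..m}"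
  proof (rule inj_onI)
    fix a b assume ab: "a \<in> {..m}" "b \<in> {..m}" "w a = w b"
    have "(\<Sum>i\<le>m. Const ((if i = a then 1 else 0) - (if i = b then 1 else 0)) * w i) = 0"
      using ab delta[of a w] delta[of b w] by (simp only: Const.hom_minus left_diff_distrib sum_subtractf atMost_iff) simp
    from ind[OF this, of a] ab(1) show "a = b" by (cases "a = b") simp_all
  qed
  have indep: "\<not> cvs.dependent (w ` {..m})"
  proof
    assume "cvs.dependent (w ` {..m})"
    then obtain u where u: "\<exists>v\<in>w ` {..m}. u v \<noteq> 0" "(\<Sum>v\<in>w ` {..m}. Const (u v) * v) = 0"
      by (subst (asm) cvs.dependent_finite) auto
    then have "(\<Sum>i\<le>m. Const (u (w i)) * w i) = 0" using inj by (simp add: sum.reindex)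
    from ind[OF this] u(1) show False by auto
  qed
  have sub: "w ` {..m} \<subseteq> cvs.span (Var ` {..m})"
  proof
    fix p assume "p \<in> w ` {..m}"
    then have "p \<in> forms m 1" using w by auto
    then show "p \<in> cvs.span (Var ` {..m})"
      by (subst linear_form_eq, assumption) (intro cvs.span_sum cvs.span_scale cvs.span_base, auto)
  qed
  have "inj_on Var {..m}"
    by (rule inj_onI) (metis lcoeff_Var zero_neq_one)
  then have card: "card (Var ` {..m}) = Suc m" "card (w ` {..m}) = Suc m" using inj by (simp_all add: card_image)
  have sp: "Var i \<in> cvs.span (w ` {..m})" if "i \<le> m" for i
  proof (rule ccontr)
    assume new: "Var i \<notin> cvs.span (w ` {..m})"
    then have "\<not> cvs.dependent (insert (Var i) (w ` {..m}))" using indep cvs.independent_insertI by blast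
    moreover have "insert (Var i) (w ` {..m}) \<subseteq> cvs.span (Var ` {..m})"
      using that sub cvs.span_base by auto
    ultimately have "card (insert (Var i) (w ` {..m})) \<le> card (Var ` {..m})"
      using cvs.independent_span_bound[of "Var ` {..m}" "insert (Var i) (w ` {..m})"] by simp
    moreover have "Var i \<notin> w ` {..m}" 
      using new cvs.span_base[of "Var i" "w ` {..m}"] by (rule contrapos_nn)
    ultimately show False using card by simp
  qed
  have "\<forall>i\<in>{..m}. \<exists>c. Var i = (\<Sum>j\<le>m. Const (c j) * w j)"
  proof
    fix i assume "i \<in> {..m}"
    then have "Var i \<in> cvs.span (w ` {..m})" using sp by simp
    then obtain u where "Var i = (\<Sum>v\<in>w ` {..m}. Const (u v) * v)" by (auto simp: cvs.span_finite)
    then have "Var i = (\<Sum>j\<le>m. Const ((u \<circ> w) j) * w j)" using inj by (simp add: sum.reindex)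
    then show "\<exists>c. Var i = (\<Sum>j\<le>m. Const (c j) * w j)" by blast
  qed
  from bchoice[OF this] obtain C where C: "\<And>i. i \<le> m \<Longrightarrow> Var i = (\<Sum>j\<le>m. Const (C i j) * w j)" by auto
  define \<rho> where "\<rho> = (\<lambda>i. \<Sum>j\<le>m. Const (C i j) * Var j)"
  have \<rho>: "\<rho> i \<in> forms m 1" for i unfolding \<rho>_def by (auto intro!: forms_sum forms_Const_mult)
  have w\<rho>: "subst w (\<rho> i) = Var i" if "i \<le> m" for i
    using C[OF that] by (simp add: \<rho>_def subst.hom_sum subst.hom_mult)
  have "subst \<rho> (w j) = Var j" if j: "j \<le> m" for j
  proof -
    have D: "subst \<rho> (w j) \<in> forms m (1 * 1)" using w[OF j] \<rho> by (rule forms_subst)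
    then have D: "subst \<rho> (w j) \<in> forms m 1" by simp
    define c where "c = lcoeff (subst \<rho> (w j))"
    have "subst w (subst \<rho> (w j)) = subst (\<lambda>i. subst w (\<rho> i)) (w j)" by (rule subst_subst)
    also have "\<dots> = w j" using w[OF j] w\<rho> by (intro subst_ident[of _ m]) (auto simp: forms_iff)
    finally have "(\<Sum>i\<le>m. Const (c i) * w i) = w j"
      unfolding subst_linear_form[OF D] c_def .
    moreover have "(\<Sum>i\<le>m. Const (c i - (if i = j then 1 else 0)) * w i) =
        (\<Sum>i\<le>m. Const (c i) * w i) - (\<Sum>i\<le>m. Const (if i = j then 1 else 0) * w i)"
      by (simp only: Const.hom_minus left_diff_distrib sum_subtractf)
    ultimately have Z: "(\<Sum>i\<le>m. Const (c i - (if i = j then 1 else 0)) * w i) = 0"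
      using delta[OF j, of w] by (simp only: diff_self)
    have cj: "c i - (if i = j then 1 else 0) = 0" if im: "i \<le> m" for i by (rule ind[OF Z im])
    have "subst \<rho> (w j) = (\<Sum>i\<le>m. Const (c i) * Var i)" unfolding c_def by (rule linear_form_eq[OF D])
    also have "\<dots> = (\<Sum>i\<le>m. Const (if i = j then 1 else 0) * Var i)"
      using cj by (intro sum.cong refl arg_cong2[of _ _ _ _ "(*)"] arg_cong[of _ _ Const]) auto
    also have "\<dots> = Var j" by (rule delta[OF j])
    finally show ?thesis .
  qed
  with \<rho> w\<rho> show ?thesis by (intro that[of \<rho>])
qed

text \<open>\<open>cvs.dim\<close> is the cardinality of a basis and would be 0 for an infinite one,
  so the basis has to be shown finite; it lies in the span of the variables.\<close>

lemma h0_ideal_sheaf_1: "h0_ideal_sheaf N Z 1 \<noteq> 0 \<longleftrightarrow> (\<exists>l\<in>Z \<inter> forms N 1. l \<noteq> 0)"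
proof -
  let ?V = "Z \<inter> forms N 1"
  obtain B where B: "B \<subseteq> ?V" "\<not> cvs.dependent B" "?V \<subseteq> cvs.span B" "card B = cvs.dim ?V"
    using cvs.basis_exists[of ?V] by metis
  have "B \<subseteq> cvs.span (Var ` {..N})"
  proof
    fix p assume "p \<in> B"
    then have "p \<in> forms N 1" using B(1) by auto
    then show "p \<in> cvs.span (Var ` {..N})"
      by (subst linear_form_eq, assumption) (intro cvs.span_sum cvs.span_scale cvs.span_base, auto)
  qed
  then have fin: "finite B" using cvs.independent_span_bound[of "Var ` {..N}" B] B(2) by simp
  have "0 \<notin> B" using B(2) cvs.dependent_zero by blast
  have "cvs.dim ?V \<noteq> 0 \<longleftrightarrow> B \<noteq> {}" using B(4) fin by (metis card_eq_0_iff)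
  also have "\<dots> \<longleftrightarrow> (\<exists>l\<in>?V. l \<noteq> 0)"
  proof
    assume "B \<noteq> {}"
    then obtain b where b: "b \<in> B" by (meson ex_in_conv)
    have "b \<in> ?V" by (rule subsetD[OF B(1) b])
    moreover have "b \<noteq> 0" using b \<open>0 \<notin> B\<close> by metis
    ultimately show "\<exists>l\<in>?V. l \<noteq> 0" by (rule bexI[rotated])
  next
    assume ex: "\<exists>l\<in>?V. l \<noteq> 0"
    show "B \<noteq> {}"
    proof
      assume "B = {}"
      then have "?V \<subseteq> {0}" using B(3) by (simp only: cvs.span_empty)
      with ex show False by (meson singletonD subsetD)
    qed
  qed
  finally show ?thesis by (simp add: h0_ideal_sheaf_def)
qed

lemma positive_degree_span:
  assumes "p \<in> homog d" "d > 0" "p \<in> U N"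
  shows "p \<in> idl.span (Var ` {..N})"
proof -
  have "subst (\<lambda>i. if i \<in> {..N} then 0 else Var i) p = subst (\<lambda>i. 0 * Var i) p"
    by (rule subst_cong[OF assms(3)]) simp
  also have "\<dots> = 0" using subst_homog_scale[OF assms(1), of 0 Var] assms(2) by simp
  finally show ?thesis by (simp add: span_Var_iff)
qed

text \<open>\<open>Var 0\<close> is prime and divides \<open>u 0 * Var 1\<close>, hence it divides
  \<open>u 0\<close>; the second variable exists because \<open>n \<ge> 1\<close>.\<close>

lemma proportional_to_coordinates:
  assumes n: "n \<ge> 1" and eq: "\<And>i j. i \<le> n \<Longrightarrow> j \<le> n \<Longrightarrow> u i * Var j = u j * (Var i :: cpoly)"
  obtains h where "\<And>i. i \<le> n \<Longrightarrow> u i = Var i * h"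
proof -
  have "u 0 * Var 1 = u 1 * Var 0" using eq[of 0 1] n by simp
  then have "u 0 * Var 1 \<in> idl.span {Var 0}" by (simp add: idl.span_scale idl.span_base)
  moreover have "Var 1 \<notin> idl.span {Var 0}"
    using span_Var_iff[of "Var 1" "{0}"] by simp
  ultimately have "u 0 \<in> idl.span {Var 0}" using linear_form_prime[of "Var 0" 0 "u 0" "Var 1"] by auto
  then obtain h where h: "u 0 = h * Var 0" by (auto simp: idl.span_singleton)
  have "u i = Var i * h" if "i \<le> n" for i
  proof -
    have "(u i - Var i * h) * Var 0 = 0"
      using eq[OF that, of 0] h by (simp add: left_diff_distrib mult_ac)
    then show ?thesis by simp
  qed
  then show ?thesis by (rule that)
qed

section \<open>Linear systems of quadrics\<close>

locale quadratic_birational_hypersurface =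
  fixes n :: nat and f :: "nat \<Rightarrow> cpoly"
  assumes birational: "quadratic_birational n f"
    and hypersurface: "\<exists>e. hypersurface (n + 1) e (image_closure n f)"
    and normal: "normal_variety (n + 1) (image_closure n f)"
    and not_hyperplane: "\<not> hypersurface (n + 1) 1 (image_closure n f)"
begin

abbreviation I where "I \<equiv> image_closure n f"

section \<open>The homogeneous ideal of the image\<close>

lemma f_forms: "i \<le> n + 1 \<Longrightarrow> f i \<in> forms n 2"
  using birational by (auto simp: quadratic_birational_def quadratic_map_def)

lemma f_U: "i \<le> n + 1 \<Longrightarrow> f i \<in> U n"
  using f_forms by (auto simp: forms_iff)

lemma f_homog: "i \<le> n + 1 \<Longrightarrow> f i \<in> homog 2"
  using f_forms by (auto simp: forms_iff)

lemma no_common_factor: "h \<in> forms n d \<Longrightarrow> d > 0 \<Longrightarrow> \<exists>i\<le>n + 1. \<not> h dvd f i"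
  using birational unfolding quadratic_birational_def quadratic_map_def by blast

text \<open>For \<open>n = 0\<close> every quadric is divisible by \<open>Var 0\<close>, which would
  be a fixed component.\<close>

lemma n_pos: "n \<ge> 1"
proof (rule ccontr)
  assume "\<not> n \<ge> 1"
  then have n0: "n = 0" by simp
  have "Var 0 dvd f i" if "i \<le> n + 1" for i
  proof -
    have "f i \<in> idl.span (Var ` {..n})" using f_forms[OF that] by (intro positive_degree_span[of _ 2]) (auto simp: forms_iff)
    then show ?thesis using n0 by (auto simp: idl.span_singleton)
  qed
  moreover have "Var 0 \<in> forms n 1" by simp
  ultimately show False using no_common_factor by blast
qed

text \<open>A form vanishes on the image iff its pullback vanishes off the base locus, hence
  identically, and pulling back keeps homogeneous parts apart. All identities on \<open>S\<close>
  are later checked by substituting \<open>f\<close>.\<close>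

lemma in_I_iff: "p \<in> I \<longleftrightarrow> p \<in> U (n + 1) \<and> subst f p = 0"
proof -
  let ?S = "{p. (\<exists>d. p \<in> forms (n + 1) d) \<and> (\<forall>v\<in>image_points n f. eval_at v p = 0)}"
  have SU: "?S \<subseteq> U (n + 1)" by (auto simp: forms_iff)
  have I: "I = idl.span ?S \<inter> U (n + 1)"
    unfolding image_closure_def vanishing_ideal_def by (rule genideal_eq[OF SU])
  have ev_f: "eval_at (vec (n + 1) v) (f i) = ev v (f i)" if "i \<le> n + 1" for v i
    unfolding eval_at_eq using f_U[OF that] by (rule ev_cong) simp
  obtain i0 where i0: "i0 \<le> n + 1" "f i0 \<noteq> 0"
  proof -
    obtain i0 where i0: "i0 \<le> n + 1" "\<not> Var 0 dvd f i0" using no_common_factor[of "Var 0" 1] by auto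
    then have "f i0 \<noteq> 0" by (intro notI) simp
    with i0(1) show ?thesis by (rule that)
  qed
  have S: "subst f q = 0" if q: "q \<in> ?S" for q
  proof -
    have qU: "q \<in> U (n + 1)" using q SU by blast
    \<comment> \<open>The factor \<open>f i0\<close> takes care of the points where it vanishes,
      among them the base points, which have no image.\<close>
    have "ev v (subst f q * f i0) = 0" for v
    proof (cases "ev v (f i0) = 0")
      case False
      let ?w = "vec (n + 2) (\<lambda>i. eval_at (vec (n + 1) v) (f i))"
      have "?w \<in> image_points n f"
        unfolding image_points_def using False i0(1) ev_f[OF i0(1), of v] vec_carrier by fastforce
      then have "eval_at ?w q = 0" using q by blast
      moreover have "eval_at ?w q = ev (\<lambda>i. ev v (f i)) q"
        unfolding eval_at_eq[of ?w]
      proof (rule ev_cong[OF qU])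
        fix i assume i: "i \<le> n + 1"
        then have "?w $ i = eval_at (vec (n + 1) v) (f i)" by (intro index_vec) simp
        then show "?w $ i = ev v (f i)" by (simp only: ev_f[OF i])
      qed
      ultimately show ?thesis by (simp add: ev.hom_mult ev_subst)
    qed (simp add: ev.hom_mult)
    then have "subst f q * f i0 = 0" by (rule ev_zero_imp)
    then show ?thesis using i0(2) by simp
  qed
  show ?thesis
  proof
    assume p: "p \<in> I"
    then have "p \<in> idl.span ?S" unfolding I by simp
    then have "subst f p = 0" by (rule subst_span_0) (rule S)
    with p show "p \<in> U (n + 1) \<and> subst f p = 0" unfolding I by simp
  next
    assume p: "p \<in> U (n + 1) \<and> subst f p = 0"
    obtain D where D: "p = (\<Sum>d\<le>D. hom_part d p)" using ex_hom_part_sum by blast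
    have "hom_part d p \<in> ?S" for d
    proof -
      have cU: "hom_part d p \<in> U (n + 1)" using p by (simp add: hom_part_in_U)
      have "subst f (hom_part d p) = hom_part (2 * d) (subst f p)"
        using p f_homog by (intro hom_part_subst[symmetric]) auto
      then have z: "subst f (hom_part d p) = 0" using p by simp
      have "eval_at w (hom_part d p) = 0" if w: "w \<in> image_points n f" for w
      proof -
        obtain v where v: "w = vec (n + 2) (\<lambda>i. eval_at v (f i))" using w by (auto simp: image_points_def)
        have "eval_at w (hom_part d p) = ev (\<lambda>i. eval_at v (f i)) (hom_part d p)"
          unfolding eval_at_eq[of w]
        proof (rule ev_cong[OF cU])
          fix i assume "i \<le> n + 1"
          then show "w $ i = eval_at v (f i)" unfolding v by (intro index_vec) simp
        qed
        also have "\<dots> = ev (\<lambda>i. v $ i) (subst f (hom_part d p))" by (simp add: ev_subst eval_at_eq)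
        finally show ?thesis using z by simp
      qed
      then show ?thesis using p hom_part_forms by blast
    qed
    then have "(\<Sum>d\<le>D. hom_part d p) \<in> idl.span ?S" by (intro idl.span_sum idl.span_base)
    then show "p \<in> I" using D p unfolding I by simp
  qed
qed

text \<open>A single nonzero element is a regular sequence, so its ideal is already
  saturated.\<close>

lemma I_principal: "F \<in> U (n + 1) \<Longrightarrow> F \<noteq> 0 \<Longrightarrow> I = subscheme (n + 1) {F} \<Longrightarrow> p \<in> I \<longleftrightarrow> p \<in> U (n + 1) \<and> p \<in> idl.span {F}"
proof -
  assume F: "F \<in> U (n + 1)" "F \<noteq> 0" and I: "I = subscheme (n + 1) {F}"
  have "regular_sequence (n + 1) ([] @ [F])"
    unfolding regular_sequence_snoc using F by (auto simp: regular_sequence_def genideal_eq)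
  then have "p \<in> idl.span {F}" if "p \<in> subscheme (n + 1) {F}"
    using regular_sequence_saturated[of "[F]" "n + 1" p] that F subscheme_iff[of "{F}" "n + 1" p] by auto
  moreover have "p \<in> subscheme (n + 1) {F}" if "p \<in> U (n + 1)" "p \<in> idl.span {F}"
    using span_in_subscheme[of "{F}" "n + 1" p] that F by auto
  ultimately show ?thesis unfolding I by (auto simp: subscheme_def)
qed

lemma obtain_F:
  obtains F e where "F \<in> forms (n + 1) e" "F \<noteq> 0" "e \<ge> 2" "I = subscheme (n + 1) {F}"
    "\<And>p. p \<in> I \<longleftrightarrow> p \<in> U (n + 1) \<and> p \<in> idl.span {F}"
proof -
  obtain e F where F: "e > 0" "F \<in> forms (n + 1) e" "F \<noteq> 0" "I = subscheme (n + 1) {F}"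
    using hypersurface unfolding hypersurface_def by blast
  have "e \<noteq> 1" using not_hyperplane F unfolding hypersurface_def by blast
  with F have "e \<ge> 2" by simp
  show ?thesis
    by (rule that[OF F(2,3) \<open>e \<ge> 2\<close> F(4)]) (rule I_principal, use F in \<open>auto simp: forms_iff\<close>)
qed

text \<open>A multiple of \<open>F\<close> has no part of degree below \<open>e\<close>, and
  \<open>e \<ge> 2\<close>.\<close>

lemma no_linear_relation: "t \<in> forms (n + 1) 1 \<Longrightarrow> subst f t = 0 \<Longrightarrow> t = 0"
proof -
  assume l: "t \<in> forms (n + 1) 1" "subst f t = 0"
  obtain F e where F: "F \<in> forms (n + 1) e" "F \<noteq> 0" "e \<ge> 2" "\<And>p. p \<in> I \<longleftrightarrow> p \<in> U (n + 1) \<and> p \<in> idl.span {F}"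
    using obtain_F by metis
  have "t \<in> I" using l by (simp add: in_I_iff forms_iff)
  then obtain k where k: "t = k * F" using F(4) by (auto simp: idl.span_singleton)
  have "t = hom_part 1 t" using l by (simp add: hom_part_of_homog[of _ 1] forms_iff)
  also have "\<dots> = 0" unfolding k using F(1,3) by (subst hom_part_mult[of _ e]) (auto simp: forms_iff)
  finally show ?thesis .
qed

lemma f_nonzero: "i \<le> n + 1 \<Longrightarrow> f i \<noteq> 0"
  using no_linear_relation[of "Var i"] by auto

lemma Var_power_not_in_I: "i \<le> n + 1 \<Longrightarrow> Var i ^ k \<notin> I"
  using f_nonzero by (simp add: in_I_iff subst.hom_power)

lemma obtain_inverse:
  assumes "inverse_of_degree n f d g"
  obtains H where "H \<noteq> 0" "\<And>i. i \<le> n \<Longrightarrow> subst f (g i) = Var i * H"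
proof -
  have g: "\<And>i j. i \<le> n \<Longrightarrow> j \<le> n \<Longrightarrow> subst f (g i) * Var j = subst f (g j) * Var i" "\<exists>i\<le>n. subst f (g i) \<noteq> 0"
    using assms unfolding inverse_of_degree_def same_rational_map_def by auto
  from proportional_to_coordinates[of n "\<lambda>i. subst f (g i)", OF n_pos g(1)]
  obtain H where H: "\<And>i. i \<le> n \<Longrightarrow> subst f (g i) = Var i * H" by blast
  moreover have "H \<noteq> 0" using g(2) H by auto
  ultimately show ?thesis using that by blast
qed

text \<open>
  Normality of the image makes the linear system complete: a quadric \<open>h\<close> through the base locus
  is integral over the homogeneous coordinate ring of the image, so \<open>h / f\<^sub>i\<close> is regular at the points
  of the image with \<open>y\<^sub>i \<noteq> 0\<close>. The ideal of denominators of \<open>h\<close> has no zeros, and the coordinate ring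
  has depth at least 2, so \<open>h\<close> comes from a form on the ambient space, which has to be linear.
\<close>

lemma complete_linear_system:
  assumes h: "h \<in> forms n 2" and sat: "\<And>i. i \<le> n \<Longrightarrow> \<exists>k. Var i ^ k * h \<in> idl.span (f ` {..n + 1})"
  obtains t where "t \<in> forms (n + 1) 1" "subst f t = h"
proof -
  let ?N = "n + 1"
  have "\<exists>k>0. \<exists>c. (\<forall>j<k. c j \<in> forms ?N (k - j)) \<and> h ^ k + (\<Sum>j<k. subst f (c j) * h ^ j) = 0"
    by (rule integral_equation[OF f_forms h sat])
  then obtain k c where k: "k > 0" and c0: "\<forall>j<k. c j \<in> forms ?N (k - j)"
    and eqn: "h ^ k + (\<Sum>j<k. subst f (c j) * h ^ j) = 0" by blast
  have c: "c j \<in> forms ?N (k - j)" if "j < k" for j using c0 that by blast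
  obtain F e where F: "F \<in> forms ?N e" "F \<noteq> 0" "e \<ge> 2" and IF: "\<And>p. p \<in> I \<longleftrightarrow> p \<in> U ?N \<and> p \<in> idl.span {F}"
    using obtain_F by metis
  have FU: "F \<in> U ?N" using F(1) by (simp add: forms_iff)
  obtain d g where dg: "inverse_of_degree n f d g"
    using birational unfolding quadratic_birational_def by blast
  then have g: "\<And>i. i \<le> n \<Longrightarrow> g i \<in> forms ?N d" by (simp add: inverse_of_degree_def)
  obtain H where H: "H \<noteq> 0" "\<And>i. i \<le> n \<Longrightarrow> subst f (g i) = Var i * H" using obtain_inverse[OF dg] by metis
  have pull: "subst f (subst g q) = H ^ 2 * q" and pull_form: "subst g q \<in> forms ?N (d * 2)" if q: "q \<in> forms n 2" for q
  proof -
    show "subst f (subst g q) = H ^ 2 * q"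
      by (rule subst_subst_proportional[OF q]) (simp add: H(2) mult.commute)
    show "subst g q \<in> forms ?N (d * 2)" by (rule forms_subst[OF q g])
  qed
  \<comment> \<open>Along \<open>f\<close>, \<open>u0 / b0\<close> pulls back to
    \<open>H ^ 2 * h * f 0\<close> over \<open>H ^ 2 * f 0\<close>, so it represents
    \<open>h\<close> as a fraction on \<open>S\<close>.\<close>
  define u0 where "u0 = subst g h * Var 0"
  define b0 where "b0 = subst g (f 0)"
  have u0U: "u0 \<in> U ?N" and b0U: "b0 \<in> U ?N"
    using pull_form[OF h] pull_form[OF f_forms[of 0]] by (auto simp: u0_def b0_def forms_iff)
  have fu0: "subst f u0 = H ^ 2 * h * f 0" by (simp add: u0_def subst.hom_mult pull[OF h])
  have fb0: "subst f b0 = H ^ 2 * f 0" by (simp add: b0_def pull[OF f_forms])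
  have fb0_nz: "subst f b0 \<noteq> 0" using H(1) f_nonzero[of 0] by (simp add: fb0)
  \<comment> \<open>The denominators of \<open>h\<close>: \<open>w \<in> D\<close> says that
    \<open>w\<close> times \<open>u0 / b0\<close> is a polynomial modulo \<open>F\<close>. Once
    \<open>D\<close> contains powers of all coordinates, saturation of the ideal of \<open>F\<close>
    and \<open>b0\<close> puts \<open>u0\<close> into it.\<close>
  define D where "D = {w. w * u0 \<in> idl.span {F, b0}}"
  have D: "idl.subspace D"
  proof (rule idl.subspaceI)
    show "x + y \<in> D" if "x \<in> D" "y \<in> D" for x y
      using that idl.span_add[of "x * u0" "{F, b0}" "y * u0"] by (simp add: D_def distrib_right)
    show "a * x \<in> D" if "x \<in> D" for a x
      using that idl.span_scale[of "x * u0" "{F, b0}" a] by (simp add: D_def mult.assoc)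
  qed (simp add: D_def idl.span_zero)
  have "F * u0 \<in> idl.span {F, b0}"
    using idl.span_scale[OF idl.span_base[of F "{F, b0}"], of u0] by (simp add: mult.commute)
  then have FD: "F \<in> D" by (simp add: D_def)
  have "\<exists>m. Var j ^ m \<in> D" if j: "j \<le> ?N" for j
  proof (rule ccontr)
    assume "\<nexists>m. Var j ^ m \<in> D"
    \<comment> \<open>A point of \<open>S\<close> with nonzero \<open>j\<close>-th coordinate at
      which all denominators of \<open>h\<close> vanish.\<close>
    then obtain v where v: "\<And>w. w \<in> D \<Longrightarrow> ev v w = 0" "v j \<noteq> 0"
      using nullstellensatz[OF D, of "Var j"] by auto
    define P where "P = vec (?N + 1) v"
    have evP: "eval_at P p = ev v p" if "p \<in> U ?N" for p
      unfolding eval_at_eq using that by (rule ev_cong) (simp add: P_def)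
    have "P $ j \<noteq> 0\<^sub>v (?N + 1) $ j" using v(2) j by (simp add: P_def)
    then have "P \<noteq> 0\<^sub>v (?N + 1)" by metis
    moreover have "eval_at P p = 0" if p: "p \<in> I" for p
    proof -
      have "p \<in> U ?N" "p \<in> idl.span {F}" using p IF by auto
      then have "ev v p = 0" by (intro ev_span_0[of p "{F}"]) (use v(1) FD in auto)
      then show ?thesis using evP \<open>p \<in> U ?N\<close> by simp
    qed
    moreover have "P \<in> carrier_vec (?N + 1)" by (simp add: P_def)
    ultimately have P: "P \<in> zero_points ?N I" by (simp add: zero_points_def)
    \<comment> \<open>\<open>a / b\<close> represents \<open>h / f j\<close>.\<close>
    define a where "a = subst g h"
    define b where "b = subst g (f j)"
    have a: "a \<in> forms ?N (d * 2)" "subst f a = H ^ 2 * h" using pull[OF h] pull_form[OF h] by (auto simp: a_def)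
    have b: "b \<in> forms ?N (d * 2)" "subst f b = H ^ 2 * f j"
      using pull[OF f_forms[OF j]] pull_form[OF f_forms[OF j]] by (auto simp: b_def)
    have "b \<notin> I" using b(2) H(1) f_nonzero[OF j] by (simp add: in_I_iff)
    then have frac: "fraction ?N I a b" using a(1) b(1) by (auto simp: fraction_def)
    \<comment> \<open>Dividing the integral equation of \<open>h\<close> by \<open>f j ^ k\<close>
      gives one for \<open>h / f j\<close> with coefficients \<open>c i / Var j ^ (k - i)\<close>;
      over the common denominator \<open>Var j ^ k\<close> the numerators are
      \<open>c i * Var j ^ i\<close>.\<close>
    define s where "s = Var j ^ k"
    define c' where "c' = (\<lambda>i. c i * Var j ^ i)"
    have s: "s \<in> forms ?N k" using forms_power[of "Var j" ?N 1 k] j by (simp add: s_def)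
    have c': "c' i \<in> forms ?N k" if i: "i < k" for i
    proof -
      have "Var j ^ i \<in> forms ?N i" using forms_power[of "Var j" ?N 1 i] j by simp
      from forms_mult[OF c[OF i] this] show ?thesis using i by (simp add: c'_def)
    qed
    have "s * a ^ k + (\<Sum>i<k. c' i * a ^ i * b ^ (k - i)) \<in> I"
    proof -
      have su: "s \<in> U ?N" "a \<in> U ?N" "b \<in> U ?N" using s a(1) b(1) by (simp_all only: forms_iff)
      have "c' i * a ^ i * b ^ (k - i) \<in> U ?N" if "i < k" for i
      proof -
        have "c' i \<in> U ?N" using c'[OF that] by (simp only: forms_iff)
        then show ?thesis by (intro U_closed(6) U_power su)
      qed
      then have "(\<Sum>i<k. c' i * a ^ i * b ^ (k - i)) \<in> U ?N" by (rule U_sum) (simp only: lessThan_iff)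
      from U_closed(5)[OF U_closed(6)[OF su(1) U_power[OF su(2)]] this]
      have "s * a ^ k + (\<Sum>i<k. c' i * a ^ i * b ^ (k - i)) \<in> U ?N" .
      moreover have "subst f (s * a ^ k + (\<Sum>i<k. c' i * a ^ i * b ^ (k - i))) = 0"
      proof -
        have summand: "subst f (c' i * a ^ i * b ^ (k - i)) = (f j * H ^ 2) ^ k * (subst f (c i) * h ^ i)" if i: "i < k" for i
        proof -
          have "subst f (c' i * a ^ i * b ^ (k - i)) = subst f (c i) * f j ^ i * (H ^ 2 * h) ^ i * (H ^ 2 * f j) ^ (k - i)"
            by (simp add: c'_def subst.hom_mult subst.hom_power a(2) b(2))
          also have "\<dots> = subst f (c i) * h ^ i * ((f j * H ^ 2) ^ i * (f j * H ^ 2) ^ (k - i))"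
            by (simp only: power_mult_distrib mult_ac)
          also have "(f j * H ^ 2) ^ i * (f j * H ^ 2) ^ (k - i) = (f j * H ^ 2) ^ k"
            using i by (simp only: power_add[symmetric]) simp
          finally show ?thesis by (simp only: mult_ac)
        qed
        have "subst f (s * a ^ k) = (f j * H ^ 2) ^ k * h ^ k"
          by (simp add: s_def subst.hom_mult subst.hom_power a(2) power_mult_distrib mult_ac)
        then have "subst f (s * a ^ k + (\<Sum>i<k. c' i * a ^ i * b ^ (k - i))) =
            (f j * H ^ 2) ^ k * h ^ k + (\<Sum>i<k. (f j * H ^ 2) ^ k * (subst f (c i) * h ^ i))"
          by (simp only: subst.hom_add subst.hom_sum) (simp add: summand)
        also have "\<dots> = (f j * H ^ 2) ^ k * (h ^ k + (\<Sum>i<k. subst f (c i) * h ^ i))"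
          by (simp only: distrib_left sum_distrib_left)
        finally show ?thesis using eqn by simp
      qed
      ultimately show ?thesis by (simp add: in_I_iff)
    qed
    moreover have "eval_at P s \<noteq> 0" using evP s v(2) by (simp add: s_def forms_iff ev.hom_power)
    moreover have "fraction ?N I (c' i) s" if "i < k" for i
      using c'[OF that] s Var_power_not_in_I[OF j, of k] by (auto simp: fraction_def s_def)
    ultimately have "integral_over_local_ring ?N I P a b"
      unfolding integral_over_local_ring_def using k by (intro exI[of _ k] conjI exI[of _ s] exI[of _ c']) auto
    then have "in_local_ring ?N I P a b"
      using normal P frac unfolding normal_variety_def by blast
    then obtain a' b' where ab': "fraction ?N I a' b'" "eval_at P b' \<noteq> 0" "a * b' - a' * b \<in> I"
      unfolding in_local_ring_def by blast
    then have ab'U: "a' \<in> U ?N" "b' \<in> U ?N" by (auto simp: fraction_def forms_iff)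
    have "subst f (a * b' - a' * b) = 0" using ab'(3) by (simp add: in_I_iff)
    then have "H ^ 2 * (h * subst f b' - subst f a' * f j) = 0"
      by (simp add: subst.hom_minus subst.hom_mult a(2) b(2) algebra_simps)
    \<comment> \<open>This reads \<open>h = a' * Var j / b'\<close> on \<open>S\<close>:
      \<open>b'\<close> is a denominator of \<open>h\<close> that does not vanish at
      \<open>P\<close>.\<close>
    then have hb': "h * subst f b' = subst f a' * f j" using H(1) by simp
    have "subst f (b' * u0 - a' * Var j * b0) = H ^ 2 * f 0 * (h * subst f b' - subst f a' * f j)"
      by (simp add: subst.hom_minus subst.hom_mult fu0 fb0 algebra_simps)
    then have "b' * u0 - a' * Var j * b0 \<in> I"
      using hb' ab'U u0U b0U j by (simp add: in_I_iff)
    then have "b' * u0 - a' * Var j * b0 \<in> idl.span {F, b0}"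
      using IF idl.span_mono[of "{F}" "{F, b0}"] by blast
    moreover have "a' * Var j * b0 \<in> idl.span {F, b0}" by (intro idl.span_scale idl.span_base) simp
    ultimately have "b' * u0 \<in> idl.span {F, b0}" using idl.span_add by fastforce
    then have "ev v b' = 0" using v(1) by (simp add: D_def)
    with ab'(2) evP[OF ab'U(2)] show False by simp
  qed
  then have sat': "\<exists>m. Var j ^ m * u0 \<in> idl.span (set [F, b0])" if "j \<le> ?N" for j
    using that by (simp add: D_def)
  have "regular_sequence ?N [F]"
    using F(2) FU regular_sequence_snoc[of ?N "[]" F] by (auto simp: regular_sequence_def genideal_eq)
  \<comment> \<open>\<open>b0\<close> is a nonzerodivisor modulo \<open>F\<close> because
    \<open>I\<close> is the kernel of a homomorphism into a domain and \<open>b0\<close> does not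
    map to 0.\<close>
  moreover have "p \<in> genideal (poly_ring ?N) (set [F])"
    if "p \<in> U ?N" "b0 * p \<in> genideal (poly_ring ?N) (set [F])" for p
  proof -
    have "b0 * p \<in> I" using that FU IF by (simp add: genideal_eq)
    then have "p \<in> I" using fb0_nz that(1) by (simp add: in_I_iff subst.hom_mult)
    then show ?thesis using FU IF by (simp add: genideal_eq)
  qed
  ultimately have "regular_sequence ?N [F, b0]"
    using regular_sequence_snoc[of ?N "[F]" b0] by simp
  then have "u0 \<in> idl.span (set [F, b0])"
    using FU b0U u0U n_pos sat' by (intro regular_sequence_saturated[of _ ?N]) auto
  then have "u0 \<in> idl.span (insert b0 {F})" by (simp add: insert_commute)
  then obtain r where r: "r \<in> U ?N" "u0 - r * b0 \<in> idl.span {F}"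
    using span_U_insert[of u0 b0 "{F}" ?N] u0U b0U FU by auto
  then have "u0 - r * b0 \<in> I" using IF u0U b0U by simp
  then have "(h - subst f r) * subst f b0 = 0"
    by (simp add: in_I_iff subst.hom_minus subst.hom_mult fu0 fb0 algebra_simps)
  then have hr: "h = subst f r" using fb0_nz by simp
  \<comment> \<open>\<open>r\<close> need not be homogeneous. Since \<open>f\<close> doubles
    degrees, its linear part already pulls back to \<open>h\<close>.\<close>
  have "hom_part (2 * 1) (subst f r) = subst f (hom_part 1 r)" using r(1) f_homog by (intro hom_part_subst) auto
  moreover have "hom_part 2 h = h" using h by (simp add: hom_part_of_homog[of _ 2] forms_iff)
  ultimately have "subst f (hom_part 1 r) = h" using hr by simp
  then show ?thesis using that hom_part_forms[OF r(1), of 1] by blast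
qed

end

context quadratic_birational_hypersurface
begin

section \<open>The base locus and the equivalent conditions\<close>

abbreviation Z where "Z \<equiv> base_locus n f"

lemma f_image_U: "f ` {..n + 1} \<subseteq> U n"
  using f_U by auto

lemma Z_iff: "p \<in> Z \<longleftrightarrow> p \<in> U n \<and> (\<forall>i\<le>n. \<exists>k. Var i ^ k * p \<in> idl.span (f ` {..n + 1}))"
  unfolding base_locus_def by (rule subscheme_iff[OF f_image_U])

lemma f_in_Z: "i \<le> n + 1 \<Longrightarrow> f i \<in> Z"
  unfolding base_locus_def
  by (rule span_in_subscheme[OF f_image_U]) (auto intro: idl.span_base f_U)

lemma quadric_in_Z:
  assumes "h \<in> Z" "h \<in> forms n 2"
  obtains t where "t \<in> forms (n + 1) 1" "subst f t = h"
  using complete_linear_system[OF assms(2)] assms(1) unfolding Z_iff by blast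

text \<open>The products \<open>l * Var i\<close> are quadrics through the base locus, so
  completeness of the linear system applies to each. The resulting \<open>\<kappa>\<close> are the
  components of a linear inverse.\<close>

lemma linear_form_multiples:
  assumes l: "l \<in> Z" "l \<in> forms n 1"
  obtains \<kappa> where "\<And>i. i \<le> n \<Longrightarrow> \<kappa> i \<in> forms (n + 1) 1" "\<And>i. i \<le> n \<Longrightarrow> subst f (\<kappa> i) = l * Var i"
proof -
  have "\<forall>i\<in>{..n}. \<exists>t. t \<in> forms (n + 1) 1 \<and> subst f t = l * Var i"
  proof
    fix i assume "i \<in> {..n}"
    then have i: "i \<le> n" by simp
    have form: "l * Var i \<in> forms n 2" using forms_mult[OF l(2), of "Var i" 1] i by (simp add: numeral_2_eq_2)
    have "l * Var i \<in> Z" unfolding Z_iff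
    proof (intro conjI allI impI)
      show "l * Var i \<in> U n" using form by (simp add: forms_iff)
      fix j assume "j \<le> n"
      then obtain k where "Var j ^ k * l \<in> idl.span (f ` {..n + 1})" using l(1) unfolding Z_iff by blast
      then have "Var i * (Var j ^ k * l) \<in> idl.span (f ` {..n + 1})" by (rule idl.span_scale)
      moreover have "Var i * (Var j ^ k * l) = Var j ^ k * (l * Var i)" by (simp only: mult_ac)
      ultimately show "\<exists>k. Var j ^ k * (l * Var i) \<in> idl.span (f ` {..n + 1})" by (intro exI[of _ k]) simp
    qed
    from quadric_in_Z[OF this form] show "\<exists>t. t \<in> forms (n + 1) 1 \<and> subst f t = l * Var i" by blast
  qed
  from bchoice[OF this] obtain \<kappa> where "\<forall>i\<in>{..n}. \<kappa> i \<in> forms (n + 1) 1 \<and> subst f (\<kappa> i) = l * Var i" ..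
  then show ?thesis by (intro that[of \<kappa>]) auto
qed

text \<open>A relation among the new coordinates pulls back to a multiple of \<open>l\<close> plus a
  constant times \<open>subst f \<mu>\<close>. As \<open>l\<close> does not divide the latter, the
  constant is 0, and cancelling \<open>l\<close> leaves a relation among the variables.\<close>

lemma linear_system_basis:
  assumes l: "l \<in> forms n 1" "l \<noteq> 0"
    and \<kappa>: "\<And>i. i \<le> n \<Longrightarrow> \<kappa> i \<in> forms (n + 1) 1" "\<And>i. i \<le> n \<Longrightarrow> subst f (\<kappa> i) = l * Var i"
    and \<mu>: "\<mu> \<in> forms (n + 1) 1" "subst f \<mu> \<notin> idl.span {l}"
  shows "\<exists>\<rho>. (\<forall>i\<le>n + 1. \<rho> i \<in> forms (n + 1) 1) \<and>
    (\<forall>i\<le>n + 1. subst (\<lambda>i. if i \<le> n then \<kappa> i else \<mu>) (\<rho> i) = Var i) \<and>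
    (\<forall>i\<le>n. subst \<rho> (\<kappa> i) = Var i) \<and> subst \<rho> \<mu> = Var (n + 1)"
proof -
  define w where "w = (\<lambda>i. if i \<le> n then \<kappa> i else \<mu>)"
  have ind: "c i = 0" if z: "(\<Sum>i\<le>n + 1. Const (c i) * w i) = 0" and i: "i \<le> n + 1" for c i
  proof -
    have "(\<Sum>i\<le>n + 1. Const (c i) * w i) = (\<Sum>i\<le>n. Const (c i) * \<kappa> i) + Const (c (n + 1)) * \<mu>"
      by (simp add: w_def)
    then have "subst f ((\<Sum>i\<le>n. Const (c i) * \<kappa> i) + Const (c (n + 1)) * \<mu>) = 0" using z by simp
    moreover have "subst f (\<Sum>i\<le>n. Const (c i) * \<kappa> i) = (\<Sum>i\<le>n. Const (c i) * (l * Var i))"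
      by (simp add: subst.hom_sum subst.hom_mult \<kappa>(2))
    moreover have "(\<Sum>i\<le>n. Const (c i) * (l * Var i)) = (\<Sum>i\<le>n. Const (c i) * Var i) * l"
      unfolding sum_distrib_right by (intro sum.cong refl) (simp only: mult_ac)
    ultimately have eq: "(\<Sum>i\<le>n. Const (c i) * Var i) * l + Const (c (n + 1)) * subst f \<mu> = 0"
      by (simp add: subst.hom_add subst.hom_mult)
    have c0: "c (n + 1) = 0"
    proof (rule ccontr)
      assume nz: "c (n + 1) \<noteq> 0"
      have "Const (c (n + 1)) * subst f \<mu> = - (\<Sum>i\<le>n. Const (c i) * Var i) * l"
        using eq by (simp add: add_eq_0_iff)
      then have "Const (c (n + 1)) * subst f \<mu> \<in> idl.span {l}"
        using idl.span_scale[OF idl.span_base[of l "{l}"], of "- (\<Sum>i\<le>n. Const (c i) * Var i)"] by simp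
      from idl.span_scale[OF this, of "Const (1 / c (n + 1))"]
      have "Const (1 / c (n + 1) * c (n + 1)) * subst f \<mu> \<in> idl.span {l}"
        by (subst Const.hom_mult) (simp only: mult.assoc)
      then show False using nz \<mu>(2) by simp
    qed
    with eq have "(\<Sum>i\<le>n. Const (c i) * Var i) * l = 0" by simp
    then have "(\<Sum>i\<le>n. Const (c i) * Var i) = 0" using l(2) by simp
    then have "c i = 0" if "i \<le> n" for i using linear_combination_zero that by blast
    then show ?thesis using c0 i by (cases "i \<le> n") (auto simp: not_le le_Suc_eq)
  qed
  have wf: "w i \<in> forms (n + 1) 1" for i using \<kappa>(1) \<mu>(1) by (simp add: w_def)
  have "\<exists>\<rho>. (\<forall>i\<le>n + 1. \<rho> i \<in> forms (n + 1) 1) \<and> (\<forall>i\<le>n + 1. subst w (\<rho> i) = Var i) \<and>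
      (\<forall>j\<le>n + 1. subst \<rho> (w j) = Var j)"
  proof (rule linear_forms_basis[of "n + 1" w])
    show "c i = 0" if "(\<Sum>i\<le>n + 1. Const (c i) * w i) = 0" "i \<le> n + 1" for c i
      using that by (rule ind)
  qed (rule wf, blast)
  then obtain \<rho> where \<rho>: "\<And>i. i \<le> n + 1 \<Longrightarrow> \<rho> i \<in> forms (n + 1) 1"
    "\<And>i. i \<le> n + 1 \<Longrightarrow> subst w (\<rho> i) = Var i" "\<And>j. j \<le> n + 1 \<Longrightarrow> subst \<rho> (w j) = Var j" by blast
  have "\<forall>i\<le>n. subst \<rho> (\<kappa> i) = Var i" using \<rho>(3) by (metis w_def le_add1 le_trans)
  moreover have "subst \<rho> \<mu> = Var (n + 1)" using \<rho>(3)[of "n + 1"] by (simp add: w_def)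
  ultimately show ?thesis using \<rho>(1,2) unfolding w_def by (intro exI[of _ \<rho>]) simp
qed

lemma ex_not_multiple:
  assumes "l \<in> forms n 1"
  obtains i0 where "i0 \<le> n + 1" "f i0 \<notin> idl.span {l}"
proof -
  obtain i0 where i0: "i0 \<le> n + 1" "\<not> l dvd f i0" using no_common_factor[OF assms] by auto
  then have "f i0 \<notin> idl.span {l}" by (auto simp: idl.span_singleton mult.commute)
  with i0(1) show ?thesis by (rule that)
qed

text \<open>The linear system consists of the multiples of \<open>l\<close> and one further quadric.\<close>

lemma linear_form_imp_quadric:
  assumes l: "l \<in> Z" "l \<in> forms n 1" "l \<noteq> 0"
  shows "codim2_quadric n Z"
proof -
  obtain \<kappa> where \<kappa>: "\<And>i. i \<le> n \<Longrightarrow> \<kappa> i \<in> forms (n + 1) 1" "\<And>i. i \<le> n \<Longrightarrow> subst f (\<kappa> i) = l * Var i"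
    using linear_form_multiples[OF l(1,2)] by blast
  obtain i0 where i0: "i0 \<le> n + 1" "f i0 \<notin> idl.span {l}" using ex_not_multiple[OF l(2)] by blast
  have lU: "l \<in> U n" using l(2) by (simp add: forms_iff)
  have GU: "{l, f i0} \<subseteq> U n" using lU f_U[OF i0(1)] by simp
  have v0: "Var i0 \<in> forms (n + 1) 1" and nn: "subst f (Var i0) \<notin> idl.span {l}" using i0 by simp_all
  obtain \<rho> where \<rho>0: "\<forall>i\<le>n + 1. \<rho> i \<in> forms (n + 1) 1"
    "\<forall>i\<le>n + 1. subst (\<lambda>i. if i \<le> n then \<kappa> i else Var i0) (\<rho> i) = Var i"
    using linear_system_basis[OF l(2,3) \<kappa> v0 nn] by blast
  define w where "w = (\<lambda>i. if i \<le> n then \<kappa> i else Var i0)"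
  have \<rho>: "\<And>i. i \<le> n + 1 \<Longrightarrow> \<rho> i \<in> forms (n + 1) 1"
    "\<And>i. i \<le> n + 1 \<Longrightarrow> subst w (\<rho> i) = Var i"
    using \<rho>0 unfolding w_def by blast+
  have "f i \<in> subscheme n {l, f i0}" if i: "i \<le> n + 1" for i
  proof (rule span_in_subscheme[OF GU _ f_U[OF i]])
    have "f i = subst f (subst w (\<rho> i))" using \<rho>(2)[OF i] by simp
    also have "\<dots> = subst (\<lambda>j. subst f (w j)) (\<rho> i)" by (rule subst_subst)
    also have "\<dots> = (\<Sum>j\<le>n + 1. Const (lcoeff (\<rho> i) j) * subst f (w j))"
      by (rule subst_linear_form[OF \<rho>(1)[OF i]])
    also have "\<dots> \<in> idl.span {l, f i0}"
    proof (intro idl.span_sum idl.span_scale)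
      fix j
      have "Var j * l \<in> idl.span {l, f i0}" "f i0 \<in> idl.span {l, f i0}"
        by (auto intro: idl.span_scale idl.span_base)
      then show "subst f (w j) \<in> idl.span {l, f i0}"
        using \<kappa>(2) by (simp add: w_def mult.commute)
    qed
    finally show "f i \<in> idl.span {l, f i0}" .
  qed
  then have "Z \<subseteq> subscheme n {l, f i0}"
    unfolding base_locus_def by (intro subscheme_mono GU) auto
  moreover have "subscheme n {l, f i0} \<subseteq> Z"
    using l(1) f_in_Z[OF i0(1)] unfolding base_locus_def by (intro subscheme_mono f_image_U) auto
  ultimately have "Z = subscheme n {l, f i0}" by blast
  moreover have "f i0 \<notin> genideal (poly_ring n) {l}" using i0(2) lU by (simp add: genideal_eq)
  ultimately have "quadric_in_hyperplane n Z l (f i0)"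
    unfolding quadric_in_hyperplane_def using l f_forms[OF i0(1)] by blast
  then show ?thesis unfolding codim2_quadric_def by blast
qed

lemma quadric_in_hyperplaneD:
  assumes "quadric_in_hyperplane n Z l q"
  shows "l \<in> forms n 1" "l \<noteq> 0" "l \<in> Z" "q \<in> forms n 2" "q \<in> Z" "q \<notin> idl.span {l}" "Z = subscheme n {l, q}"
proof -
  show l: "l \<in> forms n 1" "l \<noteq> 0" and q: "q \<in> forms n 2" and Z: "Z = subscheme n {l, q}"
    using assms by (auto simp: quadric_in_hyperplane_def)
  have U: "l \<in> U n" "q \<in> U n" using l q by (simp_all add: forms_iff)
  show "q \<notin> idl.span {l}" using assms U by (simp add: quadric_in_hyperplane_def genideal_eq)
  show "l \<in> Z" "q \<in> Z" unfolding Z using U by (auto intro!: span_in_subscheme intro: idl.span_base)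
qed

text \<open>The ideal of \<open>l\<close> is prime and does not contain \<open>q\<close>, so
  \<open>q\<close> is a nonzerodivisor modulo \<open>l\<close>.\<close>

lemma quadric_imp_complete_intersection:
  assumes "codim2_quadric n Z"
  shows "complete_intersection n Z"
proof -
  obtain l q where lq: "quadric_in_hyperplane n Z l q" using assms by (auto simp: codim2_quadric_def)
  note D = quadric_in_hyperplaneD[OF lq]
  have U: "l \<in> U n" "q \<in> U n" using D by (simp_all add: forms_iff)
  have "regular_sequence n [l]"
    using D(2) U regular_sequence_snoc[of n "[]" l] by (auto simp: regular_sequence_def genideal_eq)
  moreover have "p \<in> idl.span {l}" if "q * p \<in> idl.span {l}" for p
    using linear_form_prime[OF D(1,2) that] D(6) by blast
  ultimately have "regular_sequence n [l, q]"
    using regular_sequence_snoc[of n "[l]" q] U by (simp add: genideal_eq)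
  moreover have "\<forall>F\<in>set [l, q]. \<exists>d>0. F \<in> forms n d" using D(1,4) by (auto intro: exI[of _ 1] exI[of _ 2])
  ultimately show ?thesis unfolding complete_intersection_def using D(7)
    by (intro exI[of _ "[l, q]"]) simp
qed

text \<open>
  A complete intersection of codimension at most \<open>n\<close> has no more quadrics than equations, unless
  it lies in a hyperplane; one of codimension \<open>n + 1\<close> is empty.
\<close>

lemma complete_intersection_imp_linear_form:
  assumes "complete_intersection n Z"
  obtains l where "l \<in> Z" "l \<in> forms n 1" "l \<noteq> 0"
proof -
  note found = that
  obtain fs where fs: "\<And>F. F \<in> set fs \<Longrightarrow> \<exists>d>0. F \<in> forms n d" "regular_sequence n fs" "Z = subscheme n (set fs)"
    using assms unfolding complete_intersection_def by blast
  have fsU: "set fs \<subseteq> U n"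
  proof
    fix F assume "F \<in> set fs"
    then show "F \<in> U n" using fs(1) by (auto simp: forms_iff)
  qed
  show ?thesis
  proof (cases "length fs \<le> n")
    case False
    have D: "idl.subspace (idl.span (set fs))" by (rule idl.subspace_span)
    have "\<exists>k. Var i ^ k \<in> idl.span (set fs)" if i: "i \<le> n" for i
    proof (rule ccontr)
      assume "\<nexists>k. Var i ^ k \<in> idl.span (set fs)"
      then obtain v where v: "\<forall>w\<in>idl.span (set fs). ev v w = 0" "ev v (Var i) \<noteq> 0"
        using nullstellensatz[OF D, of "Var i"] by blast
      have "length fs \<le> n"
        by (rule regular_sequence_common_zero[OF fs(2,1), of v i]) (use v i in \<open>auto intro: idl.span_base\<close>)
      with False show False by simp
    qed
    then have "\<exists>k. Var i ^ k * Var 0 \<in> idl.span (set fs)" if "i \<le> n" for i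
      using that idl.span_scale[of _ "set fs" "Var 0"] by (metis mult.commute)
    \<comment> \<open>The ideal of the empty scheme contains every coordinate. The case does occur:
      for \<open>n = 1\<close> the map may parametrise a conic.\<close>
    then have "Var 0 \<in> Z" unfolding fs(3) subscheme_iff[OF fsU] by simp
    then show ?thesis by (intro that[of "Var 0"]) auto
  next
    case True
    show ?thesis
    proof (rule ccontr)
      assume "\<not> thesis"
      have no: "l = 0" if "l \<in> Z" "l \<in> forms n 1" for l
        using found[OF that] \<open>\<not> thesis\<close> by blast
      have "f i \<in> cvs.span (set fs)" if i: "i \<le> n + 1" for i
      proof -
        have "f i \<in> idl.span (set fs)"
          using f_in_Z[OF i] regular_sequence_saturated[OF fsU fs(2) True f_U[OF i]]
          unfolding fs(3) subscheme_iff[OF fsU] by blast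
        then obtain c where c: "f i = (\<Sum>F\<in>set fs. c F * F)"
          by (auto simp: idl.span_finite)
        have "f i = hom_part 2 (f i)" using hom_part_of_homog[OF f_homog[OF i], of 2] by simp
        also have "\<dots> = (\<Sum>F\<in>set fs. hom_part 2 (c F * F))" by (simp add: c hom_part_sum)
        also have "\<dots> \<in> cvs.span (set fs)"
        proof (rule cvs.span_sum)
          fix F assume F: "F \<in> set fs"
          obtain d where d: "d > 0" "F \<in> forms n d" using fs(1)[OF F] by blast
          have cm: "hom_part 2 (c F * F) = (if d \<le> 2 then hom_part (2 - d) (c F) * F else 0)"
            using d(2) by (intro hom_part_mult) (simp add: forms_iff)
          \<comment> \<open>In degree 2 an equation of degree 1 must be 0, one of degree 2 enters
            with a constant coefficient, and those of higher degree do not enter.\<close>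
          consider "d = 1" | "d = 2" | "d > 2" using d(1) by linarith
          then show "hom_part 2 (c F * F) \<in> cvs.span (set fs)"
          proof cases
            case 1
            have "F \<in> Z" unfolding fs(3) using fsU F by (intro span_in_subscheme) (auto intro: idl.span_base)
            then have "F = 0" using no d 1 by simp
            then show ?thesis by (simp add: cvs.span_zero)
          next
            case 2
            have "hom_part 0 (c F) = Const (lookup (hom_part 0 (c F)) 0)" by (rule homog_0_Const[OF hom_part_homog])
            then have "hom_part 2 (c F * F) = Const (lookup (hom_part 0 (c F)) 0) * F" using cm 2 by simp
            then show ?thesis using cvs.span_scale[OF cvs.span_base[OF F]] by metis
          next
            case 3
            then show ?thesis using cm by (simp add: cvs.span_zero)
          qed
        qed
        finally show ?thesis .
      qed
      \<comment> \<open>\<open>n + 2\<close> quadrics in the span of at most \<open>n\<close> forms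
        satisfy a linear relation.\<close>
      moreover have "card (set fs) < card {..n + 1}"
        using card_length[of fs] True by simp
      ultimately obtain c where c: "\<exists>i\<in>{..n + 1}. c i \<noteq> 0" "(\<Sum>i\<in>{..n + 1}. Const (c i) * f i) = 0"
        using finite_dim_dependent[of "set fs" "{..n + 1}" f] by (auto simp del: atMost_Suc)
      have "(\<Sum>i\<le>n + 1. Const (c i) * Var i) = 0"
      proof (rule no_linear_relation)
        show "(\<Sum>i\<le>n + 1. Const (c i) * Var i) \<in> forms (n + 1) 1"
          by (intro forms_sum forms_Const_mult) auto
        show "subst f (\<Sum>i\<le>n + 1. Const (c i) * Var i) = 0"
          using c(2) by (simp only: subst.hom_sum subst.hom_mult subst_Const subst_Var)
      qed
      then show False using c(1) linear_combination_zero[of c "n + 1"] by blast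
    qed
  qed
qed

text \<open>As \<open>\<kappa>\<close> pulls back to \<open>l\<close> times the coordinates, it
  inverts the map in both directions. Degree 0 is impossible because a nonzero constant would be a
  multiple of \<open>Var 0\<close>.\<close>

lemma linear_form_imp_type_2_1:
  assumes l: "l \<in> Z" "l \<in> forms n 1" "l \<noteq> 0"
  shows "of_type_2 n f 1"
proof -
  obtain \<kappa> where \<kappa>: "\<And>i. i \<le> n \<Longrightarrow> \<kappa> i \<in> forms (n + 1) 1" "\<And>i. i \<le> n \<Longrightarrow> subst f (\<kappa> i) = l * Var i"
    using linear_form_multiples[OF l(1,2)] by blast
  have in_I: "\<kappa> 0 \<notin> I" using \<kappa>(2)[of 0] l(3) by (simp add: in_I_iff)
  have pull: "subst f (subst \<kappa> (f i)) = l ^ 2 * f i" if i: "i \<le> n + 1" for i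
    by (rule subst_subst_proportional[OF f_forms[OF i] \<kappa>(2)])
  have \<kappa>f: "subst \<kappa> (f i) \<in> U (n + 1)" if "i \<le> n + 1" for i
    using f_U[OF that] by (rule subst_in_U) (use \<kappa>(1) in \<open>simp only: forms_iff\<close>)
  have map1: "same_rational_map {0} n (\<lambda>i. subst f (\<kappa> i)) Var"
    unfolding same_rational_map_def
  proof (intro conjI allI impI)
    show "\<exists>i\<le>n. subst f (\<kappa> i) \<notin> {0}" using \<kappa>(2)[of 0] l(3) by (intro exI[of _ 0]) simp
    show "\<exists>i\<le>n. Var i \<notin> {0}" by auto
    show "subst f (\<kappa> i) * Var j - subst f (\<kappa> j) * Var i \<in> {0}" if "i \<le> n" "j \<le> n" for i j
      using that \<kappa>(2) by (simp add: mult_ac)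
  qed
  have map2: "same_rational_map I (n + 1) (\<lambda>i. subst \<kappa> (f i)) Var"
    unfolding same_rational_map_def
  proof (intro conjI allI impI)
    show "\<exists>i\<le>n + 1. subst \<kappa> (f i) \<notin> I"
      using pull[of 0] l(3) f_nonzero[of 0] by (intro exI[of _ 0]) (simp add: in_I_iff)
    show "\<exists>i\<le>n + 1. Var i \<notin> I" using Var_power_not_in_I[of 0 1] by auto
    show "subst \<kappa> (f i) * Var j - subst \<kappa> (f j) * Var i \<in> I" if ij: "i \<le> n + 1" "j \<le> n + 1" for i j
      unfolding in_I_iff
    proof
      show "subst \<kappa> (f i) * Var j - subst \<kappa> (f j) * Var i \<in> U (n + 1)"
        using \<kappa>f ij by (intro U_closed) auto
      show "subst f (subst \<kappa> (f i) * Var j - subst \<kappa> (f j) * Var i) = 0"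
        by (simp only: subst.hom_minus subst.hom_mult subst_Var pull[OF ij(1)] pull[OF ij(2)]) (simp add: mult_ac)
    qed
  qed
  have "inverse_of_degree n f 1 \<kappa>"
    unfolding inverse_of_degree_def using \<kappa>(1) in_I map1 map2 by auto
  moreover have "\<not> inverse_of_degree n f 0 g" for g
  proof
    assume g: "inverse_of_degree n f 0 g"
    obtain H where H: "H \<noteq> 0" "\<And>i. i \<le> n \<Longrightarrow> subst f (g i) = Var i * H" using obtain_inverse[OF g] by blast
    have "g 0 \<in> homog 0" using g by (auto simp: inverse_of_degree_def forms_iff)
    from homog_0_Const[OF this] obtain c where "g 0 = Const c" by blast
    then have "Const c = Var 0 * H" using H(2)[of 0] by simp
    moreover from this have "c \<noteq> 0" using H(1) by auto
    moreover have "ev (\<lambda>_. 0) (Var 0 * H) = 0" by (simp add: ev.hom_mult)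
    ultimately show False by (metis ev_Const)
  qed
  ultimately show ?thesis
    using birational unfolding of_type_2_def quadratic_birational_def by auto
qed

text \<open>A linear inverse pulls back to members \<open>Var i * H\<close> of the linear system.
  Degrees make \<open>H\<close> a linear form, and its products with all coordinates lie in the
  ideal of the quadrics.\<close>

lemma type_2_1_imp_linear_form:
  assumes "of_type_2 n f 1"
  obtains l where "l \<in> Z" "l \<in> forms n 1" "l \<noteq> 0"
proof -
  obtain g where g: "inverse_of_degree n f 1 g" using assms unfolding of_type_2_def by blast
  obtain H where H: "H \<noteq> 0" "\<And>i. i \<le> n \<Longrightarrow> subst f (g i) = Var i * H" using obtain_inverse[OF g] by blast
  have g1: "g i \<in> forms (n + 1) 1" if "i \<le> n" for i using g that by (simp add: inverse_of_degree_def)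
  have "subst f (g 0) \<in> forms n (2 * 1)" using g1[of 0] f_forms by (intro forms_subst) auto
  then have form: "Var 0 * H \<in> forms n 2" using H(2)[of 0] by simp
  \<comment> \<open>Cancelling \<open>Var 0\<close> shows that \<open>H\<close> has degree 1; the
    same argument with \<open>restr\<close> shows that it involves no further variables.\<close>
  have "hom_part 2 (H * Var 0) = (if 1 \<le> (2::nat) then hom_part (2 - 1) H * Var 0 else 0)"
    by (rule hom_part_mult) simp
  moreover have "hom_part 2 (H * Var 0) = H * Var 0"
    using form by (simp add: hom_part_of_homog[of _ 2] forms_iff mult.commute)
  ultimately have "(hom_part 1 H - H) * Var 0 = 0" by (simp add: left_diff_distrib)
  then have H1: "H \<in> homog 1" using hom_part_homog[of 1 H] by simp
  have "restr n (Var 0 * H) = Var 0 * H" using form by (intro restr_id) (simp add: forms_iff)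
  then have "Var 0 * (restr n H - H) = 0" by (simp add: restr_def subst.hom_mult right_diff_distrib)
  then have "H \<in> U n" using restr_in_U[of n H] by simp
  with H1 have Hf: "H \<in> forms n 1" by (simp add: forms_iff)
  have "H \<in> Z" unfolding Z_iff
  proof (intro conjI allI impI)
    fix i assume i: "i \<le> n"
    have "subst f (g i) = (\<Sum>j\<le>n + 1. Const (lcoeff (g i) j) * f j)" by (rule subst_linear_form[OF g1[OF i]])
    also have "\<dots> \<in> idl.span (f ` {..n + 1})" by (intro idl.span_sum idl.span_scale idl.span_base) auto
    finally have "Var i ^ 1 * H \<in> idl.span (f ` {..n + 1})" using H(2)[OF i] by simp
    then show "\<exists>k. Var i ^ k * H \<in> idl.span (f ` {..n + 1})" ..
  qed fact
  then show ?thesis using Hf H(1) by (rule that)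
qed

lemma h0_iff: "h0_ideal_sheaf n Z 1 \<noteq> 0 \<longleftrightarrow> (\<exists>l. l \<in> Z \<and> l \<in> forms n 1 \<and> l \<noteq> 0)"
  unfolding h0_ideal_sheaf_1 by blast

text \<open>
  In the coordinates \<open>z\<^sub>i = l x\<^sub>i\<close>, \<open>w = q\<close> on the ambient space, the equation of the image
  is \<open>q(z) = w l(z)\<close>.
\<close>

lemma image_equation:
  assumes lq: "quadric_in_hyperplane n Z l q"
  shows "\<exists>\<kappa> \<mu> \<rho>. (\<forall>i\<le>n. \<kappa> i \<in> forms (n + 1) 1) \<and> \<mu> \<in> forms (n + 1) 1 \<and>
    (\<forall>i\<le>n + 1. \<rho> i \<in> forms (n + 1) 1) \<and>
    (\<forall>i\<le>n + 1. subst (\<lambda>i. if i \<le> n then \<kappa> i else \<mu>) (\<rho> i) = Var i) \<and>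
    (\<forall>i\<le>n. subst \<rho> (\<kappa> i) = Var i) \<and> subst \<rho> \<mu> = Var (n + 1) \<and>
    hypersurface (n + 1) 2 I \<and>
    (\<forall>Q. Q \<in> forms (n + 1) 2 \<longrightarrow> Q \<noteq> 0 \<longrightarrow> I = subscheme (n + 1) {Q} \<longrightarrow>
       (\<exists>c. c \<noteq> 0 \<and> Q = Const c * (subst \<kappa> q - \<mu> * subst \<kappa> l)))"
proof -
  note D = quadric_in_hyperplaneD[OF lq]
  obtain \<kappa> where \<kappa>: "\<And>i. i \<le> n \<Longrightarrow> \<kappa> i \<in> forms (n + 1) 1" "\<And>i. i \<le> n \<Longrightarrow> subst f (\<kappa> i) = l * Var i"
    using linear_form_multiples[OF D(3,1)] by blast
  obtain \<mu> where \<mu>: "\<mu> \<in> forms (n + 1) 1" "subst f \<mu> = q" using quadric_in_Z[OF D(5,4)] by blast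
  have nm: "subst f \<mu> \<notin> idl.span {l}" using \<mu>(2) D(6) by simp
  obtain \<rho> where \<rho>: "\<forall>i\<le>n + 1. \<rho> i \<in> forms (n + 1) 1"
    "\<forall>i\<le>n + 1. subst (\<lambda>i. if i \<le> n then \<kappa> i else \<mu>) (\<rho> i) = Var i"
    "\<forall>i\<le>n. subst \<rho> (\<kappa> i) = Var i" "subst \<rho> \<mu> = Var (n + 1)"
    using linear_system_basis[OF D(1,2) \<kappa> \<mu>(1) nm] by blast
  have U: "l \<in> U n" "q \<in> U n" using D by (simp_all add: forms_iff)
  \<comment> \<open>\<open>\<kappa>\<close> pulls back to \<open>l\<close> times the coordinates and
    \<open>\<mu>\<close> to \<open>q\<close>, so both terms of \<open>G\<close> pull back to
    \<open>l ^ 2 * q\<close>.\<close>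
  define G where "G = subst \<kappa> q - \<mu> * subst \<kappa> l"
  have "subst \<kappa> q \<in> forms (n + 1) (1 * 2)" "subst \<kappa> l \<in> forms (n + 1) (1 * 1)"
    by (rule forms_subst[OF D(4) \<kappa>(1)], simp) (rule forms_subst[OF D(1) \<kappa>(1)], simp)
  then have Gf: "G \<in> forms (n + 1) 2"
    using forms_mult[OF \<mu>(1), of "subst \<kappa> l" 1] unfolding G_def by (intro forms_closed) (simp_all add: numeral_2_eq_2)
  have pull: "subst f (subst \<kappa> p) = l ^ d * p" if "p \<in> forms n d" for p d
    by (rule subst_subst_proportional[OF that \<kappa>(2)])
  have "subst f G = 0"
    unfolding G_def subst.hom_minus subst.hom_mult \<mu>(2) pull[OF D(4)] pull[OF D(1)] by (simp add: power2_eq_square)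
  then have GI: "G \<in> I" using Gf by (simp add: in_I_iff forms_iff)
  have G0: "G \<noteq> 0"
  proof
    assume "G = 0"
    have pullback: "subst \<rho> (subst \<kappa> p) = p" if "p \<in> U n" for p
    proof -
      have "subst \<rho> (subst \<kappa> p) = subst (\<lambda>j. subst \<rho> (\<kappa> j)) p" by (rule subst_subst)
      also have "\<dots> = p" by (rule subst_ident[OF that]) (use \<rho>(3) in blast)
      finally show ?thesis .
    qed
    \<comment> \<open>Setting the last variable to 0 in these coordinates recovers \<open>q\<close>,
      which is not 0.\<close>
    have "subst \<rho> G = q - Var (n + 1) * l"
      unfolding G_def subst.hom_minus subst.hom_mult pullback[OF U(1)] pullback[OF U(2)] \<rho>(4) ..
    then have "q - Var (n + 1) * l = 0" using \<open>G = 0\<close> by simp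
    then have "restr n (q - Var (n + 1) * l) = 0" by (simp add: restr_def)
    then have "q = 0" using restr_id[OF U(2)] by (simp add: restr_def subst.hom_minus subst.hom_mult)
    then show False using D(6) by (simp add: idl.span_zero)
  qed
  \<comment> \<open>Comparing degrees leaves only a constant factor. Used with the equation
    \<open>F\<close>, where it forces degree 2, and with an arbitrary quadratic equation
    \<open>Q\<close> of \<open>S\<close>.\<close>
  have scalar: "e = 2 \<and> (\<exists>c. c \<noteq> 0 \<and> P = Const c * F)"
    if F: "F \<in> forms (n + 1) e" "e \<ge> 2" and P: "P \<in> forms (n + 1) 2" "P \<noteq> 0" "P \<in> idl.span {F}" for P F e
  proof -
    obtain k where k: "P = k * F" using P(3) by (auto simp: idl.span_singleton)
    have "P = hom_part 2 P" using P(1) hom_part_of_homog[of P 2 2] by (simp add: forms_iff)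
    also have "\<dots> = (if e \<le> 2 then hom_part (2 - e) k * F else 0)"
      unfolding k using F(1) by (intro hom_part_mult) (simp add: forms_iff)
    finally have e: "e \<le> 2" "P = hom_part (2 - e) k * F" using P(2) by (auto split: if_splits)
    then have "e = 2" using F(2) by simp
    with e(2) have "P = hom_part 0 k * F" by simp
    moreover have "hom_part 0 k = Const (lookup (hom_part 0 k) 0)" by (rule homog_0_Const[OF hom_part_homog])
    ultimately have "P = Const (lookup (hom_part 0 k) 0) * F" by metis
    then show ?thesis using \<open>e = 2\<close> P(2) by (intro conjI exI[of _ "lookup (hom_part 0 k) 0"]) auto
  qed
  obtain F e where F: "F \<in> forms (n + 1) e" "F \<noteq> 0" "e \<ge> 2" "I = subscheme (n + 1) {F}"
    "\<And>p. p \<in> I \<longleftrightarrow> p \<in> U (n + 1) \<and> p \<in> idl.span {F}"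
    using obtain_F by metis
  have "e = 2" using scalar[OF F(1,3) Gf G0] GI F(5) by blast
  then have hyp: "hypersurface (n + 1) 2 I"
    unfolding hypersurface_def using F(1,2,4) by auto
  have Qs: "\<exists>c. c \<noteq> 0 \<and> Q = Const c * G" if Q: "Q \<in> forms (n + 1) 2" "Q \<noteq> 0" "I = subscheme (n + 1) {Q}" for Q
  proof -
    have "G \<in> idl.span {Q}" using I_principal[OF _ Q(2,3), of G] Q(1) GI by (simp add: forms_iff)
    then obtain c where c: "c \<noteq> 0" "G = Const c * Q" using scalar[OF Q(1) _ Gf G0] by auto
    have "Const (1 / c) * G = Const (1 / c * c) * Q" unfolding c(2) by (subst Const.hom_mult) (simp only: mult.assoc)
    then have "Q = Const (1 / c) * G" using c(1) by simp
    then show ?thesis using c(1) by (intro exI[of _ "1 / c"]) simp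
  qed
  have "\<forall>i\<le>n. \<kappa> i \<in> forms (n + 1) 1" using \<kappa>(1) by blast
  moreover have "\<forall>Q. Q \<in> forms (n + 1) 2 \<longrightarrow> Q \<noteq> 0 \<longrightarrow> I = subscheme (n + 1) {Q} \<longrightarrow>
       (\<exists>c. c \<noteq> 0 \<and> Q = Const c * (subst \<kappa> q - \<mu> * subst \<kappa> l))"
    using Qs unfolding G_def by blast
  ultimately show ?thesis using \<mu>(1) \<rho> hyp
    by (intro exI[of _ \<kappa>] exI[of _ \<mu>] exI[of _ \<rho>] conjI)
qed

end

section \<open>Ranks\<close>

text \<open>The two Gram matrices have different sizes; their ranks are compared through isomorphic
  kernels.\<close>

lemma rank_add_kernel_dim:
  fixes A :: "complex mat"
  assumes A: "A \<in> carrier_mat k m"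
  shows "vec_space.rank k A + kernel_dim A = m"
proof -
  interpret K: kernel k m A by unfold_locales (rule A)
  interpret W: vec_space "TYPE(complex)" k .
  have hom: "(\<lambda>v. A *\<^sub>v v) \<in> LinearCombinations.module_hom class_ring (module_vec TYPE(complex) m) (module_vec TYPE(complex) k)"
    unfolding LinearCombinations.module_hom_def module_vec_simps class_ring_simps
    using A mult_add_distrib_mat_vec[OF A] mult_mat_vec[OF A] by (intro CollectI conjI allI impI) simp_all
  interpret L: linear_map class_ring "module_vec TYPE(complex) m" "module_vec TYPE(complex) k" "\<lambda>v. A *\<^sub>v v"
    by (unfold_locales) (rule hom)
  have im: "L.im = W.span (set (cols A))"
    using W.col_space_eq[OF A] A unfolding L.im_def W.col_space_def by (auto simp: module_vec_simps)
  have ker: "L.ker = mat_kernel A"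
    using A unfolding L.ker_def mat_kernel[OF A] by (auto simp: module_vec_simps)
  have "vectorspace.dim class_ring (W.V\<lparr>carrier := L.im\<rparr>) + vectorspace.dim class_ring (K.NC.V\<lparr>carrier := L.ker\<rparr>) = K.NC.dim"
    by (rule L.rank_nullity[OF K.NC.fin_dim])
  then show ?thesis unfolding im ker K.NC.dim_is_n W.rank_def K.kernel_dim .
qed

text \<open>Linearity of \<open>\<phi>\<close> is asked for on the kernel only, which suits a map
  defined through \<open>inv_into\<close>.\<close>

lemma kernel_dim_eq:
  fixes A B :: "complex mat"
  assumes A: "A \<in> carrier_mat k m" and B: "B \<in> carrier_mat k' m'"
    and add: "\<And>v w. v \<in> mat_kernel A \<Longrightarrow> w \<in> mat_kernel A \<Longrightarrow> \<phi> (v + w) = \<phi> v + \<phi> w"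
    and smult: "\<And>c v. v \<in> mat_kernel A \<Longrightarrow> \<phi> (c \<cdot>\<^sub>v v) = c \<cdot>\<^sub>v \<phi> v"
    and bij: "bij_betw \<phi> (mat_kernel A) (mat_kernel B)"
  shows "kernel_dim A = kernel_dim B"
proof -
  interpret KA: kernel k m A by unfold_locales (rule A)
  interpret KB: kernel k' m' B by unfold_locales (rule B)
  have hom: "\<phi> \<in> LinearCombinations.module_hom class_ring KA.VK KB.VK"
    unfolding LinearCombinations.module_hom_def using add smult bij_betw_imp_surj_on[OF bij] by auto
  interpret L: linear_map class_ring KA.VK KB.VK \<phi>
    by unfold_locales (rule hom)
  obtain S where S: "finite S" "KA.basis S" using kernel_basis_exists[OF A] by blast
  have fd: "KA.Ker.fin_dim"
    using S unfolding KA.Ker.fin_dim_def KA.Ker.basis_def by auto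
  have "KA.Ker.dim = KB.Ker.dim"
    by (rule L.dim_eq[OF fd]) (use bij in \<open>auto simp: bij_betw_def\<close>)
  then show ?thesis unfolding KA.kernel_dim KB.kernel_dim .
qed

section \<open>Quadratic forms, Gram matrices and polarisation\<close>

lemma single_add_eq_iff:
  fixes i j a b :: nat
  shows "single i (1::nat) + single j 1 = single a 1 + single b 1 \<longleftrightarrow>
     (i = a \<and> j = b) \<or> (i = b \<and> j = a)"
proof
  assume eq: "single i (1::nat) + single j 1 = single a 1 + single b 1"
  define \<delta> where "\<delta> = (\<lambda>(y::nat) x. if y = x then 1 else (0::nat))"
  have \<delta>: "\<delta> y x = 0 \<longleftrightarrow> y \<noteq> x" "\<delta> y y = 1" "\<delta> y x \<le> 1" for x y by (simp_all add: \<delta>_def)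
  have sum: "\<delta> i x + \<delta> j x = \<delta> a x + \<delta> b x" for x
    using arg_cong[OF eq, of "\<lambda>p. lookup p x"] by (simp only: lookup_add lookup_single when_def \<delta>_def)
  show "(i = a \<and> j = b) \<or> (i = b \<and> j = a)"
  proof (cases "a = i")
    case True
    then have "\<delta> b j = 1" using sum[of j] \<delta>(2)[of j] by simp
    then have "b = j" using \<delta>(1)[of b j] by simp
    with True show ?thesis by simp
  next
    case False
    then have "\<delta> b i \<noteq> 0" using sum[of i] \<delta>(2)[of i] \<delta>(1)[of a i] by simp
    then have b: "b = i" using \<delta>(1)[of b i] by simp
    then have "\<delta> a j = 1" using sum[of j] \<delta>(2)[of j] by simp
    then have "a = j" using \<delta>(1)[of a j] by simp
    with b show ?thesis by simp
  qed
qed (auto simp: add.commute)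

lemma monom_degree_2: "monom_degree m = 2 \<Longrightarrow> \<exists>a b. m = single a 1 + single b 1"
proof -
  assume d: "monom_degree m = 2"
  then have "keys m \<noteq> {}" by (auto simp: monom_degree_def)
  then obtain a where "a \<in> keys m" by blast
  then have a: "lookup m a \<ge> 1" by (simp add: in_keys_iff)
  define m' where "m' = m - single a 1"
  have mm: "m = single a 1 + m'"
    unfolding m'_def using a by (intro poly_mapping_eqI) (auto simp: lookup_add lookup_minus lookup_single when_def)
  have "monom_degree m = 1 + monom_degree m'" by (subst mm) (simp add: monom_degree_add)
  then have "monom_degree m' = 1" using d by simp
  then obtain b where "m' = single b 1" using monom_degree_1 by blast
  then show ?thesis using mm by blast
qed

definition qcoeff :: "cpoly \<Rightarrow> nat \<Rightarrow> nat \<Rightarrow> complex" where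
  "qcoeff P i j = lookup P (single i 1 + single j 1) / (if i = j then 1 else 2)"

lemma gram_eq: "gram N P = mat (N + 1) (N + 1) (\<lambda>(i, j). qcoeff P i j)"
  by (simp add: gram_def qcoeff_def)

lemma qcoeff_sym: "qcoeff P i j = qcoeff P j i"
  by (simp add: qcoeff_def add.commute)

lemma ev_quadratic_form:
  assumes P: "P \<in> forms N 2"
  shows "ev v P = (\<Sum>i\<le>N. \<Sum>j\<le>N. qcoeff P i j * v i * v j)"
proof -
  have mono: "ev v (single m c) = (\<Sum>i\<le>N. \<Sum>j\<le>N. qcoeff (single m c) i j * v i * v j)"
    if m: "keys m \<subseteq> {..N}" "monom_degree m = 2" for m c
  proof -
    obtain a b where ab: "m = single a 1 + single b 1"
      using monom_degree_2[OF m(2)] by blast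
    have "lookup m a \<noteq> 0" "lookup m b \<noteq> 0" by (simp_all add: ab lookup_add)
    then have le: "a \<le> N" "b \<le> N" using m(1) by (auto simp: in_keys_iff subset_iff)
    have q: "qcoeff (single m c) i j = (if i = a \<and> j = b \<or> i = b \<and> j = a then c / (if i = j then 1 else 2) else 0)" for i j
      unfolding qcoeff_def ab lookup_single when_def using single_add_eq_iff[of a b i j] by auto
    have "(\<Sum>i\<le>N. \<Sum>j\<le>N. qcoeff (single m c) i j * v i * v j) = c * v a * v b"
    proof (cases "a = b")
      case True
      have "(\<Sum>i\<le>N. \<Sum>j\<le>N. qcoeff (single m c) i j * v i * v j) =
          (\<Sum>i\<le>N. \<Sum>j\<le>N. if j = a then (if i = a then c * v a * v a else 0) else 0)"
        by (intro sum.cong refl) (simp add: q True)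
      also have "\<dots> = c * v a * v a" using le by simp
      finally show ?thesis using True by simp
    next
      \<comment> \<open>A mixed monomial is met at two positions of the matrix, each with half its
        coefficient.\<close>
      case False
      have "(\<Sum>i\<le>N. \<Sum>j\<le>N. qcoeff (single m c) i j * v i * v j) =
          (\<Sum>i\<le>N. \<Sum>j\<le>N. (if j = b then (if i = a then c / 2 * v a * v b else 0) else 0) +
             (if j = a then (if i = b then c / 2 * v a * v b else 0) else 0))"
        by (intro sum.cong refl) (use False in \<open>auto simp: q\<close>)
      also have "\<dots> = c * v a * v b" using le by (simp add: sum.distrib)
      finally show ?thesis .
    qed
    moreover have "ev v (single m c) = c * v a * v b"
      by (simp add: ev_single ab mon_add)
    ultimately show ?thesis by simp
  qed
  have "ev v P = (\<Sum>m\<in>keys P. ev v (single m (lookup P m)))"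
    by (subst poly_mapping_sum_singles[of P]) (simp only: ev.hom_sum)
  also have "\<dots> = (\<Sum>m\<in>keys P. \<Sum>i\<le>N. \<Sum>j\<le>N. qcoeff (single m (lookup P m)) i j * v i * v j)"
    using P by (intro sum.cong refl mono) (auto simp: forms_iff in_U_iff homog_def)
  also have "\<dots> = (\<Sum>i\<le>N. \<Sum>j\<le>N. \<Sum>m\<in>keys P. qcoeff (single m (lookup P m)) i j * v i * v j)"
    by (subst sum.swap, intro sum.cong refl, rule sum.swap)
  also have "\<dots> = (\<Sum>i\<le>N. \<Sum>j\<le>N. qcoeff P i j * v i * v j)"
  proof (intro sum.cong refl)
    fix i j
    have "qcoeff P i j = (\<Sum>m\<in>keys P. qcoeff (single m (lookup P m)) i j)"
      unfolding qcoeff_def by (subst poly_mapping_sum_singles[of P]) (simp only: lookup_sum sum_divide_distrib)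
    then show "(\<Sum>m\<in>keys P. qcoeff (single m (lookup P m)) i j * v i * v j) = qcoeff P i j * v i * v j"
      by (simp add: sum_distrib_right)
  qed
  finally show ?thesis .
qed

text \<open>Turns statements about kernels of \<open>gram\<close> into statements about values of
  polynomials, where coordinate changes are plain substitutions.\<close>

lemma polar_form:
  assumes P: "P \<in> forms N 2" and v: "v \<in> carrier_vec (N + 1)" and w: "w \<in> carrier_vec (N + 1)"
  shows "eval_at (v + w) P = eval_at v P + eval_at w P + 2 * (w \<bullet> (gram N P *\<^sub>v v))"
proof -
  have vw: "(v + w) $ i = v $ i + w $ i" if "i \<le> N" for i using v w that by auto
  have S: "w \<bullet> (gram N P *\<^sub>v v) = (\<Sum>i\<le>N. \<Sum>j\<le>N. qcoeff P i j * w $ i * v $ j)"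
  proof -
    have "w \<bullet> (gram N P *\<^sub>v v) = (\<Sum>i\<in>{0..<N + 1}. w $ i * (\<Sum>j\<in>{0..<N + 1}. qcoeff P i j * v $ j))"
      using v w unfolding gram_eq scalar_prod_def by (auto simp: scalar_prod_def intro!: sum.cong)
    also have "\<dots> = (\<Sum>i\<le>N. w $ i * (\<Sum>j\<le>N. qcoeff P i j * v $ j))"
      by (simp only: Suc_eq_plus1[symmetric] atLeast0LessThan lessThan_Suc_atMost)
    finally show ?thesis by (simp add: sum_distrib_left mult_ac)
  qed
  have "eval_at (v + w) P = (\<Sum>i\<le>N. \<Sum>j\<le>N. qcoeff P i j * (v $ i + w $ i) * (v $ j + w $ j))"
    unfolding eval_at_eq ev_quadratic_form[OF P] by (intro sum.cong refl) (simp add: vw)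
  also have "\<dots> = (\<Sum>i\<le>N. \<Sum>j\<le>N. qcoeff P i j * v $ i * v $ j + qcoeff P i j * w $ i * w $ j +
      qcoeff P i j * w $ i * v $ j + qcoeff P i j * v $ i * w $ j)"
    by (intro sum.cong refl) (simp add: algebra_simps)
  also have "\<dots> = eval_at v P + eval_at w P + (\<Sum>i\<le>N. \<Sum>j\<le>N. qcoeff P i j * w $ i * v $ j)
      + (\<Sum>i\<le>N. \<Sum>j\<le>N. qcoeff P i j * v $ i * w $ j)"
    unfolding eval_at_eq ev_quadratic_form[OF P] by (simp only: sum.distrib)
  also have "(\<Sum>i\<le>N. \<Sum>j\<le>N. qcoeff P i j * v $ i * w $ j) = (\<Sum>i\<le>N. \<Sum>j\<le>N. qcoeff P i j * w $ i * v $ j)"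
    by (subst sum.swap, intro sum.cong refl, subst qcoeff_sym) (simp only: mult_ac)
  finally show ?thesis by (simp add: S)
qed

lemma gram_carrier: "gram N P \<in> carrier_mat (N + 1) (N + 1)"
  by (simp add: gram_eq)

lemma vec_zero_if_orthogonal:
  fixes y :: "complex vec"
  assumes y: "y \<in> carrier_vec k" and "\<And>w. w \<in> carrier_vec k \<Longrightarrow> w \<bullet> y = 0"
  shows "y = 0\<^sub>v k"
proof (rule eq_vecI)
  fix i assume "i < dim_vec (0\<^sub>v k :: complex vec)"
  then have i: "i < k" by simp
  then have "unit_vec k i \<bullet> y = y $ i" using y by (intro scalar_prod_left_unit)
  with assms(2)[of "unit_vec k i"] i show "y $ i = 0\<^sub>v k $ i" by simp
qed (use y in simp)

lemma eval_at_linear_form: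
  assumes "l \<in> forms N 1"
  shows "eval_at v l = (\<Sum>i\<le>N. lcoeff l i * v $ i)"
  unfolding eval_at_eq
  by (subst linear_form_eq[OF assms]) (simp add: ev.hom_sum ev.hom_mult)

lemma eval_at_linear_add:
  assumes "l \<in> forms N 1" "v \<in> carrier_vec (N + 1)" "w \<in> carrier_vec (N + 1)"
  shows "eval_at (v + w) l = eval_at v l + eval_at w l"
proof -
  have "(v + w) $ i = v $ i + w $ i" if "i \<le> N" for i using assms that by auto
  then show ?thesis unfolding eval_at_linear_form[OF assms(1)]
    by (simp add: distrib_left sum.distrib)
qed

lemma eval_at_linear_smult:
  assumes "l \<in> forms N 1" "v \<in> carrier_vec (N + 1)"
  shows "eval_at (c \<cdot>\<^sub>v v) l = c * eval_at v l"
proof -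
  have "(c \<cdot>\<^sub>v v) $ i = c * v $ i" if "i \<le> N" for i using assms that by auto
  then show ?thesis unfolding eval_at_linear_form[OF assms(1)]
    by (simp add: sum_distrib_left mult_ac)
qed

text \<open>
  In the coordinates \<open>t = \<kappa>(v)\<close>, \<open>s = \<mu>(v)\<close> a vector lies in the kernel of the form \<open>q(t) - s l(t)\<close> iff
  \<open>l(t) = 0\<close> and twice the polar form of \<open>q\<close> at \<open>t\<close> is \<open>s l\<close>. So its \<open>t\<close> is in the kernel of
  the restriction of \<open>q\<close> to \<open>l = 0\<close>, and each such \<open>t\<close> determines the number \<open>s\<close>.
\<close>

lemma rank_quadric_plus_hyperbolic_plane:
  assumes l: "l \<in> forms n 1" "l \<noteq> 0" and q: "q \<in> forms n 2"
    and \<kappa>: "\<forall>i\<le>n. \<kappa> i \<in> forms (n + 1) 1" and \<mu>: "\<mu> \<in> forms (n + 1) 1"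
    and \<rho>: "\<forall>i\<le>n + 1. \<rho> i \<in> forms (n + 1) 1"
      "\<forall>i\<le>n + 1. subst (\<lambda>i. if i \<le> n then \<kappa> i else \<mu>) (\<rho> i) = Var i"
      "\<forall>i\<le>n. subst \<rho> (\<kappa> i) = Var i" "subst \<rho> \<mu> = Var (n + 1)"
    and Q: "Q \<in> forms (n + 1) 2" "c \<noteq> 0" "Q = Const c * (subst \<kappa> q - \<mu> * subst \<kappa> l)"
    and A: "A \<in> carrier_mat (n + 1) n"
      "bij_betw (\<lambda>u. A *\<^sub>v u) (carrier_vec n) {v \<in> carrier_vec (n + 1). eval_at v l = 0}"
  shows "vec_space.rank (n + 1 + 1) (gram (n + 1) Q) = vec_space.rank n (transpose_mat A * gram n q * A) + 2"
proof -
  define M where "M = gram n q"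
  define S where "S = gram (n + 1) Q"
  define B where "B = transpose_mat A * M * A"
  have M: "M \<in> carrier_mat (n + 1) (n + 1)" unfolding M_def by (rule gram_carrier)
  have S: "S \<in> carrier_mat (n + 2) (n + 2)" unfolding S_def using gram_carrier[of "n + 1" Q] by simp
  have B: "B \<in> carrier_mat n n" unfolding B_def using A(1) M by auto
  define T where "T = (\<lambda>v. vec (n + 1) (\<lambda>i. eval_at v (\<kappa> i)))"
  have T: "T v \<in> carrier_vec (n + 1)" for v by (simp add: T_def)
  \<comment> \<open>The inverse of the coordinate change that takes \<open>v\<close> to
    \<open>T v\<close> and its value under \<open>\<mu>\<close>.\<close>
  define V where "V = (\<lambda>t s. vec (n + 2) (\<lambda>i. ev (\<lambda>j. if j \<le> n then t $ j else s) (\<rho> i)))"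
  have V: "V t s \<in> carrier_vec (n + 2)" for t s by (simp add: V_def)
  have ev_V: "eval_at (V t s) p = ev (\<lambda>j. if j \<le> n then t $ j else s) (subst \<rho> p)" if "p \<in> U (n + 1)" for t s p
    unfolding eval_at_eq ev_subst
    by (rule ev_cong[OF that]) (simp add: V_def)
  have TV: "T (V t s) = t" and \<mu>V: "eval_at (V t s) \<mu> = s" if t: "t \<in> carrier_vec (n + 1)" for t s
  proof -
    show "T (V t s) = t"
    proof (rule eq_vecI)
      fix i assume "i < dim_vec t"
      then have i: "i \<le> n" using t by simp
      have "eval_at (V t s) (\<kappa> i) = t $ i" using \<kappa> \<rho>(3) i by (subst ev_V) (auto simp: forms_iff)
      then show "T (V t s) $ i = t $ i" using i by (simp add: T_def)
    qed (use t in \<open>simp add: T_def\<close>)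
    show "eval_at (V t s) \<mu> = s" using \<mu> \<rho>(4) by (subst ev_V) (auto simp: forms_iff)
  qed
  have VT: "V (T v) (eval_at v \<mu>) = v" if v: "v \<in> carrier_vec (n + 2)" for v
  proof (rule eq_vecI)
    fix i assume "i < dim_vec v"
    then have i: "i \<le> n + 1" using v by simp
    have "v $ i = ev (\<lambda>j. v $ j) (subst (\<lambda>i. if i \<le> n then \<kappa> i else \<mu>) (\<rho> i))" using \<rho>(2) i by simp
    also have "\<dots> = ev (\<lambda>j. if j \<le> n then T v $ j else eval_at v \<mu>) (\<rho> i)"
      unfolding ev_subst
    proof (rule ev_cong[of _ "n + 1"])
      show "\<rho> i \<in> U (n + 1)" using \<rho>(1) i by (auto simp: forms_iff)
    qed (simp add: T_def eval_at_eq)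
    finally show "V (T v) (eval_at v \<mu>) $ i = v $ i" using i by (simp add: V_def)
  qed (use v in \<open>simp add: V_def\<close>)
  have T_add: "T (v + w) = T v + T w" if "v \<in> carrier_vec (n + 2)" "w \<in> carrier_vec (n + 2)" for v w
    unfolding T_def using that \<kappa> eval_at_linear_add[of _ "n + 1" v w] by (intro eq_vecI) auto
  have T_smult: "T (a \<cdot>\<^sub>v v) = a \<cdot>\<^sub>v T v" if "v \<in> carrier_vec (n + 2)" for v a
    unfolding T_def using that \<kappa> eval_at_linear_smult[of _ "n + 1" v a] by (intro eq_vecI) auto
  have \<mu>_add: "eval_at (v + w) \<mu> = eval_at v \<mu> + eval_at w \<mu>" if "v \<in> carrier_vec (n + 2)" "w \<in> carrier_vec (n + 2)" for v w
    using that by (intro eval_at_linear_add[OF \<mu>]) auto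
  have ev_\<kappa>: "eval_at v (subst \<kappa> p) = eval_at (T v) p" if "p \<in> U n" for v p
    unfolding eval_at_eq ev_subst by (rule ev_cong[OF that]) (simp add: T_def eval_at_eq)
  have Q_eval: "eval_at v Q = c * (eval_at (T v) q - eval_at v \<mu> * eval_at (T v) l)" for v
  proof -
    have "eval_at v Q = c * (eval_at v (subst \<kappa> q) - eval_at v \<mu> * eval_at v (subst \<kappa> l))"
      unfolding Q(3) eval_at_eq by (simp add: ev.hom_mult ev.hom_minus)
    then show ?thesis using q l(1) by (simp add: ev_\<kappa> forms_iff)
  qed
  have S_iff: "v \<in> mat_kernel S \<longleftrightarrow> v \<in> carrier_vec (n + 2) \<and> eval_at (T v) l = 0 \<and>
      (\<forall>t\<in>carrier_vec (n + 1). 2 * (t \<bullet> (M *\<^sub>v T v)) = eval_at v \<mu> * eval_at t l)" for v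
  proof (cases "v \<in> carrier_vec (n + 2)")
    case v: True
    have polar: "2 * (w \<bullet> (S *\<^sub>v v)) = c * (2 * (T w \<bullet> (M *\<^sub>v T v)) - eval_at v \<mu> * eval_at (T w) l - eval_at w \<mu> * eval_at (T v) l)"
      if w: "w \<in> carrier_vec (n + 2)" for w
    proof -
      have "2 * (w \<bullet> (S *\<^sub>v v)) = eval_at (v + w) Q - eval_at v Q - eval_at w Q"
        using polar_form[OF Q(1), of v w] v w by (simp add: S_def)
      also have "\<dots> = c * (eval_at (T v + T w) q - eval_at (T v) q - eval_at (T w) q
         - (eval_at v \<mu> + eval_at w \<mu>) * eval_at (T v + T w) l + eval_at v \<mu> * eval_at (T v) l + eval_at w \<mu> * eval_at (T w) l)"
        unfolding Q_eval T_add[OF v w] \<mu>_add[OF v w] by (simp add: algebra_simps)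
      also have "\<dots> = c * (2 * (T w \<bullet> (M *\<^sub>v T v)) - eval_at v \<mu> * eval_at (T w) l - eval_at w \<mu> * eval_at (T v) l)"
        unfolding polar_form[OF q T T] eval_at_linear_add[OF l(1) T T] M_def by (simp add: algebra_simps)
      finally show ?thesis .
    qed
    show ?thesis
    proof
      assume "v \<in> mat_kernel S"
      then have "S *\<^sub>v v = 0\<^sub>v (n + 2)" using S by (simp add: mat_kernel)
      then have eq: "2 * (T w \<bullet> (M *\<^sub>v T v)) - eval_at v \<mu> * eval_at (T w) l - eval_at w \<mu> * eval_at (T v) l = 0"
        if "w \<in> carrier_vec (n + 2)" for w using polar[OF that] that Q(2) by simp
      have eq': "2 * (t \<bullet> (M *\<^sub>v T v)) - eval_at v \<mu> * eval_at t l - s * eval_at (T v) l = 0"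
        if "t \<in> carrier_vec (n + 1)" for t s
        using eq[OF V[of t s]] unfolding TV[OF that] \<mu>V[OF that] .
      \<comment> \<open>At \<open>t = 0\<close>, comparing \<open>s = 1\<close> with
        \<open>s = 0\<close> isolates the value of \<open>l\<close>.\<close>
      have "eval_at (T v) l = 0" using eq'[of "0\<^sub>v (n + 1)" 1] eq'[of "0\<^sub>v (n + 1)" 0] by simp
      then show "v \<in> carrier_vec (n + 2) \<and> eval_at (T v) l = 0 \<and>
          (\<forall>t\<in>carrier_vec (n + 1). 2 * (t \<bullet> (M *\<^sub>v T v)) = eval_at v \<mu> * eval_at t l)"
        using v eq'[of _ 0] by simp
    next
      assume *: "v \<in> carrier_vec (n + 2) \<and> eval_at (T v) l = 0 \<and>
          (\<forall>t\<in>carrier_vec (n + 1). 2 * (t \<bullet> (M *\<^sub>v T v)) = eval_at v \<mu> * eval_at t l)"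
      have "w \<bullet> (S *\<^sub>v v) = 0" if "w \<in> carrier_vec (n + 2)" for w
        using polar[OF that] * T by simp
      then have "S *\<^sub>v v = 0\<^sub>v (n + 2)" using S v by (intro vec_zero_if_orthogonal) auto
      then show "v \<in> mat_kernel S" using S v by (simp add: mat_kernel)
    qed
  qed (use S in \<open>simp add: mat_kernel\<close>)
  have inj_A: "inj_on (\<lambda>u. A *\<^sub>v u) (carrier_vec n)" and img_A: "(\<lambda>u. A *\<^sub>v u) ` carrier_vec n = {v \<in> carrier_vec (n + 1). eval_at v l = 0}"
    using A(2) by (auto simp: bij_betw_def)
  have B_prod: "u' \<bullet> (B *\<^sub>v u) = (A *\<^sub>v u') \<bullet> (M *\<^sub>v (A *\<^sub>v u))" if u: "u \<in> carrier_vec n" "u' \<in> carrier_vec n" for u u'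
  proof -
    have c1: "A *\<^sub>v u \<in> carrier_vec (n + 1)" "A *\<^sub>v u' \<in> carrier_vec (n + 1)" using A(1) u by auto
    then have c2: "M *\<^sub>v (A *\<^sub>v u) \<in> carrier_vec (n + 1)" using M by auto
    have At: "transpose_mat A \<in> carrier_mat n (n + 1)" using A(1) by simp
    have "B *\<^sub>v u = transpose_mat A *\<^sub>v (M *\<^sub>v (A *\<^sub>v u))"
      unfolding B_def assoc_mult_mat_vec[OF mult_carrier_mat[OF At M] A(1) u(1)] by (rule assoc_mult_mat_vec[OF At M c1(1)])
    then have "u' \<bullet> (B *\<^sub>v u) = (transpose_mat A *\<^sub>v (M *\<^sub>v (A *\<^sub>v u))) \<bullet> u'"
      using u At c2 by (subst comm_scalar_prod[of _ n]) auto
    also have "\<dots> = (M *\<^sub>v (A *\<^sub>v u)) \<bullet> (A *\<^sub>v u')"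
      by (rule transpose_vec_mult_scalar[OF A(1) u(2) c2])
    also have "\<dots> = (A *\<^sub>v u') \<bullet> (M *\<^sub>v (A *\<^sub>v u))" using c1 c2 by (rule_tac comm_scalar_prod)
    finally show ?thesis .
  qed
  \<comment> \<open>A kernel vector is sent to its \<open>T\<close>-part, read in the coordinates
    \<open>A\<close> of the hyperplane.\<close>
  define \<phi> where "\<phi> = (\<lambda>v. inv_into (carrier_vec n) (\<lambda>u. A *\<^sub>v u) (T v))"
  have \<phi>: "\<phi> v \<in> carrier_vec n" "A *\<^sub>v \<phi> v = T v" if "v \<in> mat_kernel S" for v
  proof -
    have "T v \<in> (\<lambda>u. A *\<^sub>v u) ` carrier_vec n" using that T unfolding img_A S_iff by simp
    then show "\<phi> v \<in> carrier_vec n" "A *\<^sub>v \<phi> v = T v"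
      unfolding \<phi>_def by (auto intro: inv_into_into f_inv_into_f)
  qed
  have kerS_vec: "v \<in> carrier_vec (n + 2)" if "v \<in> mat_kernel S" for v using that unfolding S_iff by simp
  \<comment> \<open>A vector off the hyperplane: testing the kernel condition with \<open>t0\<close>
    reads off the value under \<open>\<mu>\<close>.\<close>
  obtain t0 where t0: "t0 \<in> carrier_vec (n + 1)" "eval_at t0 l = 1"
  proof -
    obtain k where k: "k \<le> n" "lcoeff l k \<noteq> 0" using linear_form_nonzero[OF l] by blast
    let ?t = "vec (n + 1) (\<lambda>i. if i = k then 1 / lcoeff l k else 0)"
    have "eval_at ?t l = (\<Sum>i\<le>n. lcoeff l i * (if i = k then 1 / lcoeff l k else 0))"
      unfolding eval_at_linear_form[OF l(1)] by (intro sum.cong refl) simp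
    also have "\<dots> = 1" using k by (simp add: if_distrib[of "\<lambda>x. _ * x"] cong: if_cong)
    finally show ?thesis by (intro that[of ?t]) auto
  qed
  have A_inj: "u = u'" if "u \<in> carrier_vec n" "u' \<in> carrier_vec n" "A *\<^sub>v u = A *\<^sub>v u'" for u u'
    using inj_onD[OF inj_A that(3) that(1,2)] .
  have "kernel_dim S = kernel_dim B"
  proof (rule kernel_dim_eq[OF S B])
    fix v w assume vw: "v \<in> mat_kernel S" "w \<in> mat_kernel S"
    have sum: "v + w \<in> mat_kernel S"
      using vw S kerS_vec[OF vw(1)] kerS_vec[OF vw(2)] by (simp add: mat_kernel[OF S] mult_add_distrib_mat_vec[OF S])
    show "\<phi> (v + w) = \<phi> v + \<phi> w"
    proof (rule A_inj)
      show "A *\<^sub>v \<phi> (v + w) = A *\<^sub>v (\<phi> v + \<phi> w)"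
        using \<phi>[OF vw(1)] \<phi>[OF vw(2)] \<phi>[OF sum] T_add[OF kerS_vec[OF vw(1)] kerS_vec[OF vw(2)]]
        by (simp add: mult_add_distrib_mat_vec[OF A(1)])
    qed (use \<phi>[OF vw(1)] \<phi>[OF vw(2)] \<phi>[OF sum] in auto)
  next
    fix a v assume v: "v \<in> mat_kernel S"
    have av: "a \<cdot>\<^sub>v v \<in> mat_kernel S"
    proof -
      have "a \<cdot>\<^sub>v 0\<^sub>v (n + 2) = (0\<^sub>v (n + 2) :: complex vec)" by (intro eq_vecI) auto
      then show ?thesis using v kerS_vec[OF v] by (simp add: mat_kernel[OF S] mult_mat_vec[OF S])
    qed
    show "\<phi> (a \<cdot>\<^sub>v v) = a \<cdot>\<^sub>v \<phi> v"
    proof (rule A_inj)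
      show "A *\<^sub>v \<phi> (a \<cdot>\<^sub>v v) = A *\<^sub>v (a \<cdot>\<^sub>v \<phi> v)"
        using \<phi>[OF v] \<phi>[OF av] T_smult[OF kerS_vec[OF v]] by (simp add: mult_mat_vec[OF A(1)])
    qed (use \<phi>[OF v] \<phi>[OF av] in auto)
  next
    show "bij_betw \<phi> (mat_kernel S) (mat_kernel B)"
      unfolding bij_betw_def
    proof
      show "inj_on \<phi> (mat_kernel S)"
      proof (rule inj_onI)
        fix v w assume vw: "v \<in> mat_kernel S" "w \<in> mat_kernel S" "\<phi> v = \<phi> w"
        then have Teq: "T v = T w" using \<phi>(2)[OF vw(1)] \<phi>(2)[OF vw(2)] by simp
        have "eval_at v \<mu> * eval_at t0 l = eval_at w \<mu> * eval_at t0 l"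
        proof -
          have "2 * (t0 \<bullet> (M *\<^sub>v T v)) = eval_at v \<mu> * eval_at t0 l"
            using vw(1) t0(1) unfolding S_iff by blast
          moreover have "2 * (t0 \<bullet> (M *\<^sub>v T w)) = eval_at w \<mu> * eval_at t0 l"
            using vw(2) t0(1) unfolding S_iff by blast
          ultimately show ?thesis by (simp only: Teq)
        qed
        then have \<mu>eq: "eval_at v \<mu> = eval_at w \<mu>" using t0(2) by simp
        have "v = V (T v) (eval_at v \<mu>)" by (rule VT[OF kerS_vec[OF vw(1)], symmetric])
        also have "\<dots> = V (T w) (eval_at w \<mu>)" by (simp only: Teq \<mu>eq)
        also have "\<dots> = w" by (rule VT[OF kerS_vec[OF vw(2)]])
        finally show "v = w" .
      qed
      show "\<phi> ` mat_kernel S = mat_kernel B"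
      proof (intro subset_antisym subsetI)
        fix u assume "u \<in> \<phi> ` mat_kernel S"
        then obtain v where v: "v \<in> mat_kernel S" "u = \<phi> v" by blast
        note u = \<phi>[OF v(1), folded v(2)]
        have "u' \<bullet> (B *\<^sub>v u) = 0" if u': "u' \<in> carrier_vec n" for u'
        proof -
          have "A *\<^sub>v u' \<in> {v \<in> carrier_vec (n + 1). eval_at v l = 0}" using u' img_A by blast
          then have "2 * ((A *\<^sub>v u') \<bullet> (M *\<^sub>v T v)) = 0" using v(1) unfolding S_iff by simp
          then show ?thesis using B_prod[OF u(1) u'] u(2) by simp
        qed
        then have "B *\<^sub>v u = 0\<^sub>v n" using B u by (intro vec_zero_if_orthogonal) auto
        then show "u \<in> mat_kernel B" using u by (simp add: mat_kernel[OF B])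
      next
        fix u assume "u \<in> mat_kernel B"
        then have u: "u \<in> carrier_vec n" "B *\<^sub>v u = 0\<^sub>v n" by (simp_all add: mat_kernel[OF B])
        define t where "t = A *\<^sub>v u"
        have t: "t \<in> carrier_vec (n + 1)" "eval_at t l = 0" using u(1) img_A unfolding t_def by blast+
        have Mt: "M *\<^sub>v t \<in> carrier_vec (n + 1)" using M t by auto
        \<comment> \<open>The kernel condition tested with \<open>t0\<close> forces this
          value.\<close>
        define s where "s = 2 * (t0 \<bullet> (M *\<^sub>v t))"
        have "2 * (t' \<bullet> (M *\<^sub>v t)) = s * eval_at t' l" if t': "t' \<in> carrier_vec (n + 1)" for t'
        proof -
          \<comment> \<open>\<open>t'\<close> splits into a vector \<open>d\<close> of the
            hyperplane and a multiple of \<open>t0\<close>; on \<open>d\<close> the polar form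
            vanishes because \<open>u\<close> is in the kernel of \<open>B\<close>.\<close>
          define d where "d = t' + (- eval_at t' l) \<cdot>\<^sub>v t0"
          have d: "d \<in> carrier_vec (n + 1)" using t' t0 by (simp add: d_def)
          have "eval_at d l = 0"
            unfolding d_def using t' t0 by (simp add: eval_at_linear_add[OF l(1)] eval_at_linear_smult[OF l(1)])
          then obtain u' where u': "u' \<in> carrier_vec n" "d = A *\<^sub>v u'" using d img_A by blast
          have "d \<bullet> (M *\<^sub>v t) = u' \<bullet> (B *\<^sub>v u)" unfolding u'(2) t_def using B_prod[OF u(1) u'(1)] by simp
          then have "d \<bullet> (M *\<^sub>v t) = 0" using u(2) u'(1) by simp
          moreover have "d \<bullet> (M *\<^sub>v t) = t' \<bullet> (M *\<^sub>v t) + (- eval_at t' l) * (t0 \<bullet> (M *\<^sub>v t))"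
            unfolding d_def using t' t0(1) Mt by (simp add: add_scalar_prod_distrib[of _ "n + 1"])
          ultimately show ?thesis by (simp add: s_def)
        qed
        then have ker: "V t s \<in> mat_kernel S"
          unfolding S_iff using V TV[OF t(1)] \<mu>V[OF t(1)] t(2) by simp
        have "\<phi> (V t s) = u"
          by (rule A_inj) (use \<phi>[OF ker] u TV[OF t(1)] t_def in auto)
        then show "u \<in> \<phi> ` mat_kernel S" using ker by blast
      qed
    qed
  qed
  \<comment> \<open>Kernels of equal dimension in spaces of dimensions \<open>n + 2\<close> and
    \<open>n\<close> give ranks that differ by 2.\<close>
  moreover have "vec_space.rank (n + 2) S + kernel_dim S = n + 2" by (rule rank_add_kernel_dim[OF S])
  moreover have "vec_space.rank n B + kernel_dim B = n" by (rule rank_add_kernel_dim[OF B])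
  ultimately show ?thesis unfolding S_def B_def M_def by simp
qed

theorem proposition2p3:
  fixes n :: nat and f :: "nat \<Rightarrow> cpoly"
  assumes birational: "quadratic_birational n f"
    and hypersurface: "\<exists>e. hypersurface (n + 1) e (image_closure n f)"
    and normal: "normal_variety (n + 1) (image_closure n f)"
    and not_hyperplane: "\<not> hypersurface (n + 1) 1 (image_closure n f)"
  shows "(h0_ideal_sheaf n (base_locus n f) 1 \<noteq> 0 \<longleftrightarrow> codim2_quadric n (base_locus n f)) \<and>
         (codim2_quadric n (base_locus n f) \<longleftrightarrow> complete_intersection n (base_locus n f)) \<and>
         (complete_intersection n (base_locus n f) \<longleftrightarrow> of_type_2 n f 1) \<and>
         (h0_ideal_sheaf n (base_locus n f) 1 \<noteq> 0 \<or> codim2_quadric n (base_locus n f) \<or>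
          complete_intersection n (base_locus n f) \<or> of_type_2 n f 1 \<longrightarrow>
            hypersurface (n + 1) 2 (image_closure n f) \<and>
            (\<forall>r s. codim2_quadric_of_rank n (base_locus n f) r \<and>
                   quadric_of_rank (n + 1) (image_closure n f) s \<longrightarrow> int r = int s - 2))"
proof -
  interpret quadratic_birational_hypersurface n f by unfold_locales fact+
  have a: "h0_ideal_sheaf n Z 1 \<noteq> 0 \<longleftrightarrow> codim2_quadric n Z"
    unfolding h0_iff using linear_form_imp_quadric quadric_imp_complete_intersection complete_intersection_imp_linear_form by metis
  have b: "codim2_quadric n Z \<longleftrightarrow> complete_intersection n Z"
    using linear_form_imp_quadric quadric_imp_complete_intersection complete_intersection_imp_linear_form by metis
  have c: "complete_intersection n Z \<longleftrightarrow> of_type_2 n f 1"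
    using b a linear_form_imp_type_2_1 type_2_1_imp_linear_form unfolding h0_iff by metis
  have hyp: "hypersurface (n + 1) 2 I" if "codim2_quadric n Z"
  proof -
    obtain l q where lq: "quadric_in_hyperplane n Z l q" using \<open>codim2_quadric n Z\<close> unfolding codim2_quadric_def by blast
    show ?thesis using image_equation[OF lq] by blast
  qed
  have rank: "int r = int s - 2" if r: "codim2_quadric_of_rank n Z r" and s: "quadric_of_rank (n + 1) I s" for r s
  proof -
    obtain l q A where lq: "quadric_in_hyperplane n Z l q" and A: "A \<in> carrier_mat (n + 1) n"
      "bij_betw (\<lambda>u. A *\<^sub>v u) (carrier_vec n) {v \<in> carrier_vec (n + 1). eval_at v l = 0}"
      and r': "r = vec_space.rank n (transpose_mat A * gram n q * A)"
      using r unfolding codim2_quadric_of_rank_def by blast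
    obtain Q where Q: "Q \<in> forms (n + 1) 2" "Q \<noteq> 0" "I = subscheme (n + 1) {Q}"
      and s': "s = vec_space.rank (n + 1 + 1) (gram (n + 1) Q)"
      using s unfolding quadric_of_rank_def by blast
    note D = quadric_in_hyperplaneD[OF lq]
    obtain \<kappa> \<mu> \<rho> where k: "\<forall>i\<le>n. \<kappa> i \<in> forms (n + 1) 1" "\<mu> \<in> forms (n + 1) 1"
      "\<forall>i\<le>n + 1. \<rho> i \<in> forms (n + 1) 1"
      "\<forall>i\<le>n + 1. subst (\<lambda>i. if i \<le> n then \<kappa> i else \<mu>) (\<rho> i) = Var i"
      "\<forall>i\<le>n. subst \<rho> (\<kappa> i) = Var i" "subst \<rho> \<mu> = Var (n + 1)"
      "\<forall>Q. Q \<in> forms (n + 1) 2 \<longrightarrow> Q \<noteq> 0 \<longrightarrow> I = subscheme (n + 1) {Q} \<longrightarrow>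
         (\<exists>c. c \<noteq> 0 \<and> Q = Const c * (subst \<kappa> q - \<mu> * subst \<kappa> l))"
      using image_equation[OF lq] by blast
    obtain c where c: "c \<noteq> 0" "Q = Const c * (subst \<kappa> q - \<mu> * subst \<kappa> l)"
      using k(7) Q by blast
    show ?thesis
      using rank_quadric_plus_hyperbolic_plane[OF D(1,2,4) k(1-6) Q(1) c A] unfolding r' s' by simp
  qed
  show ?thesis using a b c hyp rank by blast
qed

end
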